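(* Let $A$ be a finite dimensional associative algebra and $\mathfrak g$ be a finite dimensional semisimple Lie algebra over an algebraically closed field $F$ of characteristic $0$. Suppose $\mathfrak g$ is acting on $A$ by derivations. Then there exists a maximal semisimple subalgebra $B$ in $A$ such that $A=B\oplus J(A)$ (direct sum of $\mathfrak g$-submodules), where $J(A)$ is the Jacobson radical of $A$.
   Context: Associative algebras are not assumed to have a unit. An action of $\mathfrak g$ on $A$ by derivations is a homomorphism of Lie algebras from $\mathfrak g$ to the Lie algebra of derivations of $A$. *)

theory Defs
  imports "HOL-Computational_Algebra.Polynomial"
begin

text \<open>
  Associative algebras over a field, not assumed unital: the class \<^class>\<open>ring\<close> has no unit.
  Subalgebras are subsets of the ambient algebra, and notions that apply to an algebra
  in its own right (ideals, radical, semisimplicity) are relativised to a subalgebra \<open>R\<close>;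
  the ambient algebra itself is \<open>R = UNIV\<close>.
\<close>

locale associative_algebra = vector_space scale
  for scale :: "'k::field \<Rightarrow> 'a::ring \<Rightarrow> 'a" (infixr \<open>*\<^sub>A\<close> 75) +
  assumes scale_mult_left: "(c *\<^sub>A x) * y = c *\<^sub>A (x * y)"
    and scale_mult_right: "x * (c *\<^sub>A y) = c *\<^sub>A (x * y)"
begin

definition subalgebra :: "'a set \<Rightarrow> bool" where
  "subalgebra R \<longleftrightarrow> subspace R \<and> (\<forall>x\<in>R. \<forall>y\<in>R. x * y \<in> R)"

definition left_ideal :: "'a set \<Rightarrow> 'a set \<Rightarrow> bool" where
  "left_ideal R L \<longleftrightarrow> subspace L \<and> L \<subseteq> R \<and> (\<forall>r\<in>R. \<forall>x\<in>L. r * x \<in> L)"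

definition maximal_left_ideal :: "'a set \<Rightarrow> 'a set \<Rightarrow> bool" where
  "maximal_left_ideal R L \<longleftrightarrow>
     left_ideal R L \<and> L \<noteq> R \<and> (\<forall>K. left_ideal R K \<and> L \<subseteq> K \<longrightarrow> K = L \<or> K = R)"

text \<open>A left ideal is modular (regular) if it admits a right unit modulo itself.\<close>

definition modular_left_ideal :: "'a set \<Rightarrow> 'a set \<Rightarrow> bool" where
  "modular_left_ideal R L \<longleftrightarrow> left_ideal R L \<and> (\<exists>e\<in>R. \<forall>x\<in>R. x - x * e \<in> L)"

text \<open>
  The Jacobson radical of a possibly non-unital algebra is the intersection of its modular
  maximal left ideals, and the whole algebra if there are none. In a unital algebra every
  left ideal is modular (take \<open>e = 1\<close>); without a unit, modularity cannot be omitted.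
  The modular maximal left ideals are the annihilators of nonzero vectors of simple left
  modules, so this is also the intersection of the annihilators of all simple left modules.
\<close>

definition jacobson_radical :: "'a set \<Rightarrow> 'a set" where
  "jacobson_radical R = R \<inter> \<Inter> {L. maximal_left_ideal R L \<and> modular_left_ideal R L}"

text \<open>Semisimplicity is meant for finite dimensional subalgebras; the zero algebra is semisimple.\<close>

definition semisimple_subalgebra :: "'a set \<Rightarrow> bool" where
  "semisimple_subalgebra R \<longleftrightarrow> subalgebra R \<and> jacobson_radical R = {0}"

definition maximal_semisimple_subalgebra :: "'a set \<Rightarrow> bool" where
  "maximal_semisimple_subalgebra B \<longleftrightarrow>
     semisimple_subalgebra B \<and> (\<forall>C. semisimple_subalgebra C \<and> B \<subseteq> C \<longrightarrow> C = B)"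

definition derivation :: "('a \<Rightarrow> 'a) \<Rightarrow> bool" where
  "derivation d \<longleftrightarrow>
     Vector_Spaces.linear (*\<^sub>A) (*\<^sub>A) d \<and> (\<forall>x y. d (x * y) = d x * y + x * d y)"

end

locale lie_algebra = vector_space scale
  for scale :: "'k::field \<Rightarrow> 'l::ab_group_add \<Rightarrow> 'l" (infixr \<open>*\<^sub>L\<close> 75) +
  fixes bracket :: "'l \<Rightarrow> 'l \<Rightarrow> 'l"
  assumes bracket_linear_left: "Vector_Spaces.linear (*\<^sub>L) (*\<^sub>L) (\<lambda>x. bracket x y)"
    and bracket_linear_right: "Vector_Spaces.linear (*\<^sub>L) (*\<^sub>L) (bracket x)"
    and bracket_self: "bracket x x = 0"
    and jacobi: "bracket x (bracket y z) + bracket y (bracket z x) + bracket z (bracket x y) = 0"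
begin

definition lie_ideal :: "'l set \<Rightarrow> bool" where
  "lie_ideal I \<longleftrightarrow> subspace I \<and> (\<forall>x. \<forall>y\<in>I. bracket x y \<in> I)"

primrec derived_series :: "'l set \<Rightarrow> nat \<Rightarrow> 'l set" where
  "derived_series I 0 = I"
| "derived_series I (Suc n) =
     span {bracket x y | x y. x \<in> derived_series I n \<and> y \<in> derived_series I n}"

definition solvable :: "'l set \<Rightarrow> bool" where
  "solvable I \<longleftrightarrow> (\<exists>n. derived_series I n = {0})"

definition semisimple :: bool where
  "semisimple \<longleftrightarrow> (\<forall>I. lie_ideal I \<and> solvable I \<longrightarrow> I = {0})"

end

text \<open>
  An action by derivations: a Lie algebra homomorphism into the Lie algebra of derivations,
  whose vector space structure is pointwise and whose bracket is the commutator.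
\<close>

locale action_by_derivations =
  A: associative_algebra scaleA + L: lie_algebra scaleL bracket
  for scaleA :: "'k::field \<Rightarrow> 'a::ring \<Rightarrow> 'a" (infixr \<open>*\<^sub>A\<close> 75)
    and scaleL :: "'k \<Rightarrow> 'l::ab_group_add \<Rightarrow> 'l" (infixr \<open>*\<^sub>L\<close> 75)
    and bracket :: "'l \<Rightarrow> 'l \<Rightarrow> 'l" +
  fixes act :: "'l \<Rightarrow> 'a \<Rightarrow> 'a"
  assumes act_derivation: "A.derivation (act x)"
    and act_add: "act (x + y) a = act x a + act y a"
    and act_scale: "act (c *\<^sub>L x) a = c *\<^sub>A act x a"
    and act_bracket: "act (bracket x y) a = act x (act y a) - act y (act x a)"
begin

definition submodule :: "'a set \<Rightarrow> bool" where
  "submodule V \<longleftrightarrow> A.subspace V \<and> (\<forall>x. \<forall>v\<in>V. act x v \<in> V)"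

definition direct_sum_of_submodules :: "'a set \<Rightarrow> 'a set \<Rightarrow> bool" where
  "direct_sum_of_submodules V W \<longleftrightarrow>
     submodule V \<and> submodule W \<and> V \<inter> W = {0} \<and> {v + w | v w. v \<in> V \<and> w \<in> W} = UNIV"

end

end

theory Submission
  imports Defs "HOL-Library.Function_Algebras"
begin

text \<open>
  Let \<open>J\<close> be the radical of \<open>A\<close> and \<open>S = A/J\<close>. The point is to split \<open>A \<rightarrow> S\<close> compatibly with
  \<open>\<gg>\<close>, first linearly and then multiplicatively.

  The radical is the kernel of the form \<open>(x, y) \<mapsto> tr L\<^sub>x\<^sub>y\<close> on \<open>A\<close>: products with a nil element have
  nilpotent left multiplications, and conversely an element of the kernel that is not nilpotent
  would produce a nonzero idempotent \<open>e\<close> with \<open>0 = tr L\<^sub>e = dim eA\<close>. Derivations preserve this form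
  because \<open>L\<^sub>\<delta>\<^sub>x = [\<delta>, L\<^sub>x]\<close> has trace zero, so they preserve \<open>J\<close>
  (\<open>derivation_preserves_radical\<close>).

  Since \<open>\<gg>\<close> is semisimple, \<open>J\<close> has a \<open>\<gg>\<close>-stable linear complement. A linear projection \<open>p\<close> onto \<open>J\<close>
  fails to be equivariant by the cocycle \<open>x \<mapsto> [x, p]\<close> with values in the module \<open>Hom(A/J, J)\<close>, and
  Whitehead's lemma \<open>H\<^sup>1(\<gg>, M) = 0\<close> makes it a coboundary, which corrects \<open>p\<close>
  (\<open>equivariant_projection_exists\<close>). Whitehead's lemma reduces to irreducible \<open>M\<close>; unless
  the action is trivial, the Casimir operator of the trace form of \<open>M\<close> is then invertible and solves
  the cocycle equation. The
  nondegeneracy of the trace forms involved rests on Cartan's criterion and on Engel's theorem.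

  Now let \<open>s : S \<rightarrow> A\<close> be an equivariant linear section, and \<open>f(u, v) = s(u)s(v) - s(uv)\<close> its defect,
  with values in an ideal \<open>I \<subseteq> J\<close>. Modulo \<open>I\<^sup>2\<close> the defect is a Hochschild 2-cocycle. The form
  \<open>tr L\<^sub>u\<^sub>v\<close> on \<open>S\<close> is nondegenerate; if \<open>(b), (d b)\<close> are dual bases for it, then
  \<open>\<Sum> b \<otimes> d b\<close> is a separability idempotent of \<open>S\<close>, and it is annihilated by every derivation.
  Contracting \<open>f\<close> with it gives an equivariant \<open>h\<close> whose coboundary is \<open>f\<close>, so that the section
  \<open>s - h\<close> has its defect in \<open>I\<^sup>2\<close> (\<open>lifting_step\<close>). A nonzero nil ideal is larger than its
  square, so the defect can be pushed down to zero, and the image of a multiplicative equivariant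
  section is the required subalgebra. It is semisimple because it is isomorphic to \<open>S\<close>; it is maximal
  because a larger subalgebra \<open>C\<close> meets \<open>J\<close> in a nonzero nil left ideal of \<open>C\<close>.
\<close>

section \<open>Finite-dimensional subspaces, traces and dual bases\<close>

lemma lin_add: "Vector_Spaces.linear s1 s2 f \<Longrightarrow> f (x + y) = f x + f y"
  and lin_scale: "Vector_Spaces.linear s1 s2 f \<Longrightarrow> f (s1 c x) = s2 c (f x)"
  by (simp_all add: Vector_Spaces.linear_iff)

lemma lin_zero: "Vector_Spaces.linear s1 s2 f \<Longrightarrow> f 0 = 0"
  using lin_add[of s1 s2 f 0 0] by simp

lemma lin_neg: "Vector_Spaces.linear s1 s2 f \<Longrightarrow> f (- x) = - f x"
  using lin_add[of s1 s2 f x "- x"] lin_zero[of s1 s2 f] by (metis add.right_inverse minus_unique)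

lemma lin_diff: "Vector_Spaces.linear s1 s2 f \<Longrightarrow> f (x - y) = f x - f y"
  using lin_add[of s1 s2 f x "- y"] lin_neg[of s1 s2 f y] by (metis diff_conv_add_uminus)

lemma lin_sum: "Vector_Spaces.linear s1 s2 f \<Longrightarrow> f (sum g I) = (\<Sum>i\<in>I. f (g i))"
  by (induction I rule: infinite_finite_induct) (simp_all add: lin_zero[of s1 s2 f] lin_add[of s1 s2 f])

lemma lin_comp:
  "Vector_Spaces.linear s1 s2 f \<Longrightarrow> Vector_Spaces.linear s2 s3 g \<Longrightarrow>
   Vector_Spaces.linear s1 s3 (\<lambda>x. g (f x))"
  by (simp add: Vector_Spaces.linear_iff)

lemma vector_space_mult: "vector_space ((*) :: 'k::field \<Rightarrow> 'k \<Rightarrow> 'k)"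
  by unfold_locales (simp_all add: algebra_simps)

text \<open>
  Modules are subspaces \<open>M\<close> of a type, and operators on \<open>M\<close> are maps that are linear everywhere
  and send \<open>M\<close> into itself. Submodules, quotients (through a projection) and modules of
  homomorphisms then all have this same form, which is what inductions over modules need.
\<close>

locale lin_space = vector_space scale
  for scale :: "'a::field \<Rightarrow> 'b::ab_group_add \<Rightarrow> 'b" (infixr \<open>*s\<close> 75)
begin

abbreviation lin :: "('b \<Rightarrow> 'b) \<Rightarrow> bool" where
  "lin \<equiv> Vector_Spaces.linear scale scale"

abbreviation functional :: "('b \<Rightarrow> 'a) \<Rightarrow> bool" where
  "functional \<equiv> Vector_Spaces.linear scale (*)"

lemma linI: "(\<And>x y. T (x + y) = T x + T y) \<Longrightarrow> (\<And>c x. T (c *s x) = c *s T x) \<Longrightarrow> lin T"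
  by (simp add: Vector_Spaces.linear_iff vector_space_axioms)

lemma functionalI:
  "(\<And>x y. \<psi> (x + y) = \<psi> x + \<psi> y) \<Longrightarrow> (\<And>c x. \<psi> (c *s x) = c * \<psi> x) \<Longrightarrow> functional \<psi>"
  by (simp add: Vector_Spaces.linear_iff vector_space_axioms vector_space_mult)

lemma lin_id: "lin (\<lambda>v. v)"
  by (intro linI) auto

lemma lin_plus: "lin S \<Longrightarrow> lin T \<Longrightarrow> lin (\<lambda>v. S v + T v)"
  by (simp add: Vector_Spaces.linear_iff algebra_simps)

lemma lin_minus: "lin S \<Longrightarrow> lin T \<Longrightarrow> lin (\<lambda>v. S v - T v)"
  by (simp add: Vector_Spaces.linear_iff algebra_simps)

lemma lin_smult: "lin T \<Longrightarrow> lin (\<lambda>v. c *s T v)"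
  by (simp add: Vector_Spaces.linear_iff algebra_simps)

lemma lin_sums: "(\<And>i. i \<in> I \<Longrightarrow> lin (T i)) \<Longrightarrow> lin (\<lambda>v. \<Sum>i\<in>I. T i v)"
  by (intro linI) (simp_all add: Vector_Spaces.linear_iff sum.distrib scale_sum_right)

lemma lin_null: "lin (\<lambda>v. 0)"
  by (intro linI) auto

lemma lin_funpow: "lin T \<Longrightarrow> lin (T ^^ n)"
  by (induction n) (simp_all add: Vector_Spaces.linear_iff vector_space_axioms)

lemma funpow_mem: "T ` M \<subseteq> M \<Longrightarrow> v \<in> M \<Longrightarrow> (T ^^ n) v \<in> M"
  by (induction n) auto

definition fdim :: "'b set \<Rightarrow> bool" where
  "fdim M \<longleftrightarrow> subspace M \<and> (\<exists>B. finite B \<and> M \<subseteq> span B)"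

lemma fdim_subspace: "fdim M \<Longrightarrow> subspace M"
  by (simp add: fdim_def)

lemma fdim_subset: "fdim M \<Longrightarrow> subspace N \<Longrightarrow> N \<subseteq> M \<Longrightarrow> fdim N"
  unfolding fdim_def by blast

lemma fdim_basis_extend:
  assumes M: "fdim M" and C: "C \<subseteq> M" "independent C"
  obtains B where "C \<subseteq> B" "B \<subseteq> M" "finite B" "independent B" "span B = M"
proof -
  obtain B where B: "C \<subseteq> B" "B \<subseteq> M" "independent B" "M \<subseteq> span B"
    using maximal_independent_subset_extend[OF C] by blast
  obtain F where F: "finite F" "M \<subseteq> span F" using M by (auto simp: fdim_def)
  have "finite B" using independent_span_bound[OF F(1) B(3)] B(2) F(2) by blast
  moreover have "span B = M"
    using B M by (intro span_subspace) (auto simp: fdim_def)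
  ultimately show ?thesis using that B by blast
qed

lemma fdim_basis:
  assumes "fdim M"
  obtains B where "B \<subseteq> M" "finite B" "independent B" "span B = M" "card B = dim M"
  using fdim_basis_extend[OF assms, of "{}"] independent_empty
  by (metis dim_span_eq_card_independent empty_subsetI)

lemma fdim_psubset_dim:
  assumes M: "fdim M" and N: "subspace N" "N \<subset> M"
  shows "dim N < dim M"
proof -
  obtain C where C: "C \<subseteq> N" "finite C" "independent C" "span C = N" "card C = dim N"
    using fdim_basis[OF fdim_subset[OF M N(1)]] N(2) by blast
  obtain B where B: "C \<subseteq> B" "B \<subseteq> M" "finite B" "independent B" "span B = M"
    using fdim_basis_extend[OF M, of C] C N by blast
  have "C \<noteq> B" using B C N by blast
  then have "card C < card B" using B by (simp add: psubset_card_mono psubsetI)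
  then show ?thesis using B C dim_span_eq_card_independent by metis
qed

lemma fdim_subset_dim_le:
  assumes "fdim M" "subspace N" "N \<subseteq> M"
  shows "dim N \<le> dim M"
  using fdim_psubset_dim[OF assms(1,2)] assms(3) by (metis less_imp_le order_refl psubsetI)

lemma chain_stabilizes:
  assumes M: "fdim M" and K: "\<And>i. subspace (K i)" "\<And>i. K i \<subseteq> M" "\<And>i. K i \<subseteq> K (Suc i)"
  shows "\<exists>m::nat. K (Suc m) = K m"
proof (rule ccontr)
  assume neg: "\<nexists>m. K (Suc m) = K m"
  have "i \<le> dim (K i)" for i
  proof (induction i)
    case (Suc i)
    have "K i \<subset> K (Suc i)" using neg K(3)[of i] by blast
    then have "dim (K i) < dim (K (Suc i))"
      by (rule fdim_psubset_dim[OF fdim_subset[OF M K(1,2)] K(1)])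
    then show ?case using Suc by linarith
  qed simp
  then have "Suc (dim M) \<le> dim (K (Suc (dim M)))" .
  then show False using fdim_subset_dim_le[OF M K(1,2), of "Suc (dim M)"] by linarith
qed

lemma subspace_proper_0: "subspace M \<Longrightarrow> M \<noteq> {0} \<Longrightarrow> {0} \<subset> M"
  using subspace_0 by blast

lemma fdim_dim_0:
  assumes "fdim M" "dim M = 0" shows "M = {0}"
  using fdim_psubset_dim[OF assms(1) subspace_single_0] assms subspace_proper_0[of M]
    fdim_subspace by fastforce

lemma subspace_image: "lin T \<Longrightarrow> subspace M \<Longrightarrow> subspace (T ` M)"
  by (intro module_hom.subspace_image) (simp_all add: module_hom_iff_linear)

lemma subspace_kernel_on: "lin T \<Longrightarrow> subspace M \<Longrightarrow> subspace {v \<in> M. T v = 0}"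
  by (intro subspaceI)
    (simp_all add: lin_zero[of scale scale T] lin_add[of scale scale T] lin_scale[of scale scale T]
      subspace_0 subspace_add subspace_scale)

lemma lin_extend:
  assumes "independent B"
  obtains T where "lin T" "\<And>b. b \<in> B \<Longrightarrow> T b = g b" "range T \<subseteq> span (g ` B)"
proof -
  interpret vector_space_pair scale scale by unfold_locales
  show ?thesis
    using that linear_independent_extend_subspace[OF assms, of g]
    by (metis order_refl)
qed

lemma functional_extend:
  assumes "independent B"
  shows "\<exists>\<psi>. functional \<psi> \<and> (\<forall>b\<in>B. \<psi> b = g b)"
proof -
  interpret K: vector_space "(*) :: 'a \<Rightarrow> 'a \<Rightarrow> 'a" by (rule vector_space_mult)
  interpret vector_space_pair scale "(*) :: 'a \<Rightarrow> 'a \<Rightarrow> 'a" by unfold_locales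
  show ?thesis using linear_independent_extend[OF assms, of g] by metis
qed

lemma projection_exists:
  assumes "subspace N"
  obtains p where "lin p" "\<And>v. p v \<in> N" "\<And>v. v \<in> N \<Longrightarrow> p v = v"
proof -
  obtain B where B: "B \<subseteq> N" "independent B" "N \<subseteq> span B"
    using maximal_independent_subset by blast
  have sB: "span B = N" using B assms by (intro span_subspace) auto
  obtain T where T: "lin T" "\<And>b. b \<in> B \<Longrightarrow> T b = b" "range T \<subseteq> span ((\<lambda>b. b) ` B)"
    using lin_extend[OF B(2), of "\<lambda>b. b"] by blast
  have "T v = v" if "v \<in> N" for v
    using that unfolding sB[symmetric]
    by (induction rule: span_induct_alt) (simp_all add: lin_zero[OF T(1)] lin_add[OF T(1)] lin_scale[OF T(1)] T(2))
  moreover have "T v \<in> N" for v using T(3) sB by auto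
  ultimately show ?thesis using that[of T] T(1) by blast
qed

lemma fdim_inj_surj:
  assumes M: "fdim M" and T: "lin T" "T ` M \<subseteq> M" and inj: "\<And>v. v \<in> M \<Longrightarrow> T v = 0 \<Longrightarrow> v = 0"
  shows "T ` M = M"
proof -
  obtain B where B: "B \<subseteq> M" "finite B" "independent B" "span B = M" "card B = dim M"
    using fdim_basis[OF M] .
  have i: "inj_on T M"
    by (intro inj_onI)
      (metis M T(1) eq_iff_diff_eq_0 fdim_subspace inj lin_diff subspace_diff)
  have indep: "independent (T ` B)"
  proof -
    have "module_hom scale scale T" using T(1) by (simp only: Vector_Spaces.linear_iff_module_hom)
    then show ?thesis
      by (rule module_hom.independent_injective_image[OF _ B(3)]) (simp only: B(4) i)
  qed
  have "card (T ` B) = dim M" using B i by (metis card_image inj_on_subset)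
  moreover have sp: "span (T ` B) = T ` M"
    using module_hom.span_image[of scale scale T B] T(1) B(4) by (simp add: module_hom_iff_linear)
  ultimately have "dim (T ` M) = dim M" using dim_span_eq_card_independent[OF indep] by simp
  then show ?thesis
    using fdim_psubset_dim[OF M subspace_image[OF T(1) fdim_subspace[OF M]]] T(2)
    by (metis less_irrefl psubsetI)
qed

text \<open>
  Coordinates on \<open>M\<close> whose vectors need not be independent. Traces can be read off in any frame,
  in particular in one given by dual bases of a bilinear form.
\<close>

definition frame :: "'b set \<Rightarrow> 'b set \<Rightarrow> ('b \<Rightarrow> 'b \<Rightarrow> 'a) \<Rightarrow> bool" where
  "frame M C \<psi> \<longleftrightarrow> finite C \<and> C \<subseteq> M \<and> (\<forall>c\<in>C. functional (\<psi> c)) \<and>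
     (\<forall>v\<in>M. v = (\<Sum>c\<in>C. \<psi> c v *s c))"

text \<open>
  The choice is harmless: all frames give the same value, see \<open>trace_frame\<close>.
\<close>

definition trace_on :: "'b set \<Rightarrow> ('b \<Rightarrow> 'b) \<Rightarrow> 'a" where
  "trace_on M T = (SOME t. \<exists>C \<psi>. frame M C \<psi> \<and> t = (\<Sum>c\<in>C. \<psi> c (T c)))"

lemma coordinates_expand:
  assumes \<psi>: "\<And>b. functional (\<psi> b)" "\<And>b c. b \<in> D \<Longrightarrow> c \<in> D \<Longrightarrow> \<psi> b c = (if b = c then 1 else 0)"
    and D: "finite D" "v \<in> span D"
  shows "(\<Sum>b\<in>D. \<psi> b v *s b) = v"
  using D(2)
proof (induction rule: span_induct_alt)
  case base
  then show ?case by (simp add: lin_zero[OF \<psi>(1)])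
next
  case (step c x y)
  have "(\<Sum>b\<in>D. \<psi> b x *s b) = (\<Sum>b\<in>D. if b = x then b else 0)"
    using step by (intro sum.cong) (auto simp: \<psi>(2))
  also have "\<dots> = x" using step D(1) by simp
  finally have x: "(\<Sum>b\<in>D. \<psi> b x *s b) = x" .
  have "(\<Sum>b\<in>D. \<psi> b (c *s x + y) *s b) = c *s (\<Sum>b\<in>D. \<psi> b x *s b) + (\<Sum>b\<in>D. \<psi> b y *s b)"
    by (simp add: lin_add[OF \<psi>(1)] lin_scale[OF \<psi>(1)] scale_left_distrib sum.distrib scale_sum_right)
  then show ?case using step x by simp
qed

text \<open>
  A basis of \<open>W\<close> extended to one of \<open>M\<close>: the coordinates beyond \<open>C\<close> vanish on \<open>W\<close>, which compares
  traces on \<open>M\<close> and on \<open>W\<close>.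
\<close>

lemma frame_extend:
  assumes M: "fdim M" and W: "subspace W" "W \<subseteq> M"
  obtains B C \<psi> where "frame M B \<psi>" "frame W C \<psi>" "C \<subseteq> B"
    "\<And>b w. b \<in> B - C \<Longrightarrow> w \<in> W \<Longrightarrow> \<psi> b w = 0"
    "\<And>b c. b \<in> B \<Longrightarrow> c \<in> B \<Longrightarrow> \<psi> b c = (if b = c then 1 else 0)" "card C = dim W"
proof -
  obtain C where C: "C \<subseteq> W" "finite C" "independent C" "span C = W" "card C = dim W"
    using fdim_basis[OF fdim_subset[OF M W]] .
  obtain B where B: "C \<subseteq> B" "B \<subseteq> M" "finite B" "independent B" "span B = M"
    using fdim_basis_extend[OF M, of C] C W by blast
  have "\<exists>\<psi>. \<forall>b. functional (\<psi> b) \<and> (\<forall>c\<in>B. \<psi> b c = (if b = c then 1 else 0))"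
    by (rule choice, rule allI) (rule functional_extend[OF B(4)])
  then obtain \<psi> where \<psi>: "\<And>b. functional (\<psi> b)"
    "\<And>b c. c \<in> B \<Longrightarrow> \<psi> b c = (if b = c then 1 else 0)" by blast
  have *: "(\<Sum>c\<in>D. \<psi> c v *s c) = v" if "D \<subseteq> B" "v \<in> span D" for D v
    using that \<psi> finite_subset[OF that(1) B(3)] by (intro coordinates_expand) (auto simp: subsetD)
  have "\<psi> b w = 0" if "b \<in> B - C" "w \<in> W" for b w
    using that(2) unfolding C(4)[symmetric]
  proof (induction rule: span_induct_alt)
    case base then show ?case by (simp add: lin_zero[OF \<psi>(1)])
  next
    case (step c x y)
    then have "x \<noteq> b" "x \<in> B" using that B by auto
    then show ?case using step by (simp add: lin_add[OF \<psi>(1)] lin_scale[OF \<psi>(1)] \<psi>(2))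
  qed
  moreover have "frame M B \<psi>"
    using B(2,3) \<psi>(1) *[OF order_refl, symmetric] unfolding frame_def B(5) by blast
  moreover have "frame W C \<psi>"
    using C(1,2) \<psi>(1) *[OF B(1), symmetric] unfolding frame_def C(4) by blast
  ultimately show ?thesis using that[of B \<psi> C] B(1) C(5) \<psi>(2) by metis
qed

text \<open>
  Both sides expand to the double sum of \<open>\<phi> d (T c) * \<psi> c (S d)\<close>. For \<open>S\<close> the identity this is
  independence of the frame, for equal frames it is \<open>tr ST = tr TS\<close>.
\<close>

lemma frame_trace_commute:
  assumes C: "frame M C \<psi>" and D: "frame M D \<phi>"
    and S: "lin S" "S ` M \<subseteq> M" and T: "lin T" "T ` M \<subseteq> M"
  shows "(\<Sum>c\<in>C. \<psi> c (S (T c))) = (\<Sum>d\<in>D. \<phi> d (T (S d)))"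
proof -
  have \<psi>: "\<And>c. c \<in> C \<Longrightarrow> functional (\<psi> c)" and \<phi>: "\<And>d. d \<in> D \<Longrightarrow> functional (\<phi> d)"
    and M: "C \<subseteq> M" "D \<subseteq> M" and rep: "\<And>v. v \<in> M \<Longrightarrow> v = (\<Sum>c\<in>C. \<psi> c v *s c)"
    "\<And>v. v \<in> M \<Longrightarrow> v = (\<Sum>c\<in>D. \<phi> c v *s c)"
    using C D unfolding frame_def by blast+
  have 1: "\<psi> c (S (T c)) = (\<Sum>d\<in>D. \<phi> d (T c) * \<psi> c (S d))" if "c \<in> C" for c
  proof -
    have "T c \<in> M" using that M T by auto
    then have "\<psi> c (S (T c)) = \<psi> c (S (\<Sum>d\<in>D. \<phi> d (T c) *s d))" using rep(2)[of "T c"] by metis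
    then show ?thesis
      by (simp add: lin_sum[OF \<psi>[OF that]] lin_sum[OF S(1)] lin_scale[OF \<psi>[OF that]] lin_scale[OF S(1)])
  qed
  have 2: "\<phi> d (T (S d)) = (\<Sum>c\<in>C. \<psi> c (S d) * \<phi> d (T c))" if "d \<in> D" for d
  proof -
    have "S d \<in> M" using that M S by auto
    then have "\<phi> d (T (S d)) = \<phi> d (T (\<Sum>c\<in>C. \<psi> c (S d) *s c))" using rep(1)[of "S d"] by metis
    then show ?thesis
      by (simp add: lin_sum[OF \<phi>[OF that]] lin_sum[OF T(1)] lin_scale[OF \<phi>[OF that]] lin_scale[OF T(1)])
  qed
  have "(\<Sum>c\<in>C. \<psi> c (S (T c))) = (\<Sum>c\<in>C. \<Sum>d\<in>D. \<phi> d (T c) * \<psi> c (S d))"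
    using 1 by (intro sum.cong) auto
  also have "\<dots> = (\<Sum>d\<in>D. \<Sum>c\<in>C. \<phi> d (T c) * \<psi> c (S d))" by (rule sum.swap)
  also have "\<dots> = (\<Sum>d\<in>D. \<phi> d (T (S d)))" using 2 by (intro sum.cong) (auto simp: mult.commute)
  finally show ?thesis .
qed

lemma frame_exists:
  assumes "fdim M" obtains C \<psi> where "frame M C \<psi>"
  using frame_extend[OF assms fdim_subspace[OF assms] order_refl] by metis

lemma trace_frame:
  assumes "frame M C \<psi>" "lin T" "T ` M \<subseteq> M"
  shows "trace_on M T = (\<Sum>c\<in>C. \<psi> c (T c))"
proof -
  have "\<exists>D \<phi>. frame M D \<phi> \<and> trace_on M T = (\<Sum>c\<in>D. \<phi> c (T c))"
    unfolding trace_on_def by (rule someI_ex) (use assms in blast)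
  then obtain D \<phi> where D: "frame M D \<phi>" "trace_on M T = (\<Sum>c\<in>D. \<phi> c (T c))" by blast
  then show ?thesis
    using frame_trace_commute[OF assms(1) D(1) lin_id _ assms(2,3)] by simp
qed

lemma trace_cong:
  assumes "\<And>v. v \<in> M \<Longrightarrow> S v = T v"
  shows "trace_on M S = trace_on M T"
proof -
  have "(\<Sum>c\<in>C. \<psi> c (S c)) = (\<Sum>c\<in>C. \<psi> c (T c))" if "frame M C \<psi>" for C \<psi>
    using that assms by (intro sum.cong) (auto simp: frame_def)
  then have "(\<exists>C \<psi>. frame M C \<psi> \<and> t = (\<Sum>c\<in>C. \<psi> c (S c))) \<longleftrightarrow>
    (\<exists>C \<psi>. frame M C \<psi> \<and> t = (\<Sum>c\<in>C. \<psi> c (T c)))" for t by metis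
  then show ?thesis unfolding trace_on_def by presburger
qed

lemma trace_commute:
  assumes "fdim M" "lin S" "S ` M \<subseteq> M" "lin T" "T ` M \<subseteq> M"
  shows "trace_on M (\<lambda>v. S (T v)) = trace_on M (\<lambda>v. T (S v))"
proof -
  obtain C \<psi> where f: "frame M C \<psi>" using frame_exists[OF assms(1)] .
  have "lin (\<lambda>v. S (T v))" "lin (\<lambda>v. T (S v))" by (rule lin_comp; fact)+
  moreover have "(\<lambda>v. S (T v)) ` M \<subseteq> M" "(\<lambda>v. T (S v)) ` M \<subseteq> M" using assms by blast+
  ultimately show ?thesis using frame_trace_commute[OF f f assms(2-5)] trace_frame[OF f] by simp
qed

lemma trace_linear:
  assumes M: "fdim M" and S: "lin S" "S ` M \<subseteq> M" and T: "lin T" "T ` M \<subseteq> M"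
  shows trace_add: "trace_on M (\<lambda>v. S v + T v) = trace_on M S + trace_on M T"
    and trace_diff: "trace_on M (\<lambda>v. S v - T v) = trace_on M S - trace_on M T"
    and trace_scale: "trace_on M (\<lambda>v. c *s T v) = c * trace_on M T"
proof -
  obtain C \<psi> where f: "frame M C \<psi>" using frame_exists[OF assms(1)] .
  have fu: "functional (\<psi> c)" if "c \<in> C" for c using f that by (auto simp: frame_def)
  have sM: "subspace M" using M by (rule fdim_subspace)
  have 1: "(\<lambda>v. S v + T v) ` M \<subseteq> M" "(\<lambda>v. S v - T v) ` M \<subseteq> M" "(\<lambda>v. c *s T v) ` M \<subseteq> M"
    using S(2) T(2) sM unfolding image_subset_iff
    by (auto intro: subspace_add subspace_diff subspace_scale)
  show "trace_on M (\<lambda>v. S v + T v) = trace_on M S + trace_on M T"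
    using trace_frame[OF f lin_plus[OF S(1) T(1)] 1(1)] trace_frame[OF f S] trace_frame[OF f T]
    by (simp add: lin_add[OF fu] sum.distrib)
  show "trace_on M (\<lambda>v. S v - T v) = trace_on M S - trace_on M T"
    using trace_frame[OF f lin_minus[OF S(1) T(1)] 1(2)] trace_frame[OF f S] trace_frame[OF f T]
    by (simp add: lin_diff[OF fu] sum_subtractf)
  show "trace_on M (\<lambda>v. c *s T v) = c * trace_on M T"
    using trace_frame[OF f lin_smult[OF T(1)] 1(3)] trace_frame[OF f T]
    by (simp add: lin_scale[OF fu] sum_distrib_left)
qed

lemma trace_null: "fdim M \<Longrightarrow> trace_on M (\<lambda>v. 0) = 0"
  using trace_diff[OF _ lin_id _ lin_id] by fastforce

lemma trace_sum:
  assumes M: "fdim M" and "\<And>i. i \<in> I \<Longrightarrow> lin (T i)" "\<And>i. i \<in> I \<Longrightarrow> T i ` M \<subseteq> M"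
  shows "trace_on M (\<lambda>v. \<Sum>i\<in>I. T i v) = (\<Sum>i\<in>I. trace_on M (T i))"
  using assms(2,3)
proof (induction I rule: infinite_finite_induct)
  case (insert i I)
  have "(\<lambda>v. \<Sum>i\<in>I. T i v) ` M \<subseteq> M"
    using insert.prems M by (auto intro!: subspace_sum simp: fdim_subspace)
  then show ?case
    using insert trace_add[OF M, of "T i" "\<lambda>v. \<Sum>i\<in>I. T i v"] lin_sums[of I T] by simp
qed (simp_all add: trace_null M)

text \<open>
  In a basis of \<open>M\<close> that extends one of \<open>W\<close>, the vectors outside \<open>W\<close> contribute nothing to the
  trace.
\<close>

lemma trace_on_image:
  assumes M: "fdim M" and W: "subspace W" "W \<subseteq> M" and T: "lin T" "T ` M \<subseteq> W"
  shows "trace_on M T = trace_on W T"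
proof -
  obtain B C \<psi> where f: "frame M B \<psi>" "frame W C \<psi>" "C \<subseteq> B"
    "\<And>b w. b \<in> B - C \<Longrightarrow> w \<in> W \<Longrightarrow> \<psi> b w = 0"
    using frame_extend[OF M W] by metis
  have "\<psi> b (T b) = 0" if "b \<in> B - C" for b
  proof -
    have "b \<in> M" using that f(1) by (auto simp: frame_def)
    then show ?thesis using f(4)[OF that] T by blast
  qed
  moreover have "finite B" using f by (simp add: frame_def)
  ultimately have "(\<Sum>b\<in>B. \<psi> b (T b)) = (\<Sum>c\<in>C. \<psi> c (T c))"
    using f(3) by (intro sum.mono_neutral_right) auto
  moreover have "T ` M \<subseteq> M" "T ` W \<subseteq> W" using T W by auto
  ultimately show ?thesis using trace_frame[OF f(1) T(1)] trace_frame[OF f(2) T(1)] by simp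
qed

lemma trace_id:
  assumes "fdim M" shows "trace_on M (\<lambda>v. v) = of_nat (dim M)"
proof -
  obtain B C \<psi> where f: "frame M C \<psi>" "C \<subseteq> B" "card C = dim M"
    "\<And>b c. b \<in> B \<Longrightarrow> c \<in> B \<Longrightarrow> \<psi> b c = (if b = c then 1 else 0)"
    using frame_extend[OF assms fdim_subspace[OF assms] order_refl] by metis
  have "(\<Sum>c\<in>C. \<psi> c c) = of_nat (card C)" using f by (simp add: subsetD)
  then show ?thesis using trace_frame[OF f(1) lin_id] f(3) by simp
qed

lemma trace_idempotent:
  assumes "fdim M" "lin T" "T ` M \<subseteq> M" "\<And>v. v \<in> M \<Longrightarrow> T (T v) = T v"
  shows "trace_on M T = of_nat (dim (T ` M))"
proof -
  have s: "subspace (T ` M)" using assms fdim_subspace subspace_image by blast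
  have "trace_on M T = trace_on (T ` M) T" using assms s by (intro trace_on_image) auto
  also have "\<dots> = trace_on (T ` M) (\<lambda>v. v)" using assms by (intro trace_cong) auto
  finally show ?thesis using trace_id[OF fdim_subset[OF assms(1) s assms(3)]] by simp
qed

definition locally_nilpotent_on :: "'b set \<Rightarrow> ('b \<Rightarrow> 'b) \<Rightarrow> bool" where
  "locally_nilpotent_on M T \<longleftrightarrow> (\<forall>v\<in>M. \<exists>n. (T ^^ n) v = 0)"

lemma locally_nilpotent_imp_nilpotent:
  assumes M: "fdim M" and T: "lin T" "locally_nilpotent_on M T"
  shows "\<exists>n. \<forall>v\<in>M. (T ^^ n) v = 0"
proof -
  obtain B where B: "B \<subseteq> M" "finite B" "span B = M" using fdim_basis[OF M] by metis
  obtain k where k: "\<And>b. b \<in> B \<Longrightarrow> (T ^^ k b) b = 0"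
    using T(2) B unfolding locally_nilpotent_on_def by (metis subsetD)
  let ?n = "\<Sum>b\<in>B. k b"
  have "(T ^^ ?n) v = 0" if "v \<in> span B" for v
    using that
  proof (induction rule: span_induct_alt)
    case (step c x y)
    have "?n = (?n - k x) + k x" using B step member_le_sum[of x B k] by simp
    then have "(T ^^ ?n) x = (T ^^ (?n - k x)) ((T ^^ k x) x)" by (metis comp_apply funpow_add)
    then have "(T ^^ ?n) x = 0" using k[OF step(1)] lin_zero[OF lin_funpow[OF T(1)]] by simp
    then show ?case using step by (simp add: lin_add[OF lin_funpow[OF T(1)]] lin_scale[OF lin_funpow[OF T(1)]])
  qed (simp add: lin_zero[OF lin_funpow[OF T(1)]])
  then show ?thesis using B by blast
qed

lemma nilpotent_image_proper:
  assumes M: "fdim M" and T: "lin T" "locally_nilpotent_on M T" and M0: "M \<noteq> {0}"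
  shows "T ` M \<noteq> M"
proof
  assume eq: "T ` M = M"
  obtain n where n: "\<And>v. v \<in> M \<Longrightarrow> (T ^^ n) v = 0"
    using locally_nilpotent_imp_nilpotent[OF M T] by blast
  have "(T ^^ k) ` M = M" for k
    by (induction k) (simp, metis eq funpow.simps(2) image_comp)
  from this[of n] have "M \<subseteq> {0}" using n by (metis image_subset_iff insertI1)
  then show False using M0 fdim_subspace[OF M] subspace_0 by blast
qed

text \<open>
  The image \<open>T M\<close> is a proper subspace and carries the whole trace, so induction on the dimension
  applies.
\<close>

lemma trace_nilpotent:
  assumes "fdim M" "lin T" "T ` M \<subseteq> M" "locally_nilpotent_on M T"
  shows "trace_on M T = 0"
  using assms
proof (induction "dim M" arbitrary: M rule: less_induct)
  case less
  show ?case
  proof (cases "M = {0}")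
    case True
    then show ?thesis using trace_null[OF less(2)] trace_cong[of M T "\<lambda>v. 0"]
      by (simp add: lin_zero[OF less(3)])
  next
    case False
    let ?W = "T ` M"
    have s: "subspace ?W" using less fdim_subspace subspace_image by blast
    have p: "?W \<subset> M" using nilpotent_image_proper[OF less(2,3,5) False] less(4) by blast
    have "trace_on M T = trace_on ?W T" using less s by (intro trace_on_image) auto
    also have "\<dots> = 0"
      using less p s fdim_psubset_dim[OF less(2) s p] fdim_subset[OF less(2) s]
      by (intro less(1)) (auto simp: locally_nilpotent_on_def)
    finally show ?thesis .
  qed
qed

definition dual_bases :: "'b set \<Rightarrow> ('b \<Rightarrow> 'b \<Rightarrow> 'a) \<Rightarrow> 'b set \<Rightarrow> ('b \<Rightarrow> 'b) \<Rightarrow> bool" where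
  "dual_bases M \<beta> B d \<longleftrightarrow> finite B \<and> B \<subseteq> M \<and> d ` B \<subseteq> M \<and>
     (\<forall>b\<in>B. \<forall>c\<in>B. \<beta> b (d c) = (if b = c then 1 else 0)) \<and>
     (\<forall>u\<in>M. (\<Sum>b\<in>B. \<beta> u (d b) *s b) = u) \<and> (\<forall>v\<in>M. (\<Sum>b\<in>B. \<beta> b v *s d b) = v) \<and>
     card B = dim M"

lemma dual_basesD:
  assumes "dual_bases M \<beta> B d"
  shows "finite B" "B \<subseteq> M" "\<And>b. b \<in> B \<Longrightarrow> d b \<in> M"
    "\<And>b c. b \<in> B \<Longrightarrow> c \<in> B \<Longrightarrow> \<beta> b (d c) = (if b = c then 1 else 0)"
    "\<And>u. u \<in> M \<Longrightarrow> (\<Sum>b\<in>B. \<beta> u (d b) *s b) = u"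
    "\<And>v. v \<in> M \<Longrightarrow> (\<Sum>b\<in>B. \<beta> b v *s d b) = v"
    "card B = dim M"
  using assms unfolding dual_bases_def by blast+

text \<open>
  The map \<open>v \<mapsto> \<Sum> \<beta>(b, v) b\<close> is injective by nondegeneracy, hence surjective, and \<open>d b\<close> is the
  preimage of \<open>b\<close>.
\<close>

lemma dual_bases_exist:
  assumes M: "fdim M"
    and \<beta>: "\<And>u. functional (\<beta> u)" "\<And>v. functional (\<lambda>u. \<beta> u v)"
    and nondeg: "\<And>v. v \<in> M \<Longrightarrow> (\<And>u. u \<in> M \<Longrightarrow> \<beta> u v = 0) \<Longrightarrow> v = 0"
  shows "\<exists>B d. dual_bases M \<beta> B d"
proof -
  obtain B where B: "B \<subseteq> M" "finite B" "independent B" "span B = M" "card B = dim M"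
    using fdim_basis[OF M] .
  define \<Phi> where "\<Phi> v = (\<Sum>b\<in>B. \<beta> b v *s b)" for v
  have lin\<Phi>: "lin \<Phi>" unfolding \<Phi>_def
    by (intro linI) (simp_all add: lin_add[OF \<beta>(1)] lin_scale[OF \<beta>(1)] scale_left_distrib
      sum.distrib scale_sum_right)
  have \<Phi>M: "\<Phi> ` M \<subseteq> M" unfolding \<Phi>_def using B M
    by (auto intro!: subspace_sum subspace_scale simp: fdim_subspace)
  have zero: "\<beta> u v = 0" if "u \<in> span B" "\<And>b. b \<in> B \<Longrightarrow> \<beta> b v = 0" for u v
    using that by (induction rule: span_induct_alt)
      (simp_all add: lin_zero[OF \<beta>(2)] lin_add[OF \<beta>(2)] lin_scale[OF \<beta>(2)])
  have coeff: "\<beta> b v = \<gamma> b" if "\<Phi> v = (\<Sum>b\<in>B. \<gamma> b *s b)" "b \<in> B" for v b \<gamma>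
  proof -
    have "(\<Sum>b\<in>B. (\<beta> b v - \<gamma> b) *s b) = 0"
      using that by (simp add: \<Phi>_def scale_left_diff_distrib sum_subtractf)
    then have "\<beta> b v - \<gamma> b = 0" 
      using independentD[OF B(3,2) order_refl _ that(2), of "\<lambda>b. \<beta> b v - \<gamma> b"] by blast
    then show ?thesis by simp
  qed
  have "\<Phi> ` M = M"
  proof (rule fdim_inj_surj[OF M lin\<Phi> \<Phi>M])
    fix v assume v: "v \<in> M" "\<Phi> v = 0"
    then have "\<And>b. b \<in> B \<Longrightarrow> \<beta> b v = 0" using coeff[of v "\<lambda>_. 0"] by simp
    then show "v = 0" using nondeg[OF v(1)] zero B by blast
  qed
  then have "\<forall>b\<in>B. \<exists>v. v \<in> M \<and> \<Phi> v = b" using B by (metis imageE subsetD)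
  then obtain d where d: "\<And>b. b \<in> B \<Longrightarrow> d b \<in> M" "\<And>b. b \<in> B \<Longrightarrow> \<Phi> (d b) = b" by metis
  have dual: "\<beta> b (d c) = (if b = c then 1 else 0)" if "b \<in> B" "c \<in> B" for b c
  proof (rule coeff[OF _ that(1)])
    have "(\<Sum>b\<in>B. (if b = c then 1 else 0) *s b) = (\<Sum>b\<in>B. if b = c then b else 0)"
      by (intro sum.cong) auto
    then show "\<Phi> (d c) = (\<Sum>b\<in>B. (if b = c then 1 else 0) *s b)" using d that B by simp
  qed
  have e1: "(\<Sum>b\<in>B. \<beta> u (d b) *s b) = u" if "u \<in> M" for u
    using \<beta>(2) dual B that by (intro coordinates_expand) auto
  have e2: "(\<Sum>b\<in>B. \<beta> b v *s d b) = v" if v: "v \<in> M" for v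
  proof -
    let ?w = "v - (\<Sum>b\<in>B. \<beta> b v *s d b)"
    have "?w \<in> M" using v d M by (intro subspace_diff subspace_sum subspace_scale) (auto simp: fdim_subspace)
    moreover have "\<beta> u ?w = 0" if "u \<in> M" for u
    proof (rule zero)
      show "u \<in> span B" using that B by simp
      fix c assume c: "c \<in> B"
      have "(\<Sum>b\<in>B. \<beta> b v * \<beta> c (d b)) = (\<Sum>b\<in>B. if c = b then \<beta> b v else 0)"
        using c by (intro sum.cong) (auto simp: dual)
      then show "\<beta> c ?w = 0" using c B
        by (simp add: lin_diff[OF \<beta>(1)] lin_sum[OF \<beta>(1)] lin_scale[OF \<beta>(1)])
    qed
    ultimately have "?w = 0" using nondeg[of ?w] by blast
    then show ?thesis by simp
  qed
  have "dual_bases M \<beta> B d"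
    unfolding dual_bases_def
    by (intro conjI ballI B(1,2,5) e1 e2 dual image_subsetI d(1)) assumption+
  then show ?thesis by blast
qed

text \<open>
  The tensor \<open>\<Sum> b \<otimes> d b\<close> does not distinguish between \<open>S\<close> acting on the left factor and its adjoint
  acting on the right one; the bilinear map \<open>Q\<close> stands for the tensor product. The invariance of
  Casimir elements and of separability idempotents are both instances.
\<close>

lemma dual_bases_adjoint:
  fixes B :: "'b set" and Q :: "'b \<Rightarrow> 'b \<Rightarrow> 'c::ab_group_add" and s2 :: "'a \<Rightarrow> 'c \<Rightarrow> 'c"
  assumes D: "dual_bases M \<beta> B d"
    and S: "\<And>u. u \<in> M \<Longrightarrow> S u \<in> M" "\<And>u. u \<in> M \<Longrightarrow> S' u \<in> M"
    and adj: "\<And>u v. u \<in> M \<Longrightarrow> v \<in> M \<Longrightarrow> \<beta> (S u) v = \<beta> u (S' v)"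
    and Q: "\<And>u. Vector_Spaces.linear scale s2 (Q u)" "\<And>v. Vector_Spaces.linear scale s2 (\<lambda>u. Q u v)"
  shows "(\<Sum>b\<in>B. Q (S b) (d b)) = (\<Sum>b\<in>B. Q b (S' (d b)))"
proof -
  note D' = dual_basesD[OF D]
  have mem: "b \<in> M" "d b \<in> M" if "b \<in> B" for b using D'(2,3) that by auto
  have 1: "Q (S b) (d b) = (\<Sum>c\<in>B. s2 (\<beta> (S b) (d c)) (Q c (d b)))" if "b \<in> B" for b
  proof -
    have "Q (S b) (d b) = Q (\<Sum>c\<in>B. \<beta> (S b) (d c) *s c) (d b)" using D'(5)[OF S(1)[OF mem(1)[OF that]]] by simp
    then show ?thesis by (simp add: lin_sum[OF Q(2)] lin_scale[OF Q(2)])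
  qed
  have 2: "Q b (S' (d b)) = (\<Sum>c\<in>B. s2 (\<beta> c (S' (d b))) (Q b (d c)))" if "b \<in> B" for b
  proof -
    have "Q b (S' (d b)) = Q b (\<Sum>c\<in>B. \<beta> c (S' (d b)) *s d c)" using D'(6)[OF S(2)[OF mem(2)[OF that]]] by simp
    then show ?thesis by (simp add: lin_sum[OF Q(1)] lin_scale[OF Q(1)])
  qed
  have "(\<Sum>b\<in>B. Q (S b) (d b)) = (\<Sum>b\<in>B. \<Sum>c\<in>B. s2 (\<beta> (S b) (d c)) (Q c (d b)))"
    using 1 by (intro sum.cong) auto
  also have "\<dots> = (\<Sum>c\<in>B. \<Sum>b\<in>B. s2 (\<beta> (S b) (d c)) (Q c (d b)))" by (rule sum.swap)
  also have "\<dots> = (\<Sum>c\<in>B. Q c (S' (d c)))" using 2 adj mem by (intro sum.cong) (auto intro!: sum.cong)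
  finally show ?thesis .
qed

end

section \<open>Generalized eigenspaces\<close>

context lin_space begin

definition shift :: "('b \<Rightarrow> 'b) \<Rightarrow> 'a \<Rightarrow> 'b \<Rightarrow> 'b" where
  "shift T a v = T v - a *s v"

definition gen_eigenspace :: "('b \<Rightarrow> 'b) \<Rightarrow> 'a \<Rightarrow> 'b set" where
  "gen_eigenspace T a = {v. \<exists>n. (shift T a ^^ n) v = 0}"

lemma lin_shift: "lin T \<Longrightarrow> lin (shift T a)"
  unfolding shift_def by (intro lin_minus lin_smult lin_id)

lemma shift_mem: "subspace M \<Longrightarrow> T ` M \<subseteq> M \<Longrightarrow> v \<in> M \<Longrightarrow> shift T a v \<in> M"
  unfolding shift_def by (intro subspace_diff subspace_scale) auto

lemma shift_commute: "lin T \<Longrightarrow> shift T a (shift T b v) = shift T b (shift T a v)"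
  by (simp add: shift_def lin_diff[of scale scale T] lin_scale[of scale scale T] algebra_simps)

lemma shift_funpow_commute:
  "lin T \<Longrightarrow> (shift T a ^^ n) (shift T b v) = shift T b ((shift T a ^^ n) v)"
  by (induction n) (simp_all add: shift_commute)

lemma funpow_zero_mono:
  assumes "lin T" "(T ^^ n) v = 0" "n \<le> m" shows "(T ^^ m) v = 0"
proof -
  have "(T ^^ m) v = (T ^^ (m - n)) ((T ^^ n) v)"
    using assms(3) by (metis add.commute comp_apply funpow_add le_add_diff_inverse)
  then show ?thesis using assms lin_zero[OF lin_funpow[OF assms(1)]] by simp
qed

lemma subspace_gen_eigenspace: assumes T: "lin T" shows "subspace (gen_eigenspace T a)"
proof (intro subspaceI)
  note l = lin_funpow[OF lin_shift[OF T]]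
  show "0 \<in> gen_eigenspace T a" by (auto simp: gen_eigenspace_def intro: exI[of _ 0])
  fix x y c assume "x \<in> gen_eigenspace T a"
  then obtain n where n: "(shift T a ^^ n) x = 0" by (auto simp: gen_eigenspace_def)
  then show "c *s x \<in> gen_eigenspace T a" by (auto simp: gen_eigenspace_def lin_scale[OF l])
  assume "y \<in> gen_eigenspace T a"
  then obtain m where m: "(shift T a ^^ m) y = 0" by (auto simp: gen_eigenspace_def)
  have "(shift T a ^^ (n + m)) (x + y) = 0"
    using funpow_zero_mono[OF lin_shift[OF T] n, of "n + m"] funpow_zero_mono[OF lin_shift[OF T] m, of "n + m"]
    by (simp add: lin_add[OF l])
  then show "x + y \<in> gen_eigenspace T a" by (auto simp: gen_eigenspace_def)
qed

lemma gen_eigenspace_shift: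
  assumes T: "lin T" and v: "v \<in> gen_eigenspace T a" shows "shift T b v \<in> gen_eigenspace T a"
proof -
  obtain n where "(shift T a ^^ n) v = 0" using v by (auto simp: gen_eigenspace_def)
  then have "(shift T a ^^ n) (shift T b v) = 0"
    by (simp add: shift_funpow_commute[OF T] lin_zero[OF lin_shift[OF T]])
  then show ?thesis by (auto simp: gen_eigenspace_def)
qed

lemma gen_eigenspace_invariant: assumes "lin T" "v \<in> gen_eigenspace T a" shows "T v \<in> gen_eigenspace T a"
proof -
  have "shift T 0 v = T v" by (simp add: shift_def)
  then show ?thesis using gen_eigenspace_shift[OF assms, of 0] by simp
qed

lemma gen_eigenspaceI: "shift T a v \<in> gen_eigenspace T a \<Longrightarrow> v \<in> gen_eigenspace T a"
proof -
  assume "shift T a v \<in> gen_eigenspace T a"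
  then obtain n where "(shift T a ^^ n) (shift T a v) = 0" by (auto simp: gen_eigenspace_def)
  then have "(shift T a ^^ Suc n) v = 0" by (simp only: funpow_Suc_right comp_apply)
  then show ?thesis by (auto simp: gen_eigenspace_def simp del: funpow.simps)
qed

lemma shift_inj_gen_eigenspace:
  assumes T: "lin T" and u: "u \<in> gen_eigenspace T a" and ab: "a \<noteq> b" and z: "(shift T b ^^ n) u = 0"
  shows "u = 0"
  using u z
proof (induction n arbitrary: u)
  case (Suc n)
  have "(shift T b ^^ n) (shift T b u) = 0" using Suc.prems(2) by (simp add: funpow_swap1)
  then have s: "shift T b u = 0" by (rule Suc.IH[OF gen_eigenspace_shift[OF T Suc.prems(1)]])
  obtain k where k: "(shift T a ^^ k) u = 0" using Suc.prems(1) by (auto simp: gen_eigenspace_def)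
  have "(shift T a ^^ k) u = (b - a) ^ k *s u" for k
  proof (induction k)
    case (Suc k)
    have "shift T a u = (b - a) *s u" using s by (simp add: shift_def algebra_simps)
    then show ?case using Suc by (simp add: lin_scale[OF lin_shift[OF T]] mult.commute)
  qed simp
  then show ?case using k ab by simp
qed simp

text \<open>
  On the generalized eigenspace of \<open>b\<close> the operator \<open>T - a\<close> is the nonzero scalar \<open>b - a\<close> plus a
  locally nilpotent operator, so it is inverted by induction on the order of nilpotency.
\<close>

lemma shift_surj_gen_eigenspace:
  assumes T: "lin T" and M: "subspace M" "T ` M \<subseteq> M" and ab: "a \<noteq> b" and x: "x \<in> gen_eigenspace T b \<inter> M"
  shows "\<exists>u \<in> gen_eigenspace T b \<inter> M. shift T a u = x"
proof -
  obtain n where "(shift T b ^^ n) x = 0" using x by (auto simp: gen_eigenspace_def)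
  then show ?thesis using x
  proof (induction n arbitrary: x)
    case 0
    then show ?case by (intro bexI[of _ 0]) (auto simp: lin_zero[OF lin_shift[OF T]])
  next
    case (Suc n)
    have "(shift T b ^^ n) (shift T b x) = 0" using Suc.prems(1) by (simp add: funpow_swap1)
    then obtain u where u: "u \<in> gen_eigenspace T b \<inter> M" "shift T a u = shift T b x"
      using Suc.IH Suc.prems gen_eigenspace_shift[OF T] shift_mem[OF M] by blast
    have "shift T a x = shift T b x + (b - a) *s x" by (simp add: shift_def algebra_simps)
    then have "shift T a (x - u) = (b - a) *s x" using u by (simp add: lin_diff[OF lin_shift[OF T]])
    then have "shift T a (inverse (b - a) *s (x - u)) = x"
      using ab by (simp add: lin_scale[OF lin_shift[OF T]])
    moreover have "inverse (b - a) *s (x - u) \<in> gen_eigenspace T b \<inter> M"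
      using u Suc.prems subspace_inter[OF subspace_gen_eigenspace[OF T] M(1)] subspace_diff subspace_scale by blast
    ultimately show ?case by blast
  qed
qed

text \<open>
  A power of \<open>T - b\<close> removes the component at \<open>b\<close> and is injective on all the others.
\<close>

lemma gen_eigenspace_independent:
  assumes T: "lin T" and E: "finite E" and c: "\<And>a. a \<in> E \<Longrightarrow> c a \<in> gen_eigenspace T a" and s: "(\<Sum>a\<in>E. c a) = 0"
  shows "\<forall>a\<in>E. c a = 0"
  using E c s
proof (induction E arbitrary: c rule: finite_induct)
  case (insert b E)
  obtain n where n: "(shift T b ^^ n) (c b) = 0" using insert.prems by (auto simp: gen_eigenspace_def)
  let ?L = "shift T b ^^ n"
  have l: "lin ?L" using lin_funpow[OF lin_shift[OF T]] .
  have "?L (c b + (\<Sum>a\<in>E. c a)) = 0" using insert by (simp add: lin_zero[OF l])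
  then have "(\<Sum>a\<in>E. ?L (c a)) = 0" using n by (simp add: lin_add[OF l] lin_sum[OF l])
  moreover have mem: "?L v \<in> gen_eigenspace T a" if "v \<in> gen_eigenspace T a" for v a
    using that by (induction n) (auto intro: gen_eigenspace_shift[OF T])
  ultimately have "\<forall>a\<in>E. ?L (c a) = 0"
    by (intro insert.IH mem insert.prems(1)) auto
  then have "\<forall>a\<in>E. c a = 0"
    using shift_inj_gen_eigenspace[OF T] insert.prems(1) insert.hyps(2) by (metis insertI2)
  then show ?case using insert by simp
qed simp

lemma span_image_sum:
  assumes "x \<in> span (f ` I)" "finite I" shows "\<exists>c. x = (\<Sum>i\<in>I. c i *s f i)"
  using assms(1)
proof (induction rule: span_induct_alt)
  case base
  show ?case by (intro exI[of _ "\<lambda>_. 0"]) simp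
next
  case (step k x y)
  then obtain c j where c: "y = (\<Sum>i\<in>I. c i *s f i)" and j: "j \<in> I" "x = f j" by blast
  have "(\<Sum>i\<in>I. (c i + (if i = j then k else 0)) *s f i) = (\<Sum>i\<in>I. c i *s f i) + (\<Sum>i\<in>I. if i = j then k *s f i else 0)"
    unfolding sum.distrib[symmetric] by (intro sum.cong) (auto simp: algebra_simps)
  also have "\<dots> = k *s x + y" using j assms(2) c by (simp add: add.commute)
  finally show ?case by metis
qed

text \<open>
  If no iterate of \<open>v\<close> depended on the earlier ones, there would be independent sets of every size
  in \<open>M\<close>.
\<close>

lemma annihilating_poly_exists:
  assumes M: "fdim M" and T: "T ` M \<subseteq> M" and v: "v \<in> M"
  shows "\<exists>p. p \<noteq> 0 \<and> (\<Sum>i\<le>degree p. coeff p i *s (T ^^ i) v) = 0"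
proof -
  have "\<exists>n. (T ^^ n) v \<in> span ((\<lambda>i. (T ^^ i) v) ` {..<n})"
  proof (rule ccontr)
    assume a: "\<not> ?thesis"
    have i: "independent ((\<lambda>i. (T ^^ i) v) ` {..<n}) \<and> card ((\<lambda>i. (T ^^ i) v) ` {..<n}) = n" for n
    proof (induction n)
      case (Suc n)
      have n: "(T ^^ n) v \<notin> span ((\<lambda>i. (T ^^ i) v) ` {..<n})" using a by blast
      then have "(T ^^ n) v \<notin> (\<lambda>i. (T ^^ i) v) ` {..<n}" by (metis span_base)
      then show ?case using Suc independent_insertI[OF n] by (simp add: lessThan_Suc)
    qed (simp add: independent_empty)
    obtain F where F: "finite F" "M \<subseteq> span F" using M by (auto simp: fdim_def)
    have "(\<lambda>i. (T ^^ i) v) ` {..<Suc (card F)} \<subseteq> span F"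
      using F funpow_mem[OF T v] by blast
    then have "card ((\<lambda>i. (T ^^ i) v) ` {..<Suc (card F)}) \<le> card F"
      using independent_span_bound[OF F(1)] i by blast
    then show False using i[of "Suc (card F)"] by linarith
  qed
  then obtain n where "(T ^^ n) v \<in> span ((\<lambda>i. (T ^^ i) v) ` {..<n})" by blast
  from span_image_sum[OF this] obtain c where c: "(T ^^ n) v = (\<Sum>i<n. c i *s (T ^^ i) v)" by auto
  define p where "p = monom 1 n - (\<Sum>i<n. monom (c i) i)"
  have co: "coeff p i = (if i = n then 1 else if i < n then - c i else 0)" for i
  proof -
    have "(\<Sum>j<n. if j = i then c j else 0) = (if i < n then c i else 0)" by simp
    moreover have "(\<Sum>j<n. coeff (monom (c j) j) i) = (\<Sum>j<n. if j = i then c j else 0)"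
      by (intro sum.cong) auto
    ultimately show ?thesis by (simp add: p_def coeff_sum)
  qed
  have d: "degree p = n"
    by (intro antisym degree_le le_degree) (auto simp: co)
  have "(\<Sum>i\<le>n. coeff p i *s (T ^^ i) v) = (\<Sum>i<n. coeff p i *s (T ^^ i) v) + (T ^^ n) v"
    by (simp add: lessThan_Suc_atMost[symmetric] co)
  also have "(\<Sum>i<n. coeff p i *s (T ^^ i) v) = - (\<Sum>i<n. c i *s (T ^^ i) v)"
    unfolding sum_negf[symmetric] by (intro sum.cong) (auto simp: co)
  also have "- (\<Sum>i<n. c i *s (T ^^ i) v) + (T ^^ n) v = 0" unfolding c by simp
  finally have "(\<Sum>i\<le>degree p. coeff p i *s (T ^^ i) v) = 0" by (simp add: d)
  moreover have "p \<noteq> 0" using co[of n] by auto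
  ultimately show ?thesis by blast
qed

end

locale acf_space = lin_space scale
  for scale :: "'a::{alg_closed_field, field_char_0} \<Rightarrow> 'b::ab_group_add \<Rightarrow> 'b" (infixr \<open>*s\<close> 75)
begin

text \<open>
  A root \<open>a\<close> of \<open>p\<close> splits off the factor \<open>T - a\<close>, and the quotient of \<open>p\<close> annihilates \<open>(T - a) v\<close>.
\<close>

lemma poly_annihilation_factors:
  assumes T: "lin T"
  shows "p \<noteq> 0 \<Longrightarrow> (\<Sum>i\<le>degree p. coeff p i *s (T ^^ i) v) = 0 \<Longrightarrow> \<exists>xs. fold (shift T) xs v = 0"
proof (induction "degree p" arbitrary: p v)
  case 0
  then have "coeff p 0 \<noteq> 0" by (metis leading_coeff_neq_0)
  then have "v = 0" using 0 by simp
  then show ?case by (intro exI[of _ "[]"]) simp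
next
  case (Suc n)
  obtain a where "poly p a = 0" using alg_closed_imp_poly_has_root[of p] Suc by auto
  then obtain q where q: "p = [:- a, 1:] * q" by (auto simp: poly_eq_0_iff_dvd)
  have q0: "q \<noteq> 0" using q Suc by auto
  then have "degree p = Suc (degree q)" unfolding q by (subst degree_mult_eq) auto
  then have dq: "degree q = n" using Suc by simp
  have cp: "coeff p i = (case i of 0 \<Rightarrow> 0 | Suc j \<Rightarrow> coeff q j) - a * coeff q i" for i
    unfolding q by (cases i) (simp_all add: coeff_pCons)
  have Tn: "lin (T ^^ i)" for i using lin_funpow[OF T] .
  have "0 = (\<Sum>i\<le>Suc n. coeff p i *s (T ^^ i) v)" using Suc by simp
  also have "\<dots> = (\<Sum>i\<le>Suc n. (case i of 0 \<Rightarrow> 0 | Suc j \<Rightarrow> coeff q j) *s (T ^^ i) v)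
      - (\<Sum>i\<le>Suc n. (a * coeff q i) *s (T ^^ i) v)"
    unfolding sum_subtractf[symmetric] by (intro sum.cong) (auto simp: cp algebra_simps)
  also have "(\<Sum>i\<le>Suc n. (case i of 0 \<Rightarrow> 0 | Suc j \<Rightarrow> coeff q j) *s (T ^^ i) v)
      = (\<Sum>i\<le>n. coeff q i *s (T ^^ i) (T v))"
    unfolding sum.atMost_Suc_shift by (simp add: funpow_swap1)
  also have "(\<Sum>i\<le>Suc n. (a * coeff q i) *s (T ^^ i) v) = (\<Sum>i\<le>n. coeff q i *s (T ^^ i) (a *s v))"
    using dq by (simp add: coeff_eq_0 lin_scale[OF Tn] mult.commute)
  also have "(\<Sum>i\<le>n. coeff q i *s (T ^^ i) (T v)) - (\<Sum>i\<le>n. coeff q i *s (T ^^ i) (a *s v))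
      = (\<Sum>i\<le>degree q. coeff q i *s (T ^^ i) (shift T a v))"
    by (simp add: dq shift_def lin_diff[OF Tn] scale_right_diff_distrib sum_subtractf)
  finally obtain xs where "fold (shift T) xs (shift T a v) = 0"
    using Suc(1)[of q "shift T a v"] dq q0 by metis
  then show ?case by (intro exI[of _ "a # xs"]) simp
qed

text \<open>
  By the previous lemma it suffices that \<open>v\<close> lies in the span whenever \<open>(T - a) v\<close> does. The
  components of \<open>(T - a) v\<close> at eigenvalues other than \<open>a\<close> have preimages under \<open>T - a\<close> in the same
  eigenspaces; what remains of \<open>v\<close> is killed by a power of \<open>T - a\<close>.
\<close>

lemma gen_eigenspace_span:
  assumes M: "fdim M" and T: "lin T" "T ` M \<subseteq> M" and v: "v \<in> M"
  shows "v \<in> span (\<Union>a. gen_eigenspace T a \<inter> M)" (is "v \<in> ?D")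
proof -
  have sM: "subspace M" using M by (rule fdim_subspace)
  have step: "v \<in> ?D" if v: "v \<in> M" and d: "shift T a v \<in> ?D" for v a
  proof -
    have "\<exists>u w. u \<in> ?D \<inter> M \<and> w \<in> gen_eigenspace T a \<and> x = shift T a u + w" if "x \<in> ?D" for x
      using that
    proof (induction rule: span_induct_alt)
      case base
      show ?case
        by (intro exI[of _ 0]) (auto simp: lin_zero[OF lin_shift[OF T(1)]] span_zero subspace_0[OF sM]
          subspace_0[OF subspace_gen_eigenspace[OF T(1)]])
    next
      case (step c x y)
      then obtain b u w where b: "x \<in> gen_eigenspace T b \<inter> M"
        and uw: "u \<in> ?D \<inter> M" "w \<in> gen_eigenspace T a" "y = shift T a u + w" by blast
      have sD: "subspace (?D \<inter> M)" using sM by (intro subspace_inter) auto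
      show ?case
      proof (cases "b = a")
        case True
        then have "c *s x + w \<in> gen_eigenspace T a"
          using b uw subspace_gen_eigenspace[OF T(1)] subspace_add subspace_scale by blast
        then show ?thesis using uw by (intro exI[of _ u] exI[of _ "c *s x + w"]) (auto simp: algebra_simps)
      next
        case False
        obtain z where z: "z \<in> gen_eigenspace T b \<inter> M" "shift T a z = x"
          using shift_surj_gen_eigenspace[OF T(1) sM T(2) _ b, of a] False by auto
        then have "z \<in> ?D \<inter> M" by (auto intro!: span_base)
        then have "c *s z + u \<in> ?D \<inter> M" using uw sD subspace_add subspace_scale by blast
        then show ?thesis using uw z
          by (intro exI[of _ "c *s z + u"] exI[of _ w])
            (simp add: lin_add[OF lin_shift[OF T(1)]] lin_scale[OF lin_shift[OF T(1)]] algebra_simps)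
      qed
    qed
    then obtain u w where u: "u \<in> ?D" "u \<in> M" "w \<in> gen_eigenspace T a" "shift T a v = shift T a u + w"
      using d by blast
    have "shift T a (v - u) = w" using u by (simp add: lin_diff[OF lin_shift[OF T(1)]])
    then have "v - u \<in> gen_eigenspace T a \<inter> M" using u v sM by (auto intro: gen_eigenspaceI subspace_diff)
    then have "v - u \<in> ?D" by (auto intro!: span_base)
    then show ?thesis using u span_add[of "v - u" _ u] by simp
  qed
  obtain p where "p \<noteq> 0" "(\<Sum>i\<le>degree p. coeff p i *s (T ^^ i) v) = 0"
    using annihilating_poly_exists[OF M T(2) v] by blast
  then obtain xs where "fold (shift T) xs v = 0" using poly_annihilation_factors[OF T(1)] by blast
  then show ?thesis using v
  proof (induction xs arbitrary: v)
    case Nil then show ?case by (simp add: span_zero)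
  next
    case (Cons a xs)
    then have "shift T a v \<in> ?D" using shift_mem[OF sM T(2)] by simp
    then show ?case using step Cons by blast
  qed
qed

lemma gen_eigenspace_components:
  assumes M: "fdim M" and T: "lin T" "T ` M \<subseteq> M" and v: "v \<in> M"
  shows "\<exists>E c. finite E \<and> (\<forall>a. c a \<in> gen_eigenspace T a \<inter> M) \<and> (\<forall>a. a \<notin> E \<longrightarrow> c a = 0) \<and> (\<Sum>a\<in>E. c a) = v"
  using gen_eigenspace_span[OF assms]
proof (induction rule: span_induct_alt)
  case base
  show ?case using fdim_subspace[OF M] subspace_gen_eigenspace[OF T(1)]
    by (intro exI[of _ "{}"] exI[of _ "\<lambda>_. 0"]) (auto simp: subspace_0)
next
  case (step k x y)
  then obtain b E c where b: "x \<in> gen_eigenspace T b \<inter> M" and E: "finite E"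
    and c: "\<And>a. c a \<in> gen_eigenspace T a \<inter> M" "\<And>a. a \<notin> E \<Longrightarrow> c a = 0" "(\<Sum>a\<in>E. c a) = y" by blast
  let ?c = "\<lambda>a. c a + (if a = b then k *s x else 0)"
  have s: "subspace (gen_eigenspace T a \<inter> M)" for a
    using fdim_subspace[OF M] subspace_gen_eigenspace[OF T(1)] by (rule subspace_inter[rotated])
  have "?c a \<in> gen_eigenspace T a \<inter> M" for a
  proof (cases "a = b")
    case True
    then show ?thesis using subspace_add[OF s c(1) subspace_scale[OF s b]] by simp
  next
    case False
    then show ?thesis using c(1)[of a] by simp
  qed
  moreover have "(\<Sum>a\<in>insert b E. ?c a) = k *s x + y"
  proof -
    have "(\<Sum>a\<in>insert b E. c a) = y" using c E by (auto simp: sum.insert_if)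
    then show ?thesis using E by (simp add: sum.distrib add.commute del: sum.insert)
  qed
  moreover have "?c a = 0" if "a \<notin> insert b E" for a using that c by simp
  ultimately show ?case using E by (intro exI[of _ "insert b E"] exI[of _ ?c]) blast
qed

text \<open>
  Components are chosen for the vectors of a basis only and then extended linearly, which makes \<open>P a\<close>
  linear by construction; independence of the eigenspaces determines its values on each of them.
\<close>

lemma gen_eigenspace_projections:
  assumes M: "fdim M" and T: "lin T" "T ` M \<subseteq> M"
  shows "\<exists>E P. finite E \<and> (\<forall>a. lin (P a)) \<and> (\<forall>a v. P a v \<in> gen_eigenspace T a \<inter> M) \<and>
    (\<forall>v\<in>M. (\<Sum>a\<in>E. P a v) = v) \<and> (\<forall>a v. a \<notin> E \<longrightarrow> P a v = 0) \<and>
    (\<forall>a b. \<forall>v \<in> gen_eigenspace T b \<inter> M. P a v = (if a = b then v else 0))"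
proof -
  obtain B where B: "B \<subseteq> M" "finite B" "independent B" "span B = M" using fdim_basis[OF M] by metis
  have "\<forall>b\<in>B. \<exists>E c. finite E \<and> (\<forall>a. c a \<in> gen_eigenspace T a \<inter> M) \<and> (\<forall>a. a \<notin> E \<longrightarrow> c a = 0) \<and> (\<Sum>a\<in>E. c a) = b"
    using gen_eigenspace_components[OF M T] B by blast
  then obtain Es c where c: "\<And>b. b \<in> B \<Longrightarrow> finite (Es b)" "\<And>b a. b \<in> B \<Longrightarrow> c b a \<in> gen_eigenspace T a \<inter> M"
    "\<And>b a. b \<in> B \<Longrightarrow> a \<notin> Es b \<Longrightarrow> c b a = 0" "\<And>b. b \<in> B \<Longrightarrow> (\<Sum>a\<in>Es b. c b a) = b" by metis
  define E where "E = (\<Union>b\<in>B. Es b)"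
  have E: "finite E" using B c by (simp add: E_def)
  have "\<forall>a. \<exists>P. lin P \<and> (\<forall>b\<in>B. P b = c b a) \<and> range P \<subseteq> span ((\<lambda>b. c b a) ` B)"
  proof
    fix a show "\<exists>P. lin P \<and> (\<forall>b\<in>B. P b = c b a) \<and> range P \<subseteq> span ((\<lambda>b. c b a) ` B)"
      using lin_extend[OF B(3), of "\<lambda>b. c b a"] by metis
  qed
  then obtain P where P: "\<And>a. lin (P a)" "\<And>a b. b \<in> B \<Longrightarrow> P a b = c b a"
    "\<And>a. range (P a) \<subseteq> span ((\<lambda>b. c b a) ` B)" by metis
  have s: "subspace (gen_eigenspace T a \<inter> M)" for a
    using fdim_subspace[OF M] subspace_gen_eigenspace[OF T(1)] by (rule subspace_inter[rotated])
  have mem: "P a v \<in> gen_eigenspace T a \<inter> M" for a v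
    using P(3)[of a] span_minimal[OF _ s[of a], of "(\<lambda>b. c b a) ` B"] c(2) by blast
  have out: "P a v = 0" if "a \<notin> E" for a v
  proof -
    have "(\<lambda>b. c b a) ` B \<subseteq> {0}" using that c(3) by (auto simp: E_def)
    then have "span ((\<lambda>b. c b a) ` B) \<subseteq> {0}" by (intro span_minimal) auto
    then show ?thesis using P(3)[of a] by blast
  qed
  have tot: "(\<Sum>a\<in>E. P a v) = v" if "v \<in> M" for v
    using that unfolding B(4)[symmetric]
  proof (induction rule: span_induct_alt)
    case base then show ?case by (simp add: lin_zero[OF P(1)])
  next
    case (step k x y)
    have "(\<Sum>a\<in>E. c x a) = (\<Sum>a\<in>Es x. c x a)"
      using step(1) c(3) E by (intro sum.mono_neutral_right) (auto simp: E_def)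
    then have "(\<Sum>a\<in>E. P a x) = x" using c(4) step(1) P(2) by simp
    moreover have "(\<Sum>a\<in>E. P a (k *s x + y)) = k *s (\<Sum>a\<in>E. P a x) + (\<Sum>a\<in>E. P a y)"
      by (simp add: lin_add[OF P(1)] lin_scale[OF P(1)] sum.distrib scale_sum_right)
    ultimately show ?case using step by simp
  qed
  have "P a v = (if a = b then v else 0)" if v: "v \<in> gen_eigenspace T b \<inter> M" for a b v
  proof -
    let ?E = "insert a (insert b E)"
    let ?c = "\<lambda>a. P a v - (if a = b then v else 0)"
    have "(\<Sum>a\<in>?E. P a v) = (\<Sum>a\<in>E. P a v)" using E out by (intro sum.mono_neutral_right) auto
    then have "(\<Sum>a\<in>?E. ?c a) = 0"
      using tot[of v] v E by (simp add: sum_subtractf sum.delta del: sum.insert)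
    moreover have "?c a \<in> gen_eigenspace T a" for a
      using mem[of a v] v subspace_diff[OF subspace_gen_eigenspace[OF T(1)]] by (cases "a = b") auto
    moreover have "finite ?E" using E by simp
    ultimately have "?c a = 0" using gen_eigenspace_independent[OF T(1), of ?E ?c] by blast
    then show ?thesis by simp
  qed
  with E P(1) mem tot out show ?thesis
    by (intro exI[of _ E] exI[of _ P] conjI allI ballI impI) simp_all
qed

lemma rational_functional:
  assumes "(a :: 'a) \<noteq> 0"
  shows "\<exists>f :: 'a \<Rightarrow> rat. (\<forall>x y. f (x + y) = f x + f y) \<and> (\<forall>q x. f (of_rat q * x) = q * f x) \<and> f a = 1"
proof -
  interpret Q: vector_space "\<lambda>q (x :: 'a). of_rat q * x"
    by unfold_locales (simp_all add: algebra_simps of_rat_add of_rat_mult)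
  interpret R: vector_space "(*) :: rat \<Rightarrow> rat \<Rightarrow> rat" by (rule vector_space_mult)
  interpret vector_space_pair "\<lambda>q (x :: 'a). of_rat q * x" "(*) :: rat \<Rightarrow> rat \<Rightarrow> rat" by unfold_locales
  have "Q.independent {a}" using assms by simp
  then obtain f where "Vector_Spaces.linear (\<lambda>q (x :: 'a). of_rat q * x) ((*) :: rat \<Rightarrow> rat \<Rightarrow> rat) f" "f a = 1"
    using linear_independent_extend[of "{a}" "\<lambda>_. 1"] by auto
  then show ?thesis by (auto simp: Vector_Spaces.linear_iff)
qed

text \<open>
  Let \<open>f\<close> be additive, hence \<open>\<rat>\<close>-linear, and \<open>y\<close> the operator that is \<open>f a\<close> on the
  generalized eigenspace of \<open>a\<close>. Then \<open>tr T y = \<Sum> a f(a) dim\<close>, and applying \<open>f\<close> to \<open>tr T y = 0\<close> gives \<open>\<Sum> f(a)\<^sup>2 dim = 0\<close> in \<open>\<rat>\<close>. So \<open>f\<close>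
  vanishes at every eigenvalue, while for any \<open>a \<noteq> 0\<close> there is an \<open>f\<close> with \<open>f a = 1\<close>.
\<close>

lemma nilpotent_criterion:
  assumes M: "fdim M" and T: "lin T" "T ` M \<subseteq> M"
    and tr: "\<And>(f :: 'a \<Rightarrow> rat) y. (\<And>a b. f (a + b) = f a + f b) \<Longrightarrow> lin y \<Longrightarrow> y ` M \<subseteq> M \<Longrightarrow>
      (\<And>a v. v \<in> gen_eigenspace T a \<inter> M \<Longrightarrow> y v = of_rat (f a) *s v) \<Longrightarrow> trace_on M (\<lambda>v. T (y v)) = 0"
  shows "locally_nilpotent_on M T"
proof -
  have sM: "subspace M" using M by (rule fdim_subspace)
  obtain E P where E: "finite E" and P: "\<And>a. lin (P a)" "\<And>a v. P a v \<in> gen_eigenspace T a \<inter> M"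
    "\<And>v. v \<in> M \<Longrightarrow> (\<Sum>a\<in>E. P a v) = v" "\<And>a v. a \<notin> E \<Longrightarrow> P a v = 0"
    "\<And>a b v. v \<in> gen_eigenspace T b \<inter> M \<Longrightarrow> P a v = (if a = b then v else 0)"
    using gen_eigenspace_projections[OF M T] by metis
  let ?G = "\<lambda>a. gen_eigenspace T a \<inter> M"
  have sG: "subspace (?G a)" for a using subspace_inter[OF subspace_gen_eigenspace[OF T(1)] sM] .
  have fG: "fdim (?G a)" for a using fdim_subset[OF M sG] by blast
  have PM: "P a ` M \<subseteq> M" for a using P(2) by blast
  have TG: "T ` ?G a \<subseteq> ?G a" for a using T gen_eigenspace_invariant[OF T(1)] by blast
  have trP: "trace_on M (\<lambda>v. T (P a v)) = a * of_nat (dim (?G a))" for a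
  proof -
    have "trace_on M (\<lambda>v. T (P a v)) = trace_on (?G a) (\<lambda>v. T (P a v))"
      using sG TG P(2) by (intro trace_on_image[OF M] lin_comp[OF P(1) T(1)]) blast+
    also have "\<dots> = trace_on (?G a) (\<lambda>v. shift T a v + a *s v)"
    proof (rule trace_cong)
      fix v assume "v \<in> ?G a"
      then have "P a v = v" using P(5)[of v a a] by simp
      then show "T (P a v) = shift T a v + a *s v" by (simp add: shift_def)
    qed
    also have "\<dots> = trace_on (?G a) (shift T a) + trace_on (?G a) (\<lambda>v. a *s v)"
      using shift_mem[OF sG TG] sG
      by (intro trace_add fG lin_shift T lin_smult lin_id)
        (use subspace_scale[OF sG] in blast)+
    also have "trace_on (?G a) (shift T a) = 0"
      using shift_mem[OF sG TG]
      by (intro trace_nilpotent fG lin_shift T) (auto simp: locally_nilpotent_on_def gen_eigenspace_def simp del: Int_iff, blast)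
    also have "trace_on (?G a) (\<lambda>v. a *s v) = a * of_nat (dim (?G a))"
      using trace_scale[OF fG lin_id _ lin_id] trace_id[OF fG] by fastforce
    finally show ?thesis by simp
  qed
  have zero: "?G a = {0}" if a: "a \<noteq> 0" for a
  proof -
    obtain f :: "'a \<Rightarrow> rat" where f: "\<And>x y. f (x + y) = f x + f y" "\<And>q x. f (of_rat q * x) = q * f x" "f a = 1"
      using rational_functional[OF a] by blast
    define y where "y v = (\<Sum>b\<in>E. of_rat (f b) *s P b v)" for v
    have ly: "lin y" unfolding y_def by (intro lin_sums lin_smult P)
    have yM: "y ` M \<subseteq> M" unfolding y_def using P(2) sM by (auto intro!: subspace_sum subspace_scale)
    have yG: "y v = of_rat (f b) *s v" if "v \<in> ?G b" for b v
    proof -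
      have "y v = (\<Sum>c\<in>E. if c = b then of_rat (f b) *s v else 0)"
        unfolding y_def by (intro sum.cong) (auto simp: P(5)[OF that])
      then show ?thesis using P(4)[of b v] P(5)[OF that, of b] E by (cases "b \<in> E") auto
    qed
    \<comment> \<open>Apply \<open>f\<close> to the vanishing trace; the coefficients \<open>f b * dim\<close> are rational.\<close>
    have "0 = trace_on M (\<lambda>v. T (y v))" using tr[OF f(1) ly yM yG] by simp
    also have "(\<lambda>v. T (y v)) = (\<lambda>v. \<Sum>b\<in>E. of_rat (f b) *s T (P b v))"
      by (simp add: y_def lin_sum[OF T(1)] lin_scale[OF T(1)])
    also have "trace_on M \<dots> = (\<Sum>b\<in>E. trace_on M (\<lambda>v. of_rat (f b) *s T (P b v)))"
      using PM T sM by (intro trace_sum M lin_smult lin_comp[OF P(1) T(1)]) (auto intro!: subspace_scale)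
    also have "\<dots> = (\<Sum>b\<in>E. of_rat (f b) * trace_on M (\<lambda>v. T (P b v)))"
      using PM T by (intro sum.cong refl trace_scale[OF M lin_id _ lin_comp[OF P(1) T(1)]]) auto
    also have "\<dots> = (\<Sum>b\<in>E. of_rat (f b * of_nat (dim (?G b))) * b)"
      by (simp add: trP of_rat_mult algebra_simps)
    finally have "f (\<Sum>b\<in>E. of_rat (f b * of_nat (dim (?G b))) * b) = 0"
      using f(1)[of 0 0] by simp
    moreover have "f (sum g E) = (\<Sum>b\<in>E. f (g b))" for g
      using f(1)[of 0 0] by (induction E rule: infinite_finite_induct) (simp_all add: f(1))
    ultimately have "(\<Sum>b\<in>E. f b * of_nat (dim (?G b)) * f b) = 0" by (simp add: f(2))
    moreover have "0 \<le> f b * of_nat (dim (?G b)) * f b" for b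
    proof -
      have "f b * of_nat (dim (?G b)) * f b = of_nat (dim (?G b)) * (f b * f b)" by simp
      then show ?thesis by (metis mult_nonneg_nonneg of_nat_0_le_iff zero_le_square)
    qed
    ultimately have "\<forall>b\<in>E. f b * of_nat (dim (?G b)) * f b = 0"
      using sum_nonneg_eq_0_iff[OF E, of "\<lambda>b. f b * of_nat (dim (?G b)) * f b"] by simp
    then have "a \<in> E \<Longrightarrow> dim (?G a) = 0" using f(3) by auto
    moreover have "?G a \<subseteq> {0}" if "a \<notin> E"
    proof
      fix v assume "v \<in> ?G a"
      then show "v \<in> {0}" using P(5)[of v a a] P(4)[OF that, of v] by simp
    qed
    ultimately show ?thesis using fdim_dim_0[OF fG] subspace_0[OF sG] by blast
  qed
  show ?thesis unfolding locally_nilpotent_on_def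
  proof
    fix v assume v: "v \<in> M"
    have "P a v = 0" if "a \<noteq> 0" for a using zero[OF that] P(2)[of a v] by blast
    then have "(\<Sum>a\<in>E. P a v) = (\<Sum>a\<in>E. if a = 0 then P a v else 0)"
      by (intro sum.cong) auto
    then have "(\<Sum>a\<in>E. P a v) = (if 0 \<in> E then P 0 v else 0)" using E by simp
    then have "v \<in> gen_eigenspace T 0" using P(2,3) v subspace_0[OF sG] by (metis Int_iff)
    moreover have "shift T 0 = T" by (auto simp: shift_def)
    ultimately show "\<exists>n. (T ^^ n) v = 0" by (simp add: gen_eigenspace_def)
  qed
qed

end

section \<open>Engel's theorem\<close>

sublocale lie_algebra \<subseteq> lin_space scale by unfold_locales

context lie_algebra begin

lemma bracket_add: "bracket (x + y) z = bracket x z + bracket y z" "bracket z (x + y) = bracket z x + bracket z y"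
  using lin_add[OF bracket_linear_left] lin_add[OF bracket_linear_right] by blast+

lemma bracket_scale: "bracket (c *\<^sub>L x) z = c *\<^sub>L bracket x z" "bracket z (c *\<^sub>L x) = c *\<^sub>L bracket z x"
  using lin_scale[OF bracket_linear_left] lin_scale[OF bracket_linear_right] by blast+

lemma bracket_zero: "bracket 0 z = 0" "bracket z 0 = 0"
  using lin_zero[OF bracket_linear_left] lin_zero[OF bracket_linear_right] by blast+

lemma bracket_anticomm: "bracket x y = - bracket y x"
proof -
  have "bracket (x + y) (x + y) = bracket x x + bracket x y + bracket y x + bracket y y"
    by (simp add: bracket_add)
  then show ?thesis by (simp add: bracket_self eq_neg_iff_add_eq_0)
qed

lemma bracket_bracket: "bracket (bracket x y) z = bracket x (bracket y z) - bracket y (bracket x z)"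
proof -
  have "bracket z (bracket x y) = - bracket (bracket x y) z" by (rule bracket_anticomm)
  moreover have "bracket y (bracket z x) = - bracket y (bracket x z)"
    using bracket_anticomm[of z x] lin_neg[OF bracket_linear_right] by simp
  ultimately have "bracket x (bracket y z) + - bracket y (bracket x z) + - bracket (bracket x y) z = 0"
    using jacobi[of x y z] by (simp only:)
  then show ?thesis by (simp add: algebra_simps)
qed

definition lie_subalgebra :: "'l set \<Rightarrow> bool" where
  "lie_subalgebra H \<longleftrightarrow> subspace H \<and> (\<forall>x\<in>H. \<forall>y\<in>H. bracket x y \<in> H)"

lemma lie_ideal_left: "lie_ideal I \<Longrightarrow> y \<in> I \<Longrightarrow> bracket y x \<in> I"
  using bracket_anticomm[of y x] subspace_neg by (auto simp: lie_ideal_def)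

lemma lie_ideal_subalgebra: "lie_ideal I \<Longrightarrow> lie_subalgebra I"
  by (auto simp: lie_ideal_def lie_subalgebra_def)

lemma lie_ideal_brackets:
  assumes I: "lie_ideal I"
  shows "lie_ideal (span {bracket a b | a b. a \<in> I})" (is "lie_ideal (span ?S)")
  unfolding lie_ideal_def
proof (intro conjI allI ballI)
  fix x y assume "y \<in> span ?S"
  then show "bracket x y \<in> span ?S"
  proof (induction rule: span_induct_alt)
    case base then show ?case by (simp add: bracket_zero span_zero)
  next
    case (step c z w)
    then obtain a b where ab: "z = bracket a b" "a \<in> I" by blast
    have "bracket x z = bracket (bracket x a) b + bracket a (bracket x b)"
      unfolding ab bracket_bracket[of x a b] by simp
    moreover have "bracket x a \<in> I" using ab I by (auto simp: lie_ideal_def)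
    then have "bracket (bracket x a) b \<in> span ?S" "bracket a (bracket x b) \<in> span ?S"
      using ab by (auto intro!: span_base)
    ultimately show ?case using step
      by (simp add: bracket_add bracket_scale span_add span_scale)
  qed
qed simp

end

locale fd_lie_algebra = lie_algebra scale bracket
  for scale :: "'k::field \<Rightarrow> 'l::ab_group_add \<Rightarrow> 'l" (infixr \<open>*\<^sub>L\<close> 75) and bracket +
  assumes fdim_UNIV: "fdim UNIV"

locale lie_rep = L: fd_lie_algebra scaleL bracket + V: lin_space scale
  for scaleL :: "'k::field \<Rightarrow> 'l::ab_group_add \<Rightarrow> 'l" (infixr \<open>*\<^sub>L\<close> 75)
    and bracket :: "'l \<Rightarrow> 'l \<Rightarrow> 'l"
    and scale :: "'k \<Rightarrow> 'b::ab_group_add \<Rightarrow> 'b" (infixr \<open>*s\<close> 75) +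
  fixes M :: "'b set" and \<rho> :: "'l \<Rightarrow> 'b \<Rightarrow> 'b"
  assumes fdim_M: "V.fdim M"
    and rho_lin: "V.lin (\<rho> x)"
    and rho_mem: "v \<in> M \<Longrightarrow> \<rho> x v \<in> M"
    and rho_add: "v \<in> M \<Longrightarrow> \<rho> (x + y) v = \<rho> x v + \<rho> y v"
    and rho_scale: "v \<in> M \<Longrightarrow> \<rho> (c *\<^sub>L x) v = c *s \<rho> x v"
    and rho_bracket: "v \<in> M \<Longrightarrow> \<rho> (bracket x y) v = \<rho> x (\<rho> y v) - \<rho> y (\<rho> x v)"
begin

lemma subspace_M: "V.subspace M"
  using V.fdim_subspace[OF fdim_M] .

lemma rho_image: "\<rho> x ` M \<subseteq> M"
  using rho_mem by blast

lemma rho_sum: "v \<in> M \<Longrightarrow> \<rho> (sum f I) v = (\<Sum>i\<in>I. \<rho> (f i) v)"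
proof (induction I rule: infinite_finite_induct)
  case (infinite I) then show ?case using rho_scale[of v 0 0] by simp
next
  case empty then show ?case using rho_scale[of v 0 0] by simp
qed (simp add: rho_add)

definition stable :: "'l set \<Rightarrow> 'b set \<Rightarrow> bool" where
  "stable H N \<longleftrightarrow> (\<forall>x\<in>H. \<forall>v\<in>N. \<rho> x v \<in> N)"

text \<open>
  The conclusion of Engel's theorem for all nonzero stable subquotients \<open>P/N\<close> of \<open>M\<close> at once.
  In this form it passes from a subalgebra \<open>H\<close> to \<open>H + F y\<close>, see \<open>acts_unipotently_insert\<close>.
\<close>

definition acts_unipotently :: "'l set \<Rightarrow> bool" where
  "acts_unipotently H \<longleftrightarrow> (\<forall>N P. V.subspace N \<longrightarrow> V.subspace P \<longrightarrow> N \<subset> P \<longrightarrow> P \<subseteq> M \<longrightarrow>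
     stable H N \<longrightarrow> stable H P \<longrightarrow> (\<exists>v \<in> P - N. \<forall>x\<in>H. \<rho> x v \<in> N))"

lemma acts_unipotentlyD:
  assumes "acts_unipotently H" "V.subspace N" "V.subspace P" "N \<subset> P" "P \<subseteq> M" "stable H N" "stable H P"
  shows "\<exists>v \<in> P - N. \<forall>x\<in>H. \<rho> x v \<in> N"
  using assms unfolding acts_unipotently_def by blast

text \<open>
  The \<open>i\<close>-th term consists of the vectors killed by all products of \<open>i\<close> elements of \<open>H\<close>.
\<close>

primrec socle_series :: "'l set \<Rightarrow> nat \<Rightarrow> 'b set" where
  "socle_series H 0 = {0}"
| "socle_series H (Suc i) = {v \<in> M. \<forall>x\<in>H. \<rho> x v \<in> socle_series H i}"

lemma subspace_socle: "V.subspace (socle_series H i) \<and> socle_series H i \<subseteq> M"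
proof (induction i)
  case 0 then show ?case using V.subspace_0[OF subspace_M] by simp
next
  case (Suc i)
  then show ?case using subspace_M
    by (auto intro!: V.subspaceI simp: lin_zero[OF rho_lin] lin_add[OF rho_lin] lin_scale[OF rho_lin]
      V.subspace_0 V.subspace_add V.subspace_scale)
qed

lemma socle_mono: "socle_series H i \<subseteq> socle_series H (Suc i)"
proof (induction i)
  case 0
  show ?case using V.subspace_0[OF subspace_M] by (auto simp: lin_zero[OF rho_lin])
next
  case (Suc i)
  then show ?case by auto
qed

lemma socle_exhausts:
  assumes "acts_unipotently H"
  shows "\<exists>n. socle_series H n = M"
proof -
  obtain n where n: "socle_series H (Suc n) = socle_series H n"
    using V.chain_stabilizes[OF fdim_M, of "socle_series H"] subspace_socle socle_mono by blast
  have "socle_series H n = M"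
  proof (rule ccontr)
    assume "socle_series H n \<noteq> M"
    then have "socle_series H n \<subset> M" using subspace_socle by blast
    moreover have "stable H (socle_series H n)" using socle_mono[of H n] unfolding stable_def by auto
    moreover have "stable H M" unfolding stable_def using rho_mem by blast
    ultimately obtain v where "v \<in> M - socle_series H n" "\<forall>x\<in>H. \<rho> x v \<in> socle_series H n"
      using acts_unipotentlyD[OF assms, of "socle_series H n" M] subspace_socle subspace_M by blast
    then have "v \<in> socle_series H (Suc n)" "v \<notin> socle_series H n" by auto
    then show False by (simp only: n)
  qed
  then show ?thesis by blast
qed

text \<open>
  Otherwise some iterated bracket \<open>[h\<^sub>s, \<dots> [h\<^sub>1, y]]\<close> stays outside \<open>H\<close> for every \<open>s\<close>. But \<open>\<rho> y\<close> raises the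
  degree in the socle series by at most its length \<open>n\<close>, and each bracket with \<open>H\<close> lowers the shift by
  one, so after \<open>2 n\<close> brackets the result acts as zero and belongs to \<open>H\<close> after all.
\<close>

lemma engel_normalizer:
  assumes K: "L.lie_subalgebra K" and H: "L.lie_subalgebra H" "H \<subset> K" "acts_unipotently H"
    and Z: "\<And>x. x \<in> K \<Longrightarrow> (\<And>v. v \<in> M \<Longrightarrow> \<rho> x v = 0) \<Longrightarrow> x \<in> H"
  shows "\<exists>y \<in> K - H. \<forall>h\<in>H. bracket h y \<in> H"
proof (rule ccontr)
  assume neg: "\<not> ?thesis"
  let ?F = "socle_series H"
  obtain n where n: "?F n = M" using socle_exhausts[OF H(3)] by blast
  have down: "\<rho> h v \<in> ?F (i - 1)" if "v \<in> ?F i" "h \<in> H" for v i h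
    using that by (cases i) (auto simp: lin_zero[OF rho_lin])
  have mono: "?F i \<subseteq> ?F (i + j)" for i j
    using lift_Suc_mono_le[of ?F i "i + j"] socle_mono by auto
  have "\<exists>y \<in> K - H. \<forall>i. \<forall>v \<in> ?F i. \<rho> y v \<in> ?F (i + n - s)" for s
  proof (induction s)
    case 0
    obtain y where y: "y \<in> K - H" using H by blast
    have "\<rho> y v \<in> ?F (i + n)" if "v \<in> ?F i" for i v
    proof -
      have "v \<in> M" using that subspace_socle by blast
      then have "\<rho> y v \<in> ?F n" using rho_mem n by simp
      then show ?thesis using mono[of n i] by (auto simp: add.commute)
    qed
    then show ?case using y by auto
  next
    case (Suc s)
    then obtain y where y: "y \<in> K - H" "\<And>i v. v \<in> ?F i \<Longrightarrow> \<rho> y v \<in> ?F (i + n - s)" by blast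
    obtain h where h: "h \<in> H" "bracket h y \<notin> H" using neg y by blast
    have "bracket h y \<in> K - H" using h y K H unfolding L.lie_subalgebra_def by blast
    moreover have "\<rho> (bracket h y) v \<in> ?F (i + n - Suc s)" if v: "v \<in> ?F i" for i v
    proof -
      have vM: "v \<in> M" using v subspace_socle by blast
      have 1: "\<rho> h (\<rho> y v) \<in> ?F (i + n - Suc s)" using down[OF y(2)[OF v] h(1)] by simp
      have 2: "\<rho> y (\<rho> h v) \<in> ?F (i + n - Suc s)"
      proof (cases i)
        case 0
        then have "v = 0" using v by simp
        then show ?thesis using subspace_socle V.subspace_0 by (simp add: lin_zero[OF rho_lin])
      next
        case (Suc j)
        then show ?thesis using y(2)[OF down[OF v h(1)]] by simp
      qed
      show ?thesis using rho_bracket[OF vM] 1 2 subspace_socle V.subspace_diff by simp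
    qed
    ultimately show ?case by blast
  qed
  from this[of "n + n"] obtain y where y: "y \<in> K - H" "\<And>v. v \<in> ?F n \<Longrightarrow> \<rho> y v \<in> ?F (n + n - (n + n))"
    by blast
  then have "y \<in> H" using Z[of y] n by simp
  then show False using y by blast
qed

text \<open>
  The vectors of \<open>P\<close> that \<open>H\<close> sends into \<open>N\<close> form a \<open>y\<close>-stable set because \<open>y\<close> normalizes \<open>H\<close>. Starting from
  one outside \<open>N\<close>, its last iterate under \<open>y\<close> that is still outside \<open>N\<close> is the required vector.
\<close>

lemma acts_unipotently_insert:
  assumes H: "L.subspace H" "acts_unipotently H"
    and y: "\<And>h. h \<in> H \<Longrightarrow> bracket h y \<in> H" "V.locally_nilpotent_on M (\<rho> y)"
    and H': "\<And>x. x \<in> H' \<Longrightarrow> \<exists>c. x - c *\<^sub>L y \<in> H" "H \<subseteq> H'" "y \<in> H'"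
  shows "acts_unipotently H'"
  unfolding acts_unipotently_def
proof (intro allI impI)
  fix N P assume N: "V.subspace N" and P: "V.subspace P" "N \<subset> P" "P \<subseteq> M" and st: "stable H' N" "stable H' P"
  have stH: "stable H N" "stable H P" using st H'(2) unfolding stable_def by blast+
  define Q where "Q = {v \<in> P. \<forall>h\<in>H. \<rho> h v \<in> N}"
  obtain v0 where v0: "v0 \<in> Q" "v0 \<notin> N"
  proof -
    obtain v where "v \<in> P - N" "\<forall>x\<in>H. \<rho> x v \<in> N"
      using acts_unipotentlyD[OF H(2) N P stH] by blast
    then show ?thesis using that[of v] by (simp add: Q_def)
  qed
  have yQ: "\<rho> y v \<in> Q" if v: "v \<in> Q" for v
  proof -
    have vP: "v \<in> P" "v \<in> M" using v P by (auto simp: Q_def)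
    have "\<rho> h (\<rho> y v) \<in> N" if h: "h \<in> H" for h
    proof -
      have "\<rho> h (\<rho> y v) = \<rho> (bracket h y) v + \<rho> y (\<rho> h v)" using rho_bracket[OF vP(2), of h y] by simp
      moreover have "\<rho> (bracket h y) v \<in> N" using v y(1)[OF h] by (simp add: Q_def)
      moreover have "\<rho> y (\<rho> h v) \<in> N" using v h st(1) H'(3) by (auto simp: Q_def stable_def)
      ultimately show ?thesis using N V.subspace_add by simp
    qed
    then show ?thesis using vP st(2) H'(3) by (auto simp: Q_def stable_def)
  qed
  then have pQ: "(\<rho> y ^^ k) v0 \<in> Q" for k using v0 by (induction k) auto
  have "v0 \<in> M" using v0 P by (auto simp: Q_def)
  then obtain k where "(\<rho> y ^^ k) v0 = 0" using y(2) unfolding V.locally_nilpotent_on_def by blast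
  then have ex: "\<exists>k. (\<rho> y ^^ k) v0 \<in> N" using V.subspace_0[OF N] by metis
  define k where "k = (LEAST k. (\<rho> y ^^ k) v0 \<in> N)"
  have k: "(\<rho> y ^^ k) v0 \<in> N" unfolding k_def using ex by (rule LeastI_ex)
  obtain j where j: "k = Suc j" using k v0 by (cases k) auto
  define v where "v = (\<rho> y ^^ j) v0"
  have v: "v \<in> Q" "v \<notin> N" "\<rho> y v \<in> N"
    using pQ[of j] k j not_less_Least[of j "\<lambda>k. (\<rho> y ^^ k) v0 \<in> N"] by (auto simp: v_def k_def[symmetric])
  have vM: "v \<in> P" "v \<in> M" using v P by (auto simp: Q_def)
  have "\<rho> x v \<in> N" if x: "x \<in> H'" for x
  proof -
    obtain c where c: "x - c *\<^sub>L y \<in> H" using H'(1)[OF x] by blast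
    have "\<rho> x v = \<rho> ((x - c *\<^sub>L y) + c *\<^sub>L y) v" by simp
    also have "\<dots> = \<rho> (x - c *\<^sub>L y) v + c *s \<rho> y v" using vM by (simp only: rho_add rho_scale)
    finally show ?thesis using v c N by (auto simp: Q_def intro: V.subspace_add V.subspace_scale)
  qed
  then show "\<exists>v \<in> P - N. \<forall>x\<in>H'. \<rho> x v \<in> N" using v vM by blast
qed

text \<open>
  A subalgebra of \<open>K\<close> of largest dimension among those that act unipotently and contain the kernel
  of the action is \<open>K\<close> itself, as it could otherwise be enlarged by an element normalizing it.
\<close>

theorem engel:
  assumes K: "L.lie_subalgebra K" and nil: "\<And>x. x \<in> K \<Longrightarrow> V.locally_nilpotent_on M (\<rho> x)"
  shows "acts_unipotently K"
proof -
  define Z where "Z = {x \<in> K. \<forall>v\<in>M. \<rho> x v = 0}"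
  \<comment> \<open>Containing \<open>Z\<close> ensures that an iterated bracket that acts as zero has returned to \<open>H\<close>.\<close>
  define cand where "cand H \<longleftrightarrow> L.lie_subalgebra H \<and> Z \<subseteq> H \<and> H \<subseteq> K \<and> acts_unipotently H" for H
  have rho0: "\<rho> 0 v = 0" if "v \<in> M" for v using rho_scale[OF that, of 0 0] by simp
  have "L.subspace Z" using K unfolding Z_def L.lie_subalgebra_def
    by (intro L.subspaceI) (auto simp: rho0 rho_add rho_scale L.subspace_0 L.subspace_add L.subspace_scale)
  then have "L.lie_subalgebra Z" using K
    by (auto simp: L.lie_subalgebra_def Z_def rho_bracket lin_zero[OF rho_lin])
  moreover have "acts_unipotently Z" unfolding acts_unipotently_def
  proof (intro allI impI)
    fix N P assume "V.subspace N" "N \<subset> P" "P \<subseteq> M"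
    then obtain v where "v \<in> P - N" "v \<in> M" "0 \<in> N" using V.subspace_0 by blast
    then show "\<exists>v \<in> P - N. \<forall>x\<in>Z. \<rho> x v \<in> N" by (intro bexI[of _ v]) (auto simp: Z_def)
  qed
  ultimately have "cand Z" by (auto simp: cand_def Z_def)
  moreover have "L.dim H < Suc (L.dim UNIV)" if "cand H" for H
    using that L.fdim_subset_dim_le[OF L.fdim_UNIV, of H] by (auto simp: cand_def L.lie_subalgebra_def)
  ultimately obtain H where H: "cand H" and max: "\<And>H'. cand H' \<Longrightarrow> L.dim H' \<le> L.dim H"
    using ex_has_greatest_nat[of cand Z L.dim "Suc (L.dim UNIV)"] by auto
  have sH: "L.subspace H" using H by (simp add: cand_def L.lie_subalgebra_def)
  have "H = K"
  proof (rule ccontr)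
    assume "H \<noteq> K"
    then obtain y where y: "y \<in> K" "y \<notin> H" "\<And>h. h \<in> H \<Longrightarrow> bracket h y \<in> H"
    proof -
      have "H \<subset> K" using H \<open>H \<noteq> K\<close> by (auto simp: cand_def)
      moreover have "x \<in> H" if "x \<in> K" "\<And>v. v \<in> M \<Longrightarrow> \<rho> x v = 0" for x
        using that H by (auto simp: cand_def Z_def)
      ultimately have "\<exists>y \<in> K - H. \<forall>h\<in>H. bracket h y \<in> H"
        using H by (intro engel_normalizer[OF K]) (auto simp: cand_def)
      then show ?thesis using that by blast
    qed
    define H' where "H' = L.span (insert y H)"
    have "L.span H = H" by (simp only: L.span_eq_iff sH)
    then have H'iff: "x \<in> H' \<longleftrightarrow> (\<exists>c. x - c *\<^sub>L y \<in> H)" for x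
      unfolding H'_def L.span_breakdown_eq by (simp only:)
    have HH': "H \<subseteq> H'" "y \<in> H'" unfolding H'_def using L.span_base by blast+
    have sH': "L.subspace H'" unfolding H'_def by simp
    have "insert y H \<subseteq> K" using y H by (auto simp: cand_def)
    then have H'K: "H' \<subseteq> K" unfolding H'_def using K by (intro L.span_minimal) (auto simp: L.lie_subalgebra_def)
    have "bracket u v \<in> H'" if uv: "u \<in> H'" "v \<in> H'" for u v
    proof -
      obtain a b where ab: "u - a *\<^sub>L y \<in> H" "v - b *\<^sub>L y \<in> H" using uv H'iff by blast
      let ?u = "u - a *\<^sub>L y" and ?v = "v - b *\<^sub>L y"
      have "bracket u v = bracket (?u + a *\<^sub>L y) (?v + b *\<^sub>L y)" by simp
      also have "\<dots> = bracket ?u ?v + b *\<^sub>L bracket ?u y + a *\<^sub>L bracket y ?v"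
        unfolding L.bracket_add L.bracket_scale L.bracket_self by (simp add: algebra_simps)
      also have "\<dots> = bracket ?u ?v + b *\<^sub>L bracket ?u y - a *\<^sub>L bracket ?v y"
        using L.bracket_anticomm[of y ?v] by simp
      also have "\<dots> \<in> H"
        using ab y(3) H sH unfolding cand_def L.lie_subalgebra_def
        by (intro L.subspace_add L.subspace_diff L.subspace_scale) blast+
      finally show ?thesis using HH' by blast
    qed
    moreover have "acts_unipotently H'"
      using acts_unipotently_insert[OF sH _ y(3) nil[OF y(1)], of H'] H H'iff HH' by (auto simp: cand_def)
    ultimately have "cand H'" using H HH' H'K sH' by (auto simp: cand_def L.lie_subalgebra_def)
    moreover have "H \<subset> H'" using HH' y by blast
    then have "L.dim H < L.dim H'"
      using L.fdim_psubset_dim[OF L.fdim_subset[OF L.fdim_UNIV sH'] sH] by blast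
    ultimately show False using max[of H'] by linarith
  qed
  then show ?thesis using H by (simp add: cand_def)
qed

end

section \<open>Cartan's criterion and the Killing form\<close>

locale acf_lie_rep = lie_rep scaleL bracket scale M \<rho>
  for scaleL :: "'k::{alg_closed_field, field_char_0} \<Rightarrow> 'l::ab_group_add \<Rightarrow> 'l" (infixr \<open>*\<^sub>L\<close> 75)
    and bracket :: "'l \<Rightarrow> 'l \<Rightarrow> 'l"
    and scale :: "'k \<Rightarrow> 'b::ab_group_add \<Rightarrow> 'b" (infixr \<open>*s\<close> 75)
    and M :: "'b set" and \<rho> :: "'l \<Rightarrow> 'b \<Rightarrow> 'b"
begin

sublocale V: acf_space scale by unfold_locales
sublocale L: acf_space scaleL by unfold_locales

definition trace_form :: "'l \<Rightarrow> 'l \<Rightarrow> 'k" where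
  "trace_form x y = V.trace_on M (\<lambda>v. \<rho> x (\<rho> y v))"

definition form_radical :: "'l set" where
  "form_radical = {x. \<forall>y. trace_form x y = 0}"

lemma lin_rho_comp: "V.lin T \<Longrightarrow> V.lin (\<lambda>v. \<rho> x (T v))"
  by (rule lin_comp[OF _ rho_lin])

lemma image_rho_comp: "T ` M \<subseteq> M \<Longrightarrow> (\<lambda>v. \<rho> x (T v)) ` M \<subseteq> M"
  using rho_mem by blast

lemma trace_rho_linear:
  assumes T: "V.lin T" "T ` M \<subseteq> M"
  shows "L.functional (\<lambda>x. V.trace_on M (\<lambda>v. \<rho> x (T v)))"
proof (rule L.functionalI)
  fix x y c
  have "V.trace_on M (\<lambda>v. \<rho> (x + y) (T v)) = V.trace_on M (\<lambda>v. \<rho> x (T v) + \<rho> y (T v))"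
    using T by (intro V.trace_cong rho_add) blast
  also have "\<dots> = V.trace_on M (\<lambda>v. \<rho> x (T v)) + V.trace_on M (\<lambda>v. \<rho> y (T v))"
    by (intro V.trace_add fdim_M lin_rho_comp image_rho_comp T)
  finally show "V.trace_on M (\<lambda>v. \<rho> (x + y) (T v)) = V.trace_on M (\<lambda>v. \<rho> x (T v)) + V.trace_on M (\<lambda>v. \<rho> y (T v))" .
  have "V.trace_on M (\<lambda>v. \<rho> (c *\<^sub>L x) (T v)) = V.trace_on M (\<lambda>v. c *s \<rho> x (T v))"
    using T by (intro V.trace_cong rho_scale) blast
  also have "\<dots> = c * V.trace_on M (\<lambda>v. \<rho> x (T v))"
    by (intro V.trace_scale[OF fdim_M V.lin_id] lin_rho_comp image_rho_comp T) simp
  finally show "V.trace_on M (\<lambda>v. \<rho> (c *\<^sub>L x) (T v)) = c * V.trace_on M (\<lambda>v. \<rho> x (T v))" .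
qed

lemma trace_form_sym: "trace_form x y = trace_form y x"
  unfolding trace_form_def by (intro V.trace_commute fdim_M rho_lin rho_image)

lemma trace_form_functional: "L.functional (\<lambda>x. trace_form x y)" "L.functional (trace_form y)"
proof -
  show "L.functional (\<lambda>x. trace_form x y)" for y
    unfolding trace_form_def by (intro trace_rho_linear rho_lin rho_image)
  then have "L.functional (\<lambda>x. trace_form x y)" .
  moreover have "trace_form y = (\<lambda>x. trace_form x y)" using trace_form_sym[of y] by auto
  ultimately show "L.functional (trace_form y)" by simp
qed

lemma trace_bracket:
  assumes y: "V.lin y" "y ` M \<subseteq> M"
  shows "V.trace_on M (\<lambda>v. \<rho> (bracket a b) (y v)) =
    V.trace_on M (\<lambda>v. \<rho> a (\<rho> b (y v) - y (\<rho> b v)))"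
proof -
  note ab = lin_rho_comp[OF lin_rho_comp[OF y(1)]] image_rho_comp[OF image_rho_comp[OF y(2)]]
  have l: "V.lin (\<lambda>v. \<rho> a (y (\<rho> b v)))" by (rule lin_rho_comp[OF lin_comp[OF rho_lin y(1)]])
  have i: "(\<lambda>v. \<rho> a (y (\<rho> b v))) ` M \<subseteq> M" using y rho_mem by blast
  have "V.trace_on M (\<lambda>v. \<rho> (bracket a b) (y v)) =
      V.trace_on M (\<lambda>v. \<rho> a (\<rho> b (y v)) - \<rho> b (\<rho> a (y v)))"
    using y by (intro V.trace_cong rho_bracket) blast
  also have "\<dots> = V.trace_on M (\<lambda>v. \<rho> a (\<rho> b (y v))) - V.trace_on M (\<lambda>v. \<rho> b (\<rho> a (y v)))"
    by (intro V.trace_diff fdim_M ab)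
  also have "V.trace_on M (\<lambda>v. \<rho> b (\<rho> a (y v))) = V.trace_on M (\<lambda>v. \<rho> a (y (\<rho> b v)))"
    by (rule V.trace_commute[OF fdim_M rho_lin rho_image lin_rho_comp[OF y(1)] image_rho_comp[OF y(2)]])
  also have "V.trace_on M (\<lambda>v. \<rho> a (\<rho> b (y v))) - V.trace_on M (\<lambda>v. \<rho> a (y (\<rho> b v)))
      = V.trace_on M (\<lambda>v. \<rho> a (\<rho> b (y v)) - \<rho> a (y (\<rho> b v)))"
    by (intro V.trace_diff[symmetric] fdim_M ab l i)
  finally show ?thesis by (simp add: lin_diff[OF rho_lin])
qed

lemma trace_form_invariant: "trace_form (bracket x y) z = trace_form x (bracket y z)"
proof -
  have "trace_form (bracket x y) z = V.trace_on M (\<lambda>v. \<rho> x (\<rho> y (\<rho> z v) - \<rho> z (\<rho> y v)))"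
    unfolding trace_form_def by (rule trace_bracket[OF rho_lin rho_image])
  also have "\<dots> = trace_form x (bracket y z)"
    unfolding trace_form_def by (intro V.trace_cong) (simp add: rho_bracket)
  finally show ?thesis .
qed

lemma lie_ideal_radical: "L.lie_ideal form_radical"
  unfolding L.lie_ideal_def
proof (intro conjI allI ballI)
  show "L.subspace form_radical"
    unfolding form_radical_def
    by (intro L.subspaceI)
      (simp_all add: lin_zero[OF trace_form_functional(1)] lin_add[OF trace_form_functional(1)]
        lin_scale[OF trace_form_functional(1)])
  fix x y assume "y \<in> form_radical"
  then have "trace_form (bracket y x) z = 0" for z
    by (simp add: form_radical_def trace_form_invariant)
  then have "trace_form (bracket x y) z = 0" for z
    using L.bracket_anticomm[of x y] lin_neg[OF trace_form_functional(1)] by simp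
  then show "bracket x y \<in> form_radical" by (simp add: form_radical_def)
qed

text \<open>
  The Leibniz rule \<open>(\<rho> x - (a + c)) \<rho> b = \<rho> ((ad x - c) b) + \<rho> b (\<rho> x - a)\<close>, iterated.
\<close>

lemma gen_eigenspace_rho:
  assumes b: "b \<in> L.gen_eigenspace (bracket x) c" and v: "v \<in> V.gen_eigenspace (\<rho> x) a \<inter> M"
  shows "\<rho> b v \<in> V.gen_eigenspace (\<rho> x) (a + c) \<inter> M"
proof -
  have leib: "V.shift (\<rho> x) (a + c) (\<rho> b v) = \<rho> (L.shift (bracket x) c b) v + \<rho> b (V.shift (\<rho> x) a v)"
    if "v \<in> M" for b v
  proof -
    have "\<rho> (L.shift (bracket x) c b) v + c *s \<rho> b v = \<rho> (bracket x b) v"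
      using that rho_add[OF that, of "bracket x b - c *\<^sub>L b" "c *\<^sub>L b"]
      by (simp add: L.shift_def rho_scale)
    then show ?thesis
      by (simp add: V.shift_def rho_bracket[OF that] lin_diff[OF rho_lin] lin_scale[OF rho_lin] algebra_simps)
  qed
  have rho0: "\<rho> 0 v = 0" if "v \<in> M" for v using rho_scale[OF that, of 0 0] by simp
  have "(V.shift (\<rho> x) (a + c) ^^ (n + m)) (\<rho> b v) = 0"
    if "(L.shift (bracket x) c ^^ n) b = 0" "(V.shift (\<rho> x) a ^^ m) v = 0" "v \<in> M" for n m b v
    using that
  proof (induction "n + m" arbitrary: n m b v)
    case 0
    then show ?case by (simp add: rho0)
  next
    case (Suc k)
    note ls = V.lin_funpow[OF V.lin_shift[OF rho_lin]]
    have vM: "V.shift (\<rho> x) a v \<in> M" using V.shift_mem[OF subspace_M rho_image Suc.prems(3)] .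
    have 1: "(V.shift (\<rho> x) (a + c) ^^ k) (\<rho> (L.shift (bracket x) c b) v) = 0"
    proof (cases n)
      case 0
      then have "b = 0" using Suc.prems(1) by simp
      then have "L.shift (bracket x) c b = 0" by (simp add: L.shift_def L.bracket_zero)
      then show ?thesis using rho0[OF Suc.prems(3)] lin_zero[OF ls] by simp
    next
      case (Suc n')
      then have "(L.shift (bracket x) c ^^ n') (L.shift (bracket x) c b) = 0"
        using Suc.prems(1) by (simp add: funpow_swap1)
      moreover have "k = n' + m" using Suc Suc.hyps(2) by simp
      ultimately show ?thesis using Suc.hyps(1)[of n' m "L.shift (bracket x) c b" v] Suc.prems by blast
    qed
    have 2: "(V.shift (\<rho> x) (a + c) ^^ k) (\<rho> b (V.shift (\<rho> x) a v)) = 0"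
    proof (cases m)
      case 0
      then have "v = 0" using Suc.prems(2) by simp
      then have "V.shift (\<rho> x) a v = 0" by (simp add: V.shift_def lin_zero[OF rho_lin])
      then show ?thesis using lin_zero[OF rho_lin] lin_zero[OF ls] by simp
    next
      case (Suc m')
      then have "(V.shift (\<rho> x) a ^^ m') (V.shift (\<rho> x) a v) = 0"
        using Suc.prems(2) by (simp add: funpow_swap1)
      moreover have "k = n + m'" using Suc Suc.hyps(2) by simp
      ultimately show ?thesis using Suc.hyps(1)[of n m' b "V.shift (\<rho> x) a v"] Suc.prems vM by blast
    qed
    have "(V.shift (\<rho> x) (a + c) ^^ Suc k) (\<rho> b v) = (V.shift (\<rho> x) (a + c) ^^ k) (V.shift (\<rho> x) (a + c) (\<rho> b v))"
      by (simp only: funpow_Suc_right comp_apply)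
    also have "\<dots> = 0" unfolding leib[OF Suc.prems(3)] lin_add[OF ls] 1 2 by simp
    finally show ?case using Suc.hyps(2) by simp
  qed
  moreover obtain n m where "(L.shift (bracket x) c ^^ n) b = 0" "(V.shift (\<rho> x) a ^^ m) v = 0" "v \<in> M"
    using b v by (auto simp: L.gen_eigenspace_def V.gen_eigenspace_def)
  ultimately have "(V.shift (\<rho> x) (a + c) ^^ (n + m)) (\<rho> b v) = 0" by blast
  then show ?thesis using rho_mem v by (auto simp: V.gen_eigenspace_def)
qed

text \<open>
  A component \<open>b\<^sub>c\<close> of \<open>b\<close> in the generalized eigenspace of \<open>ad x\<close> at \<open>c\<close> moves eigenvalues of \<open>\<rho> x\<close> by \<open>c\<close>.
  As \<open>f\<close> is additive, \<open>[\<rho> b\<^sub>c, y] = - f(c) \<rho> b\<^sub>c\<close>; in particular the commutator with \<open>y\<close> does not leave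
  the image of the Lie algebra, even though \<open>y\<close> itself may not belong to it.
\<close>

lemma semisimple_commutator:
  fixes f :: "'k \<Rightarrow> 'k"
  assumes f: "\<And>a b. f (a + b) = f a + f b"
    and y: "V.lin y" "\<And>a v. v \<in> V.gen_eigenspace (\<rho> x) a \<inter> M \<Longrightarrow> y v = f a *s v"
  shows "\<exists>b'. \<forall>v\<in>M. \<rho> b (y v) - y (\<rho> b v) = \<rho> b' v"
proof -
  have ad: "L.lin (bracket x)" by (rule L.bracket_linear_right)
  obtain E bc where E: "finite E" "\<And>c. bc c \<in> L.gen_eigenspace (bracket x) c" "(\<Sum>c\<in>E. bc c) = b"
    using L.gen_eigenspace_components[OF L.fdim_UNIV ad, of b] by auto
  obtain D P where P: "\<And>a v. P a v \<in> V.gen_eigenspace (\<rho> x) a \<inter> M" "\<And>v. v \<in> M \<Longrightarrow> (\<Sum>a\<in>D. P a v) = v"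
    using V.gen_eigenspace_projections[OF fdim_M rho_lin rho_image] by metis
  define b' where "b' = (\<Sum>c\<in>E. (- f c) *\<^sub>L bc c)"
  have on_gen_eigenspace: "\<rho> b (y v) - y (\<rho> b v) = \<rho> b' v" if v: "v \<in> V.gen_eigenspace (\<rho> x) a \<inter> M" for v a
  proof -
    have vM: "v \<in> M" using v by simp
    have "\<rho> b (y v) - y (\<rho> b v) = f a *s \<rho> b v - y (\<rho> b v)"
      using y(2)[OF v] by (simp add: lin_scale[OF rho_lin])
    also have "\<dots> = (\<Sum>c\<in>E. f a *s \<rho> (bc c) v - y (\<rho> (bc c) v))"
      unfolding E(3)[symmetric] rho_sum[OF vM] by (simp add: lin_sum[OF y(1)] V.scale_sum_right sum_subtractf)
    also have "\<dots> = (\<Sum>c\<in>E. (- f c) *s \<rho> (bc c) v)"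
    proof (rule sum.cong[OF refl])
      fix c
      have "y (\<rho> (bc c) v) = f (a + c) *s \<rho> (bc c) v" using y(2)[OF gen_eigenspace_rho[OF E(2) v]] .
      then show "f a *s \<rho> (bc c) v - y (\<rho> (bc c) v) = (- f c) *s \<rho> (bc c) v"
        by (simp add: f algebra_simps)
    qed
    also have "\<dots> = \<rho> b' v" unfolding b'_def rho_sum[OF vM] by (simp only: rho_scale[OF vM])
    finally show ?thesis .
  qed
  have "\<rho> b (y v) - y (\<rho> b v) = \<rho> b' v" if v: "v \<in> M" for v
  proof -
    have "\<rho> b (y v) - y (\<rho> b v) = (\<Sum>a\<in>D. \<rho> b (y (P a v)) - y (\<rho> b (P a v)))"
      using P(2)[OF v] by (simp add: sum_subtractf flip: lin_sum[OF rho_lin] lin_sum[OF y(1)])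
    also have "\<dots> = (\<Sum>a\<in>D. \<rho> b' (P a v))" using on_gen_eigenspace[OF P(1)] by simp
    also have "\<dots> = \<rho> b' v" using P(2)[OF v] by (simp flip: lin_sum[OF rho_lin])
    finally show ?thesis .
  qed
  then show ?thesis by blast
qed

text \<open>
  For \<open>a\<close> in the radical of the trace form, \<open>tr (\<rho> [a, b] y) = tr (\<rho> a [\<rho> b, y])\<close> is a value
  of the trace form at \<open>a\<close>, hence zero, so the nilpotency criterion applies.
\<close>

theorem cartan:
  assumes x: "x \<in> L.span {bracket a b | a b. a \<in> form_radical}"
  shows "V.locally_nilpotent_on M (\<rho> x)"
proof (rule V.nilpotent_criterion[OF fdim_M rho_lin rho_image])
  fix f :: "'k \<Rightarrow> rat" and y
  assume f: "\<And>a b. f (a + b) = f a + f b" and y: "V.lin y" "y ` M \<subseteq> M"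
    "\<And>a v. v \<in> V.gen_eigenspace (\<rho> x) a \<inter> M \<Longrightarrow> y v = of_rat (f a) *s v"
  note fu = trace_rho_linear[OF y(1,2)]
  show "V.trace_on M (\<lambda>v. \<rho> x (y v)) = 0"
    using x
  proof (induction rule: L.span_induct_alt)
    case base
    then show ?case using lin_zero[OF fu] by simp
  next
    case (step c z w)
    then obtain a b where ab: "z = bracket a b" "a \<in> form_radical" by blast
    obtain b' where b': "\<And>v. v \<in> M \<Longrightarrow> \<rho> b (y v) - y (\<rho> b v) = \<rho> b' v"
    proof -
      have "\<exists>b'. \<forall>v\<in>M. \<rho> b (y v) - y (\<rho> b v) = \<rho> b' v"
        by (rule semisimple_commutator[of "\<lambda>a. of_rat (f a)", OF _ y(1,3)]) (simp_all add: f of_rat_add)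
      then show ?thesis using that by blast
    qed
    have "V.trace_on M (\<lambda>v. \<rho> z (y v)) = V.trace_on M (\<lambda>v. \<rho> a (\<rho> b (y v) - y (\<rho> b v)))"
      unfolding ab(1) by (rule trace_bracket[OF y(1,2)])
    also have "\<dots> = trace_form a b'" unfolding trace_form_def by (intro V.trace_cong) (simp add: b')
    also have "\<dots> = 0" using ab(2) by (simp add: form_radical_def)
    finally show ?case using step lin_add[OF fu] lin_scale[OF fu] by simp
  qed
qed

lemma radical_brackets:
  defines "K \<equiv> L.span {bracket a b | a b. a \<in> form_radical}"
  shows "L.lie_ideal K" "acts_unipotently K"
proof -
  show K: "L.lie_ideal K" unfolding K_def by (rule L.lie_ideal_brackets[OF lie_ideal_radical])
  show "acts_unipotently K"
    by (rule engel[OF L.lie_ideal_subalgebra[OF K]]) (simp add: K_def cartan)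
qed

end

context lie_algebra begin

lemma lie_ideal_inter: "lie_ideal I \<Longrightarrow> lie_ideal J \<Longrightarrow> lie_ideal (I \<inter> J)"
  by (auto simp: lie_ideal_def intro: subspace_inter)

lemma semisimple_no_abelian_ideal:
  assumes semisimple and D: "lie_ideal D" and ab: "\<And>x y. x \<in> D \<Longrightarrow> y \<in> D \<Longrightarrow> bracket x y = 0"
  shows "D = {0}"
proof -
  have "{bracket x y | x y. x \<in> D \<and> y \<in> D} \<subseteq> {0}" using ab by auto
  then have "span {bracket x y | x y. x \<in> D \<and> y \<in> D} \<subseteq> {0}" by (rule span_minimal) simp
  then have "derived_series D 1 = {0}" using span_zero by auto
  then have "solvable D" unfolding solvable_def by blast
  then show ?thesis using assms(1) D by (simp add: semisimple_def)
qed

end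

locale semisimple_lie_algebra = fd_lie_algebra scale bracket
  for scale :: "'k::{alg_closed_field, field_char_0} \<Rightarrow> 'l::ab_group_add \<Rightarrow> 'l" (infixr \<open>*\<^sub>L\<close> 75)
    and bracket :: "'l \<Rightarrow> 'l \<Rightarrow> 'l" +
  assumes semisimple: semisimple
begin

lemmas no_abelian_ideal = semisimple_no_abelian_ideal[OF semisimple]

sublocale ad: acf_lie_rep scale bracket scale UNIV bracket
  by unfold_locales
    (use fdim_UNIV bracket_linear_right in \<open>auto simp: bracket_add bracket_scale bracket_bracket\<close>)

text \<open>
  Let \<open>R\<close> be the radical of the Killing form. By Cartan's criterion \<open>K = [R, \<gg>]\<close> acts by nilpotent
  operators, so by Engel a nonzero \<open>K\<close> would contain nonzero vectors killed by \<open>K\<close>; these form an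
  abelian ideal. Hence \<open>K = 0\<close>, and \<open>R\<close> is abelian.
\<close>

lemma killing_nondegenerate: "ad.form_radical = {0}"
proof -
  let ?R = ad.form_radical
  let ?K = "span {bracket a b | a b. a \<in> ?R}"
  note K = ad.radical_brackets(1) and uni = ad.radical_brackets(2)
  let ?D = "{v \<in> ?K. \<forall>x\<in>?K. bracket x v = 0}"
  have "lie_ideal ?D"
    unfolding lie_ideal_def
  proof (intro conjI allI ballI)
    show "subspace ?D"
      by (intro subspaceI) (auto simp: bracket_zero bracket_add bracket_scale span_zero span_add span_scale)
    fix z v assume v: "v \<in> ?D"
    have "bracket x (bracket z v) = 0" if x: "x \<in> ?K" for x
    proof -
      have "bracket x z \<in> ?K" using lie_ideal_left[OF K x] .
      then have "bracket (bracket x z) v = 0" "bracket x v = 0" using v x by blast+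
      then show ?thesis using bracket_bracket[of x z v] by (simp add: bracket_zero)
    qed
    moreover have "bracket z v \<in> ?K" using K v by (auto simp: lie_ideal_def)
    ultimately show "bracket z v \<in> ?D" by blast
  qed
  then have D: "?D = {0}" by (rule no_abelian_ideal) auto
  have "?K = {0}"
  proof (rule ccontr)
    assume "?K \<noteq> {0}"
    then have "{0} \<subset> ?K" using span_zero by blast
    moreover have "ad.stable ?K ?K" "ad.stable ?K {0}"
      using K by (auto simp: ad.stable_def lie_ideal_def bracket_zero)
    ultimately have "\<exists>v \<in> ?K - {0}. \<forall>x\<in>?K. bracket x v \<in> {0}"
      using ad.acts_unipotentlyD[OF uni, of "{0}" ?K] by simp
    then show False using D by blast
  qed
  then have "bracket a b = 0" if "a \<in> ?R" for a b
    using span_base[of "bracket a b" "{bracket a b | a b. a \<in> ?R}"] that by blast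
  then show ?thesis by (intro no_abelian_ideal[OF ad.lie_ideal_radical])
qed

text \<open>
  The complement is the orthogonal of \<open>Z\<close> for the Killing form. The intersection is abelian by
  invariance and nondegeneracy of the form, hence zero; so the form is nondegenerate on \<open>Z\<close>, and dual
  bases of \<open>Z\<close> give the orthogonal projection.
\<close>

lemma ideal_complement:
  assumes Z: "lie_ideal Z"
  shows "\<exists>Z'. lie_ideal Z' \<and> Z \<inter> Z' = {0} \<and> (\<forall>x. \<exists>z\<in>Z. x - z \<in> Z')"
proof -
  note fu = ad.trace_form_functional
  define Z' where "Z' = {x. \<forall>z\<in>Z. ad.trace_form x z = 0}"
  have Z': "lie_ideal Z'"
    unfolding lie_ideal_def
  proof (intro conjI allI ballI)
    show "subspace Z'" unfolding Z'_def
      by (intro subspaceI) (auto simp: lin_zero[OF fu(1)] lin_add[OF fu(1)] lin_scale[OF fu(1)])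
    fix x y assume y: "y \<in> Z'"
    have "ad.trace_form (bracket x y) z = 0" if "z \<in> Z" for z
    proof -
      have "ad.trace_form (bracket x y) z = - ad.trace_form y (bracket x z)"
        using bracket_anticomm[of x y] lin_neg[OF fu(1)] ad.trace_form_invariant[of y x z] by simp
      moreover have "bracket x z \<in> Z" using Z that by (simp add: lie_ideal_def)
      ultimately show ?thesis using y by (simp add: Z'_def)
    qed
    then show "bracket x y \<in> Z'" by (simp add: Z'_def)
  qed
  have int: "Z \<inter> Z' = {0}"
  proof (rule no_abelian_ideal[OF lie_ideal_inter[OF Z Z']])
    fix x y assume x: "x \<in> Z \<inter> Z'" and y: "y \<in> Z \<inter> Z'"
    have "ad.trace_form (bracket x y) z = 0" for z
      unfolding ad.trace_form_invariant using x lie_ideal_left[OF Z, of y z] y by (simp add: Z'_def)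
    then have "bracket x y \<in> ad.form_radical" by (simp add: ad.form_radical_def)
    then show "bracket x y = 0" using killing_nondegenerate by blast
  qed
  have sZ: "subspace Z" using Z by (simp add: lie_ideal_def)
  have fZ: "fdim Z" using fdim_subset[OF fdim_UNIV sZ] by simp
  have nondeg: "v = 0" if "v \<in> Z" "\<And>u. u \<in> Z \<Longrightarrow> ad.trace_form u v = 0" for v
  proof -
    have "v \<in> Z'" using that(2) by (simp add: Z'_def ad.trace_form_sym[of v])
    then show ?thesis using that(1) int by blast
  qed
  obtain B d where D: "dual_bases Z ad.trace_form B d"
    using dual_bases_exist[OF fZ fu(2,1) nondeg] by blast
  note B = dual_basesD[OF D]
  have "\<exists>z\<in>Z. x - z \<in> Z'" for x
  proof
    let ?z = "\<Sum>b\<in>B. ad.trace_form x (d b) *\<^sub>L b"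
    show "?z \<in> Z" using B(2) sZ by (intro subspace_sum subspace_scale) auto
    have "ad.trace_form (x - ?z) w = 0" if w: "w \<in> Z" for w
    proof -
      have "ad.trace_form x w = ad.trace_form x (\<Sum>b\<in>B. ad.trace_form b w *\<^sub>L d b)" using B(6)[OF w] by simp
      then show ?thesis
        by (simp add: lin_diff[OF fu(1)] lin_sum[OF fu(1)] lin_scale[OF fu(1)] lin_sum[OF fu(2)]
          lin_scale[OF fu(2)] mult.commute)
    qed
    then show "x - ?z \<in> Z'" by (simp add: Z'_def)
  qed
  then show ?thesis using Z' int by blast
qed

text \<open>
  Brackets with an ideal complement of \<open>Y\<close> lie in both, so the complement is abelian, hence zero.
\<close>

lemma perfect:
  assumes Y: "subspace Y" and br: "\<And>x y. bracket x y \<in> Y"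
  shows "Y = UNIV"
proof -
  have "lie_ideal Y" using assms by (simp add: lie_ideal_def)
  then obtain Y' where Y': "lie_ideal Y'" "Y \<inter> Y' = {0}" "\<forall>x. \<exists>z\<in>Y. x - z \<in> Y'"
    using ideal_complement[of Y] by blast
  have "Y' = {0}"
  proof (rule no_abelian_ideal[OF Y'(1)])
    fix x y assume "x \<in> Y'" "y \<in> Y'"
    then have "bracket x y \<in> Y \<inter> Y'" using br Y'(1) by (simp add: lie_ideal_def)
    then show "bracket x y = 0" using Y'(2) by blast
  qed
  then show ?thesis using Y'(3) by (metis UNIV_eq_I eq_iff_diff_eq_0 singletonD)
qed

end

section \<open>Whitehead's lemma and equivariant projections\<close>

context lie_rep begin

lemma sub_rep:
  assumes "V.subspace N" "N \<subseteq> M" "stable UNIV N"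
  shows "lie_rep scaleL bracket scale N \<rho>"
proof (intro lie_rep.intro lie_rep_axioms.intro L.fd_lie_algebra_axioms V.lin_space_axioms rho_lin)
  show "V.fdim N" using V.fdim_subset[OF fdim_M assms(1,2)] .
  show "\<rho> x v \<in> N" if "v \<in> N" for x v using that assms(3) by (simp add: stable_def)
qed (use assms(2) rho_add rho_scale rho_bracket in blast)+

text \<open>
  The quotient \<open>M/N\<close>, carried by the kernel in \<open>M\<close> of a projection \<open>p\<close> onto \<open>N\<close>.
\<close>

lemma quotient_rep:
  assumes N: "stable UNIV N" and p: "V.lin p" "\<And>v. p v \<in> N" "\<And>v. v \<in> N \<Longrightarrow> p v = v" and NM: "N \<subseteq> M"
  shows "lie_rep scaleL bracket scale {v \<in> M. p v = 0} (\<lambda>x v. \<rho> x v - p (\<rho> x v))"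
proof -
  let ?Q = "{v \<in> M. p v = 0}"
  have sQ: "V.subspace ?Q" by (rule V.subspace_kernel_on[OF p(1) subspace_M])
  have pM: "p v \<in> M" for v using p(2) NM by blast
  have pp: "p (p v) = p v" for v using p by blast
  have st: "p (\<rho> x (p v)) = \<rho> x (p v)" for x v using N p unfolding stable_def by blast
  have "lie_rep_axioms scaleL bracket scale ?Q (\<lambda>x v. \<rho> x v - p (\<rho> x v))"
  proof (rule lie_rep_axioms.intro)
    show "V.fdim ?Q" using V.fdim_subset[OF fdim_M sQ] by blast
    fix x y c v
    show "V.lin (\<lambda>v. \<rho> x v - p (\<rho> x v))" by (intro V.lin_minus rho_lin lin_comp[OF rho_lin p(1)])
    assume v: "v \<in> ?Q"
    then have vM: "v \<in> M" by simp
    show "\<rho> x v - p (\<rho> x v) \<in> ?Q"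
      using V.subspace_diff[OF subspace_M rho_mem[OF vM] pM] by (simp add: lin_diff[OF p(1)] pp)
    show "\<rho> (x + y) v - p (\<rho> (x + y) v) = \<rho> x v - p (\<rho> x v) + (\<rho> y v - p (\<rho> y v))"
      by (simp add: rho_add[OF vM] lin_add[OF p(1)])
    show "\<rho> (c *\<^sub>L x) v - p (\<rho> (c *\<^sub>L x) v) = c *s (\<rho> x v - p (\<rho> x v))"
      by (simp add: rho_scale[OF vM] lin_scale[OF p(1)] V.scale_right_diff_distrib)
    show "\<rho> (bracket x y) v - p (\<rho> (bracket x y) v) =
      \<rho> x (\<rho> y v - p (\<rho> y v)) - p (\<rho> x (\<rho> y v - p (\<rho> y v))) -
      (\<rho> y (\<rho> x v - p (\<rho> x v)) - p (\<rho> y (\<rho> x v - p (\<rho> x v))))"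
      by (simp add: rho_bracket[OF vM] lin_diff[OF p(1)] lin_diff[OF rho_lin] st)
  qed
  then show ?thesis by (intro lie_rep.intro L.fd_lie_algebra_axioms V.lin_space_axioms)
qed

definition cocycle :: "('l \<Rightarrow> 'b) \<Rightarrow> bool" where
  "cocycle \<phi> \<longleftrightarrow> Vector_Spaces.linear scaleL scale \<phi> \<and> range \<phi> \<subseteq> M \<and>
     (\<forall>x y. \<phi> (bracket x y) = \<rho> x (\<phi> y) - \<rho> y (\<phi> x))"

lemma cocycleD:
  assumes "cocycle \<phi>"
  shows "Vector_Spaces.linear scaleL scale \<phi>" "\<phi> x \<in> M" "\<phi> (bracket x y) = \<rho> x (\<phi> y) - \<rho> y (\<phi> x)"
  using assms unfolding cocycle_def by blast+

lemma linear_orbit_map: "m \<in> M \<Longrightarrow> Vector_Spaces.linear scaleL scale (\<lambda>x. \<rho> x m)"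
  by (simp add: Vector_Spaces.linear_iff L.vector_space_axioms V.vector_space_axioms rho_add rho_scale)

lemma coboundary_cocycle: "m \<in> M \<Longrightarrow> cocycle (\<lambda>x. \<rho> x m)"
  unfolding cocycle_def using linear_orbit_map rho_mem by (auto simp: rho_bracket)

end

context semisimple_lie_algebra begin

text \<open>
  Moving \<open>x\<close> to the right past \<open>b\<close>, and then into \<open>\<phi>\<close> by the cocycle identity, leaves the terms in \<open>[x, b]\<close> and in \<open>[x, d b]\<close>,
  which cancel since the Casimir element is invariant. For a coboundary \<open>\<phi>\<close> this says that the Casimir
  operator commutes with \<open>x\<close>.
\<close>

lemma casimir_cocycle:
  assumes rep: "acf_lie_rep scale bracket sM M \<rho>"
    and D: "dual_bases Z' (acf_lie_rep.trace_form sM M \<rho>) B d" and Z': "lie_ideal Z'"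
    and \<phi>: "lie_rep.cocycle scale bracket sM M \<rho> \<phi>"
  shows "\<rho> x (\<Sum>b\<in>B. \<rho> b (\<phi> (d b))) = (\<Sum>b\<in>B. \<rho> b (\<rho> (d b) (\<phi> x)))"
proof -
  interpret R: acf_lie_rep scale bracket sM M \<rho> by (rule rep)
  note c = R.cocycleD[OF \<phi>] and fu = R.trace_form_functional
  have step: "\<rho> x (\<rho> b (\<phi> w)) = \<rho> (bracket x b) (\<phi> w) + \<rho> b (\<phi> (bracket x w)) + \<rho> b (\<rho> w (\<phi> x))" for b w
    using R.rho_bracket[OF c(2), of x b w] by (simp add: c(3) lin_diff[OF R.rho_lin])
  have "(\<Sum>b\<in>B. \<rho> (bracket x b) (\<phi> (d b))) = (\<Sum>b\<in>B. \<rho> b (\<phi> (- bracket x (d b))))"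
  proof (rule dual_bases_adjoint[OF D, of "bracket x" "\<lambda>w. - bracket x w" sM "\<lambda>u w. \<rho> u (\<phi> w)"])
    show "bracket x u \<in> Z'" "- bracket x u \<in> Z'" if "u \<in> Z'" for u
      using Z' that subspace_neg by (auto simp: lie_ideal_def)
    show "R.trace_form (bracket x u) v = R.trace_form u (- bracket x v)" for u v
      using bracket_anticomm[of x u] by (simp add: lin_neg[OF fu(1)] lin_neg[OF fu(2)] R.trace_form_invariant)
    show "Vector_Spaces.linear scale sM (\<lambda>w. \<rho> u (\<phi> w))" for u
      by (rule lin_comp[OF c(1) R.rho_lin])
    show "Vector_Spaces.linear scale sM (\<lambda>u. \<rho> u (\<phi> w))" for w
      by (rule R.linear_orbit_map[OF c(2)])
  qed
  also have "\<dots> = - (\<Sum>b\<in>B. \<rho> b (\<phi> (bracket x (d b))))"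
    by (simp add: lin_neg[OF c(1)] lin_neg[OF R.rho_lin] sum_negf)
  finally have "(\<Sum>b\<in>B. \<rho> (bracket x b) (\<phi> (d b))) + (\<Sum>b\<in>B. \<rho> b (\<phi> (bracket x (d b)))) = 0" by simp
  then show ?thesis by (simp add: lin_sum[OF R.rho_lin] step sum.distrib)
qed

text \<open>
  With \<open>R\<close> the radical of the trace form, \<open>[R, \<gg>]\<close> is an ideal that acts by nilpotent operators. By Engel
  it has nonzero invariants in \<open>M\<close>; these form a submodule, so it acts as zero. Hence \<open>[R \<inter> Z', \<gg>]\<close>
  lies in \<open>Z \<inter> Z' = 0\<close>, and \<open>R \<inter> Z'\<close> is an abelian ideal.
\<close>

lemma trace_form_nondegenerate_mod_kernel:
  assumes rep: "acf_lie_rep scale bracket sM M \<rho>"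
    and irr: "\<And>N. module.subspace sM N \<Longrightarrow> N \<subseteq> M \<Longrightarrow> lie_rep.stable \<rho> UNIV N \<Longrightarrow> N = {0} \<or> N = M"
    and M0: "M \<noteq> {0}"
    and Z: "\<And>x. (\<And>v. v \<in> M \<Longrightarrow> \<rho> x v = 0) \<Longrightarrow> x \<in> Z"
    and Z': "lie_ideal Z'" "Z \<inter> Z' = {0}"
    and v: "v \<in> Z'" "v \<in> acf_lie_rep.form_radical sM M \<rho>"
  shows "v = 0"
proof -
  interpret R: acf_lie_rep scale bracket sM M \<rho> by (rule rep)
  let ?R = R.form_radical
  let ?K = "span {bracket a b | a b. a \<in> ?R}"
  note K = R.radical_brackets(1) and uni = R.radical_brackets(2)
  let ?N = "{v \<in> M. \<forall>x\<in>?K. \<rho> x v = 0}"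
  have sN: "R.V.subspace ?N" using R.subspace_M
    by (intro R.V.subspaceI) (auto simp: lin_zero[OF R.rho_lin] lin_add[OF R.rho_lin] lin_scale[OF R.rho_lin]
      R.V.subspace_0 R.V.subspace_add R.V.subspace_scale)
  have stN: "R.stable UNIV ?N"
    unfolding R.stable_def
  proof (intro ballI)
    fix z w assume w: "w \<in> ?N"
    have "\<rho> x (\<rho> z w) = 0" if x: "x \<in> ?K" for x
    proof -
      have "bracket x z \<in> ?K" using lie_ideal_left[OF K x] .
      then have "\<rho> (bracket x z) w = 0" "\<rho> x w = 0" "w \<in> M" using w x by blast+
      then show ?thesis using R.rho_bracket[of w x z] by (simp add: lin_zero[OF R.rho_lin])
    qed
    then show "\<rho> z w \<in> ?N" using w R.rho_mem by blast
  qed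
  have "R.stable ?K {0}" "R.stable ?K M" "{0} \<subset> M"
    using R.rho_mem M0 R.V.subspace_0[OF R.subspace_M] by (auto simp: R.stable_def lin_zero[OF R.rho_lin])
  then have "\<exists>w \<in> M - {0}. \<forall>x\<in>?K. \<rho> x w \<in> {0}"
    by (intro R.acts_unipotentlyD[OF uni]) (auto intro: R.subspace_M)
  then have "?N \<noteq> {0}" by blast
  then have N: "?N = M" using irr[OF sN _ stN] by blast
  have "lie_ideal (?R \<inter> Z')" by (rule lie_ideal_inter[OF R.lie_ideal_radical Z'(1)])
  moreover have "bracket a b = 0" if a: "a \<in> ?R \<inter> Z'" and b: "b \<in> ?R \<inter> Z'" for a b
  proof -
    have "bracket a b \<in> ?K" using a by (intro span_base) blast
    then have "bracket a b \<in> Z" using N by (intro Z) blast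
    moreover have "bracket a b \<in> Z'" using Z'(1) b by (simp add: lie_ideal_def)
    ultimately show ?thesis using Z'(2) by blast
  qed
  ultimately have "?R \<inter> Z' = {0}" by (rule no_abelian_ideal)
  then show ?thesis using v by blast
qed

text \<open>
  If \<open>\<gg>\<close> acts trivially, then \<open>\<phi>\<close> vanishes on \<open>[\<gg>, \<gg>] = \<gg>\<close>. Otherwise let \<open>Z'\<close> be an ideal complement of the
  kernel of the action and \<open>C\<close> the Casimir operator of \<open>Z'\<close> for the trace form of \<open>M\<close>. Its trace
  is \<open>dim Z' \<noteq> 0\<close>, so its kernel is a proper submodule and therefore zero. The solution \<open>m\<close> of
  \<open>C m = \<Sum> b \<phi>(d b)\<close> satisfies \<open>C (x m) = C \<phi>(x)\<close> for all \<open>x\<close>.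
\<close>

lemma whitehead_irreducible:
  assumes rep: "acf_lie_rep scale bracket sM M \<rho>"
    and irr: "\<And>N. module.subspace sM N \<Longrightarrow> N \<subseteq> M \<Longrightarrow> lie_rep.stable \<rho> UNIV N \<Longrightarrow> N = {0} \<or> N = M"
    and \<phi>: "lie_rep.cocycle scale bracket sM M \<rho> \<phi>"
  shows "\<exists>m\<in>M. \<forall>x. \<phi> x = \<rho> x m"
proof -
  interpret R: acf_lie_rep scale bracket sM M \<rho> by (rule rep)
  note c = R.cocycleD[OF \<phi>]
  define Z where "Z = {x. \<forall>v\<in>M. \<rho> x v = 0}"
  have rho0: "\<rho> 0 v = 0" if "v \<in> M" for v using R.rho_scale[OF that, of 0 0] by simp
  have Z: "lie_ideal Z" unfolding lie_ideal_def
  proof (intro conjI allI ballI)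
    show "subspace Z" unfolding Z_def by (intro subspaceI) (auto simp: rho0 R.rho_add R.rho_scale)
    fix x y assume "y \<in> Z"
    then show "bracket x y \<in> Z" using R.rho_mem by (auto simp: Z_def R.rho_bracket lin_zero[OF R.rho_lin])
  qed
  show ?thesis
  proof (cases "Z = UNIV")
    case True
    then have triv: "\<rho> x v = 0" if "v \<in> M" for x v using that unfolding Z_def by blast
    have "{x. \<phi> x = 0} = UNIV"
      by (rule perfect) (auto intro!: subspaceI simp: lin_zero[OF c(1)] lin_add[OF c(1)] lin_scale[OF c(1)] c(3) triv[OF c(2)])
    then have "\<phi> x = \<rho> x 0" for x using lin_zero[OF R.rho_lin] by auto
    then show ?thesis using R.V.subspace_0[OF R.subspace_M] by blast
  next
    case False
    \<comment> \<open>The trace form vanishes on the kernel \<open>Z\<close>, so dual bases exist only on a complement of it.\<close>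
    obtain Z' where Z': "lie_ideal Z'" "Z \<inter> Z' = {0}" "\<forall>x. \<exists>z\<in>Z. x - z \<in> Z'"
      using ideal_complement[OF Z] by blast
    have M0: "M \<noteq> {0}" using False by (auto simp: Z_def lin_zero[OF R.rho_lin])
    have sZ': "subspace Z'" using Z'(1) by (simp add: lie_ideal_def)
    have fZ': "fdim Z'" using fdim_subset[OF fdim_UNIV sZ'] by simp
    have nondeg: "v = 0" if v: "v \<in> Z'" "\<And>u. u \<in> Z' \<Longrightarrow> R.trace_form u v = 0" for v
    proof (rule trace_form_nondegenerate_mod_kernel[OF rep irr M0 _ Z'(1,2) v(1)])
      show "x \<in> Z" if "\<And>v. v \<in> M \<Longrightarrow> \<rho> x v = 0" for x using that by (simp add: Z_def)
      have "R.trace_form u v = 0" for u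
      proof -
        obtain z where z: "z \<in> Z" "u - z \<in> Z'" using Z'(3) by blast
        have "R.trace_form z v = R.V.trace_on M (\<lambda>w. 0)" unfolding R.trace_form_def
          using z(1) R.rho_mem by (intro R.V.trace_cong) (simp add: Z_def)
        then have "R.trace_form z v = 0" using R.V.trace_null[OF R.fdim_M] by simp
        then show ?thesis using v(2)[OF z(2)] lin_diff[OF R.trace_form_functional(1), of u z v] by simp
      qed
      then show "v \<in> R.form_radical" unfolding R.form_radical_def by (simp add: R.trace_form_sym[of v])
    qed
    obtain B d where D: "dual_bases Z' R.trace_form B d"
      using dual_bases_exist[OF fZ' R.trace_form_functional(2,1) nondeg] by blast
    note B = dual_basesD[OF D]
    define C where "C v = (\<Sum>b\<in>B. \<rho> b (\<rho> (d b) v))" for v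
    have lC: "R.V.lin C" unfolding C_def by (intro R.V.lin_sums R.lin_rho_comp R.rho_lin)
    have CM: "C ` M \<subseteq> M" unfolding C_def using R.rho_mem R.subspace_M by (auto intro!: R.V.subspace_sum)
    have comm: "\<rho> x (C v) = C (\<rho> x v)" if "v \<in> M" for x v
      using casimir_cocycle[OF rep D Z'(1) R.coboundary_cocycle[OF that]] by (simp add: C_def)
    have "R.V.trace_on M C = (\<Sum>b\<in>B. R.trace_form b (d b))"
      unfolding C_def R.trace_form_def
      by (intro R.V.trace_sum R.fdim_M R.lin_rho_comp R.rho_lin R.image_rho_comp R.rho_image)
    also have "\<dots> = of_nat (dim Z')" using B(4,7) by simp
    finally have trC: "R.V.trace_on M C = of_nat (dim Z')" .
    have "Z' \<noteq> {0}"
    proof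
      assume "Z' = {0}"
      then have "x \<in> Z" for x using Z'(3) by (metis eq_iff_diff_eq_0 singletonD)
      then show False using False by blast
    qed
    then have tr0: "R.V.trace_on M C \<noteq> 0" using trC fdim_dim_0[OF fZ'] by auto
    let ?N = "{v \<in> M. C v = 0}"
    have "R.V.subspace ?N" by (rule R.V.subspace_kernel_on[OF lC R.subspace_M])
    moreover have "R.stable UNIV ?N" unfolding R.stable_def
      using comm[symmetric] R.rho_mem lin_zero[OF R.rho_lin] by auto
    moreover have "?N \<noteq> M"
    proof
      assume "?N = M"
      then have "R.V.trace_on M C = R.V.trace_on M (\<lambda>v. 0)" by (intro R.V.trace_cong) blast
      then show False using tr0 R.V.trace_null[OF R.fdim_M] by simp
    qed
    ultimately have N: "?N = {0}" using irr[of ?N] by blast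
    have surj: "C ` M = M" using R.V.fdim_inj_surj[OF R.fdim_M lC CM] N by blast
    have "(\<Sum>b\<in>B. \<rho> b (\<phi> (d b))) \<in> M" using R.rho_mem c(2) by (intro R.V.subspace_sum R.subspace_M) auto
    then obtain m where m: "m \<in> M" "C m = (\<Sum>b\<in>B. \<rho> b (\<phi> (d b)))" using surj by (metis imageE)
    have "\<phi> x = \<rho> x m" for x
    proof -
      have "C (\<rho> x m) = C (\<phi> x)"
        using comm[OF m(1), of x] casimir_cocycle[OF rep D Z'(1) \<phi>, of x] m(2) by (simp add: C_def)
      then have "C (\<rho> x m - \<phi> x) = 0" by (simp add: lin_diff[OF lC])
      moreover have "\<rho> x m - \<phi> x \<in> M" using m c(2) R.rho_mem R.V.subspace_diff[OF R.subspace_M] by blast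
      ultimately have "\<rho> x m - \<phi> x = 0" using N by blast
      then show ?thesis by simp
    qed
    then show ?thesis using m by blast
  qed
qed

text \<open>
  For a proper submodule \<open>N\<close> the cocycle is first corrected modulo \<open>N\<close>; the remainder is a
  cocycle with values in \<open>N\<close>.
\<close>

theorem whitehead:
  assumes "lie_rep scale bracket sM M \<rho>" and "lie_rep.cocycle scale bracket sM M \<rho> \<phi>"
  shows "\<exists>m\<in>M. \<forall>x. \<phi> x = \<rho> x m"
  using assms
proof (induction "vector_space.dim sM M" arbitrary: M \<rho> \<phi> rule: less_induct)
  case less
  interpret R: lie_rep scale bracket sM M \<rho> by (rule less.prems(1))
  note c = R.cocycleD[OF less.prems(2)]
  show ?case
  proof (cases "\<exists>N. R.V.subspace N \<and> N \<subseteq> M \<and> R.stable UNIV N \<and> N \<noteq> {0} \<and> N \<noteq> M")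
    case False
    have "acf_lie_rep scale bracket sM M \<rho>" by (simp add: acf_lie_rep_def less.prems(1))
    then show ?thesis using whitehead_irreducible[OF _ _ less.prems(2)] False by blast
  next
    case True
    then obtain N where N: "R.V.subspace N" "N \<subseteq> M" "R.stable UNIV N" "N \<noteq> {0}" "N \<noteq> M" by blast
    obtain p where p: "R.V.lin p" "\<And>v. p v \<in> N" "\<And>v. v \<in> N \<Longrightarrow> p v = v"
      by (rule R.V.projection_exists[OF N(1)]) blast
    let ?Q = "{v \<in> M. p v = 0}" and ?\<rho> = "\<lambda>x v. \<rho> x v - p (\<rho> x v)"
    have repQ: "lie_rep scale bracket sM ?Q ?\<rho>" by (rule R.quotient_rep[OF N(3) p N(2)])
    interpret Q: lie_rep scale bracket sM ?Q ?\<rho> by (rule repQ)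
    obtain n where n: "n \<in> N" "n \<noteq> 0" using N(1,4) R.V.subspace_0 by blast
    then have "n \<in> M" "n \<notin> ?Q" using p(3)[OF n(1)] N(2) by auto
    then have "?Q \<subset> M" by blast
    then have dimQ: "R.V.dim ?Q < R.V.dim M" by (rule R.V.fdim_psubset_dim[OF R.fdim_M Q.subspace_M])
    have pM: "p v \<in> M" for v using p(2) N(2) by blast
    have st: "p (\<rho> x (p v)) = \<rho> x (p v)" for x v using N(3) p unfolding R.stable_def by blast
    have "Q.cocycle (\<lambda>x. \<phi> x - p (\<phi> x))"
      unfolding Q.cocycle_def
    proof (intro conjI allI)
      show "Vector_Spaces.linear scale sM (\<lambda>x. \<phi> x - p (\<phi> x))"
        using lin_comp[OF c(1) p(1)] c(1) by (simp add: Vector_Spaces.linear_iff R.V.scale_right_diff_distrib)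
      show "range (\<lambda>x. \<phi> x - p (\<phi> x)) \<subseteq> ?Q"
        using c(2) pM p by (auto simp: lin_diff[OF p(1)] R.V.subspace_diff[OF R.subspace_M])
      show "\<phi> (bracket x y) - p (\<phi> (bracket x y)) =
        ?\<rho> x (\<phi> y - p (\<phi> y)) - ?\<rho> y (\<phi> x - p (\<phi> x))" for x y
        by (simp add: c(3) lin_diff[OF p(1)] lin_diff[OF R.rho_lin] st)
    qed
    from less.hyps[OF dimQ repQ this] obtain m1 where m1: "m1 \<in> ?Q"
      "\<forall>x. \<phi> x - p (\<phi> x) = \<rho> x m1 - p (\<rho> x m1)" by blast
    then have m1M: "m1 \<in> M" by simp
    define \<phi>2 where "\<phi>2 x = \<phi> x - \<rho> x m1" for x
    have \<phi>2N: "\<phi>2 x \<in> N" for x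
    proof -
      have "\<phi>2 x = p (\<phi>2 x)" using m1(2)[rule_format, of x] by (simp add: \<phi>2_def lin_diff[OF p(1)] algebra_simps)
      then show ?thesis using p(2) by metis
    qed
    have repN: "lie_rep scale bracket sM N \<rho>" by (rule R.sub_rep[OF N(1-3)])
    interpret N: lie_rep scale bracket sM N \<rho> by (rule repN)
    have "N.cocycle \<phi>2"
      unfolding N.cocycle_def
    proof (intro conjI allI)
      show "Vector_Spaces.linear scale sM \<phi>2"
        using c(1) R.linear_orbit_map[OF m1M] unfolding \<phi>2_def
        by (simp add: Vector_Spaces.linear_iff R.V.scale_right_diff_distrib)
      show "range \<phi>2 \<subseteq> N" using \<phi>2N by blast
      show "\<phi>2 (bracket x y) = \<rho> x (\<phi>2 y) - \<rho> y (\<phi>2 x)" for x y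
        by (simp add: \<phi>2_def c(3) R.rho_bracket[OF m1M] lin_diff[OF R.rho_lin])
    qed
    moreover have "R.V.dim N < R.V.dim M" using N by (intro R.V.fdim_psubset_dim R.fdim_M) auto
    ultimately obtain m2 where m2: "m2 \<in> N" "\<forall>x. \<phi>2 x = \<rho> x m2" using less.hyps[OF _ repN] by blast
    have "\<phi> x = \<rho> x (m1 + m2)" for x
      using m2(2)[rule_format, of x] by (simp add: \<phi>2_def lin_add[OF R.rho_lin] algebra_simps)
    moreover have "m1 + m2 \<in> M" using m1M m2(1) N(2) R.V.subspace_add[OF R.subspace_M] by blast
    ultimately show ?thesis by blast
  qed
qed

end

context lin_space begin

definition fun_scale :: "'a \<Rightarrow> ('b \<Rightarrow> 'b) \<Rightarrow> 'b \<Rightarrow> 'b" where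
  "fun_scale c h = (\<lambda>v. c *s h v)"

lemma lin_space_fun_scale: "lin_space fun_scale"
  by unfold_locales (auto simp: fun_scale_def fun_eq_iff algebra_simps)

end

lemma sum_fun_apply: "(\<Sum>i\<in>I. f i) v = (\<Sum>i\<in>I. f i v)" for f :: "'i \<Rightarrow> 'b \<Rightarrow> 'c::comm_monoid_add"
  by (induction I rule: infinite_finite_induct) auto

context lin_space begin

text \<open>
  The space \<open>Hom(A/N, N)\<close>, where \<open>A\<close> is the whole type.
\<close>

definition hom_quotient_sub :: "'b set \<Rightarrow> ('b \<Rightarrow> 'b) set" where
  "hom_quotient_sub N = {h. lin h \<and> range h \<subseteq> N \<and> (\<forall>v\<in>N. h v = 0)}"

lemma fdim_hom_quotient_sub:
  assumes U: "fdim UNIV" and N: "subspace N"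
  shows "lin_space.fdim fun_scale (hom_quotient_sub N)"
proof -
  interpret F: lin_space fun_scale by (rule lin_space_fun_scale)
  obtain C \<psi> where f: "frame UNIV C \<psi>" using frame_exists[OF U] .
  have C: "finite C" "\<And>v. (\<Sum>c\<in>C. \<psi> c v *s c) = v" using f by (auto simp: frame_def)
  let ?E = "\<lambda>(c, e). \<lambda>v. \<psi> c v *s e"
  have "h \<in> F.span (?E ` (C \<times> C))" if h: "lin h" for h
  proof -
    have "h = (\<Sum>c\<in>C. \<Sum>e\<in>C. fun_scale (\<psi> e (h c)) (?E (c, e)))"
    proof
      fix v
      have "h v = (\<Sum>c\<in>C. \<psi> c v *s h c)"
        using arg_cong[OF C(2)[of v], of h] by (simp add: lin_sum[OF h] lin_scale[OF h])
      also have "\<dots> = (\<Sum>c\<in>C. \<psi> c v *s (\<Sum>e\<in>C. \<psi> e (h c) *s e))" by (simp only: C(2))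
      also have "\<dots> = (\<Sum>c\<in>C. \<Sum>e\<in>C. fun_scale (\<psi> e (h c)) (?E (c, e)) v)"
        by (simp add: fun_scale_def scale_sum_right mult.commute)
      finally show "h v = (\<Sum>c\<in>C. \<Sum>e\<in>C. fun_scale (\<psi> e (h c)) (?E (c, e))) v" by (simp only: sum_fun_apply)
    qed
    moreover have "(\<Sum>c\<in>C. \<Sum>e\<in>C. fun_scale (\<psi> e (h c)) (?E (c, e))) \<in> F.span (?E ` (C \<times> C))"
      by (intro F.span_sum F.span_scale F.span_base imageI) simp
    ultimately show ?thesis by metis
  qed
  then have "hom_quotient_sub N \<subseteq> F.span (?E ` (C \<times> C))" by (auto simp: hom_quotient_sub_def)
  moreover have "F.subspace (hom_quotient_sub N)"
  proof (rule F.subspaceI)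
    show "0 \<in> hom_quotient_sub N"
      using subspace_0[OF N] lin_null by (auto simp: hom_quotient_sub_def zero_fun_def)
    fix g h c assume g: "g \<in> hom_quotient_sub N"
    then show "fun_scale c g \<in> hom_quotient_sub N"
      using subspace_scale[OF N] lin_smult[of g c] by (auto simp: hom_quotient_sub_def fun_scale_def)
    assume "h \<in> hom_quotient_sub N"
    then show "g + h \<in> hom_quotient_sub N"
      using g subspace_add[OF N] lin_plus[of g h] by (auto simp: hom_quotient_sub_def plus_fun_def image_subset_iff)
  qed
  moreover have "finite (?E ` (C \<times> C))" using C(1) by simp
  ultimately show ?thesis unfolding F.fdim_def by (intro conjI exI[of _ "?E ` (C \<times> C)"])
qed

end

context semisimple_lie_algebra begin

text \<open>
  For a linear projection \<open>p\<close> onto \<open>N\<close> the commutators \<open>[\<rho> x, p]\<close> vanish on \<open>N\<close> and map into \<open>N\<close>. They form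
  a cocycle, so \<open>[\<rho> x, p] = [\<rho> x, h]\<close> for some \<open>h\<close> in \<open>Hom(A/N, N)\<close>, and \<open>p - h\<close> is an equivariant
  projection onto \<open>N\<close>. The map \<open>\<pi>\<close> is the complementary projection.
\<close>

theorem equivariant_projection_exists:
  assumes rep: "lie_rep scale bracket sM UNIV \<rho>"
    and N: "module.subspace sM N" "\<And>x v. v \<in> N \<Longrightarrow> \<rho> x v \<in> N"
  shows "\<exists>\<pi>. Vector_Spaces.linear sM sM \<pi> \<and> (\<forall>v. v - \<pi> v \<in> N) \<and> (\<forall>v\<in>N. \<pi> v = 0) \<and>
    (\<forall>x v. \<pi> (\<rho> x v) = \<rho> x (\<pi> v))"
proof -
  interpret R: lie_rep scale bracket sM UNIV \<rho> by (rule rep)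
  obtain p where p: "R.V.lin p" "\<And>v. p v \<in> N" "\<And>v. v \<in> N \<Longrightarrow> p v = v"
    by (rule R.V.projection_exists[OF N(1)]) blast
  let ?M = "R.V.hom_quotient_sub N"
  let ?ad = "\<lambda>x h v. \<rho> x (h v) - h (\<rho> x v)"
  interpret F: lin_space R.V.fun_scale by (rule R.V.lin_space_fun_scale)
  note rl = R.rho_lin
  have repM: "lie_rep scale bracket R.V.fun_scale ?M ?ad"
  proof (intro lie_rep.intro lie_rep_axioms.intro fd_lie_algebra_axioms F.lin_space_axioms)
    show "F.fdim ?M" by (rule R.V.fdim_hom_quotient_sub[OF R.fdim_M N(1)])
    fix x y c h
    show "F.lin (?ad x)"
      by (intro F.linI) (auto simp: fun_eq_iff R.V.fun_scale_def lin_add[OF rl] lin_scale[OF rl] R.V.scale_right_diff_distrib)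
    assume h: "h \<in> ?M"
    then have lh: "R.V.lin h" "\<And>v. h v \<in> N" "\<And>v. v \<in> N \<Longrightarrow> h v = 0" by (auto simp: R.V.hom_quotient_sub_def)
    show "?ad x h \<in> ?M"
      unfolding R.V.hom_quotient_sub_def
      using lh N R.V.subspace_diff[OF N(1)] R.V.lin_minus[OF lin_comp[OF lh(1) rl] lin_comp[OF rl lh(1)]]
      by (auto simp: lin_zero[OF rl])
    show "?ad (x + y) h = ?ad x h + ?ad y h"
      by (auto simp: fun_eq_iff R.rho_add lin_add[OF lh(1)])
    show "?ad (c *\<^sub>L x) h = R.V.fun_scale c (?ad x h)"
      by (auto simp: fun_eq_iff R.V.fun_scale_def R.rho_scale lin_scale[OF lh(1)] R.V.scale_right_diff_distrib)
    show "?ad (bracket x y) h = ?ad x (?ad y h) - ?ad y (?ad x h)"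
      by (auto simp: fun_eq_iff R.rho_bracket lin_diff[OF lh(1)] lin_diff[OF rl])
  qed
  interpret H: lie_rep scale bracket R.V.fun_scale ?M ?ad by (rule repM)
  have "H.cocycle (\<lambda>x. ?ad x p)"
    unfolding H.cocycle_def
  proof (intro conjI allI)
    show "Vector_Spaces.linear scale R.V.fun_scale (\<lambda>x. ?ad x p)"
      by (auto simp: Vector_Spaces.linear_iff vector_space_axioms F.vector_space_axioms fun_eq_iff R.rho_add
        lin_add[OF p(1)] R.V.fun_scale_def R.rho_scale lin_scale[OF p(1)] R.V.scale_right_diff_distrib)
    show "range (\<lambda>x. ?ad x p) \<subseteq> ?M"
      using p N R.V.subspace_diff[OF N(1)] R.V.lin_minus[OF lin_comp[OF p(1) rl] lin_comp[OF rl p(1)]]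
      by (auto simp: R.V.hom_quotient_sub_def)
    show "?ad (bracket x y) p = ?ad x (?ad y p) - ?ad y (?ad x p)" for x y
      by (auto simp: fun_eq_iff R.rho_bracket lin_diff[OF p(1)] lin_diff[OF rl])
  qed
  from whitehead[OF repM this] obtain h where h: "h \<in> ?M" "\<And>x. ?ad x p = ?ad x h" by blast
  have lh: "R.V.lin h" "\<And>v. h v \<in> N" "\<And>v. v \<in> N \<Longrightarrow> h v = 0"
    using h(1) by (auto simp: R.V.hom_quotient_sub_def)
  define \<pi> where "\<pi> v = v - (p v - h v)" for v
  have "R.V.lin \<pi>" unfolding \<pi>_def by (intro R.V.lin_minus R.V.lin_id p lh)
  moreover have "v - \<pi> v \<in> N" for v using p(2) lh(2) R.V.subspace_diff[OF N(1)] by (simp add: \<pi>_def)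
  moreover have "\<pi> v = 0" if "v \<in> N" for v using that p(3) lh(3) by (simp add: \<pi>_def)
  moreover have "\<pi> (\<rho> x v) = \<rho> x (\<pi> v)" for x v
    using fun_cong[OF h(2)[of x], of v] by (simp add: \<pi>_def lin_diff[OF rl] lin_add[OF rl] algebra_simps)
  ultimately show ?thesis by blast
qed

end

section \<open>The Jacobson radical of a finite-dimensional algebra\<close>

sublocale associative_algebra \<subseteq> lin_space scale by unfold_locales

text \<open>
  The power \<open>x\<^bsup>n+1\<^esup>\<close>; without a unit the recursion has to start at \<open>x\<close>.
\<close>

primrec npow :: "'a::ring \<Rightarrow> nat \<Rightarrow> 'a" where
  "npow x 0 = x"
| "npow x (Suc n) = npow x n * x"

definition nilp :: "'a::ring \<Rightarrow> bool" where
  "nilp x \<longleftrightarrow> (\<exists>n. npow x n = 0)"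

lemma npow_left: "x * npow x n = npow x n * x"
  by (induction n) (simp_all add: mult.assoc[symmetric])

lemma npow_mult: "npow x n * npow x m = npow x (Suc (n + m))"
proof (induction m)
  case (Suc m)
  have "npow x n * npow x (Suc m) = (npow x n * npow x m) * x" by (simp add: mult.assoc)
  then show ?case using Suc by simp
qed simp

lemma npow_npow: "\<exists>k. npow (npow x n) m = npow x k"
proof (induction m)
  case 0 then show ?case by auto
next
  case (Suc m) then show ?case by (metis npow.simps(2) npow_mult)
qed

lemma nilp_npow: assumes "nilp (npow x n)" shows "nilp x"
  using assms npow_npow unfolding nilp_def by metis

lemma right_mult_funpow: "((\<lambda>y. y * x) ^^ Suc n) y = y * npow x n"
  by (induction n) (simp_all add: mult.assoc)

lemma left_mult_funpow: "((\<lambda>y. x * y) ^^ Suc n) y = npow x n * y"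
proof (induction n)
  case (Suc n)
  have "((\<lambda>y. x * y) ^^ Suc (Suc n)) y = x * (npow x n * y)" using Suc by simp
  then show ?case by (simp add: npow_left[symmetric] mult.assoc[symmetric])
qed simp

lemma npow_rotate: "npow (y * a) (Suc n) = y * npow (a * y) n * a"
  by (induction n) (simp_all add: mult.assoc)

lemma npow_idempotent: "e * e = e \<Longrightarrow> npow e n = e"
  by (induction n) simp_all

context lin_space begin

lemma fitting:
  assumes M: "fdim M" and T: "lin T" "T ` M \<subseteq> M"
  shows "\<exists>m. \<forall>v \<in> (T ^^ m) ` M. T v = 0 \<longrightarrow> v = 0"
proof -
  let ?K = "\<lambda>i. {v \<in> M. (T ^^ i) v = 0}"
  note l = lin_funpow[OF T(1)]
  have "subspace (?K i)" for i by (rule subspace_kernel_on[OF l fdim_subspace[OF M]])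
  moreover have "?K i \<subseteq> ?K (Suc i)" for i by (auto simp: lin_zero[OF T(1)])
  ultimately have "\<exists>m. ?K (Suc m) = ?K m" by (intro chain_stabilizes[OF M]) auto
  then obtain m where m: "?K (Suc m) = ?K m" by blast
  have "v = 0" if v: "v \<in> (T ^^ m) ` M" "T v = 0" for v
  proof -
    obtain u where u: "u \<in> M" "v = (T ^^ m) u" using v(1) by blast
    then have "u \<in> ?K (Suc m)" using v(2) by simp
    then show ?thesis using m u by blast
  qed
  then show ?thesis by blast
qed

end

locale fd_algebra = associative_algebra scale
  for scale :: "'k::field \<Rightarrow> 'a::ring \<Rightarrow> 'a" (infixr \<open>*\<^sub>A\<close> 75) +
  assumes fdim_UNIV: "fdim UNIV"
begin

lemma lin_left_mult: "lin (\<lambda>y. x * y)"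
  by (intro linI) (simp_all add: distrib_left scale_mult_right)

lemma lin_right_mult: "lin (\<lambda>y. y * x)"
  by (intro linI) (simp_all add: distrib_right scale_mult_left)

lemma fdim_all: "subspace N \<Longrightarrow> fdim N"
  using fdim_subset[OF fdim_UNIV] by blast

text \<open>
  For large \<open>m\<close> right multiplication by \<open>x\<close> is bijective on the left ideal \<open>W = N x\<^sup>m\<close>, which contains
  \<open>x\<^bsup>m+1\<^esup> \<noteq> 0\<close>. The element \<open>e \<in> W\<close> with \<open>e x\<^bsup>m+1\<^esup> = x\<^bsup>m+1\<^esup>\<close> is idempotent, since \<open>e\<^sup>2 - e \<in> W\<close> is killed by
  \<open>x\<^bsup>m+1\<^esup>\<close>.
\<close>

lemma idempotent_in_left_ideal:
  assumes R: "subalgebra R" and N: "left_ideal R N" and x: "x \<in> N" "\<not> nilp x"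
  shows "\<exists>e\<in>N. e * e = e \<and> e \<noteq> 0"
proof -
  let ?T = "\<lambda>y. y * x"
  have sN: "subspace N" and NR: "N \<subseteq> R" and RN: "\<And>r y. r \<in> R \<Longrightarrow> y \<in> N \<Longrightarrow> r * y \<in> N"
    using N by (auto simp: left_ideal_def)
  have TN: "?T ` N \<subseteq> N" using x NR RN by blast
  obtain m where m: "\<And>v. v \<in> (?T ^^ m) ` N \<Longrightarrow> ?T v = 0 \<Longrightarrow> v = 0"
    using fitting[OF fdim_all[OF sN] lin_right_mult TN] by blast
  let ?W = "(?T ^^ m) ` N"
  have sW: "subspace ?W" using subspace_image[OF lin_funpow[OF lin_right_mult] sN] .
  have TW: "?T ` ?W \<subseteq> ?W"
  proof (rule image_subsetI)
    fix w assume "w \<in> ?W"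
    then obtain v where v: "v \<in> N" "w = (?T ^^ m) v" by blast
    have "?T w = (?T ^^ m) (?T v)" unfolding v(2) by (rule funpow_swap1)
    then show "?T w \<in> ?W" using TN v by blast
  qed
  have surj: "?T ` ?W = ?W" by (rule fdim_inj_surj[OF fdim_all[OF sW] lin_right_mult TW m])
  have surj': "(?T ^^ k) ` ?W = ?W" for k
    by (induction k) (simp, metis surj funpow.simps(2) image_comp)
  have inj': "v = 0" if "v \<in> ?W" "(?T ^^ k) v = 0" for v k
    using that
  proof (induction k)
    case (Suc k)
    have "(?T ^^ k) v \<in> ?W" using funpow_mem[OF TW Suc.prems(1)] .
    then show ?case using Suc m by simp
  qed simp
  have WN: "?W \<subseteq> N" using funpow_mem[OF TN] by blast
  have RW: "r * w \<in> ?W" if r: "r \<in> R" and w: "w \<in> ?W" for r w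
  proof -
    obtain v where v: "v \<in> N" "w = (?T ^^ m) v" using w by blast
    have "r * (?T ^^ m) v = (?T ^^ m) (r * v)" by (induction m) (simp_all add: mult.assoc[symmetric])
    then show ?thesis using v RN[OF r] by blast
  qed
  have Tx: "(?T ^^ m) x = npow x m" by (induction m) simp_all
  then have "npow x m \<in> ?W" using x by (metis imageI)
  then obtain e where e: "e \<in> ?W" "(?T ^^ Suc m) e = npow x m" using surj'[of "Suc m"] by (metis imageE)
  then have ex: "e * npow x m = npow x m" by (simp only: right_mult_funpow)
  have "(?T ^^ Suc m) (e * e - e) = 0"
    unfolding right_mult_funpow by (simp add: left_diff_distrib mult.assoc ex)
  moreover have "e * e - e \<in> ?W" using e(1) WN NR RW subspace_diff[OF sW] by blast
  ultimately have "e * e - e = 0" using inj' by blast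
  moreover have "npow x m \<noteq> 0" using x(2) by (auto simp: nilp_def)
  then have "e \<noteq> 0" using ex by auto
  ultimately show ?thesis using e WN by auto
qed

lemma subset_jacobson_radicalI:
  assumes "x \<in> R" "\<And>L. maximal_left_ideal R L \<Longrightarrow> modular_left_ideal R L \<Longrightarrow> x \<in> L"
  shows "x \<in> jacobson_radical R"
  using assms by (auto simp: jacobson_radical_def)

lemma left_ideal_jacobson_radical:
  assumes R: "subalgebra R" shows "left_ideal R (jacobson_radical R)"
  unfolding left_ideal_def
proof (intro conjI ballI)
  have l: "left_ideal R L" if "maximal_left_ideal R L" for L
    using that by (simp add: maximal_left_ideal_def)
  show "subspace (jacobson_radical R)"
    using R l unfolding jacobson_radical_def subalgebra_def left_ideal_def
    by (intro subspace_inter subspace_Inter) auto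
  show "jacobson_radical R \<subseteq> R" by (auto simp: jacobson_radical_def)
  fix r x assume "r \<in> R" "x \<in> jacobson_radical R"
  then show "r * x \<in> jacobson_radical R"
    using R l by (auto simp: jacobson_radical_def subalgebra_def left_ideal_def)
qed

lemma maximal_left_ideal_exists:
  assumes R: "subalgebra R" and L: "left_ideal R L" "L \<noteq> R"
  shows "\<exists>K. maximal_left_ideal R K \<and> L \<subseteq> K"
proof -
  let ?P = "\<lambda>K. left_ideal R K \<and> K \<noteq> R \<and> L \<subseteq> K"
  have bound: "dim K < Suc (dim UNIV)" if "?P K" for K
    using that fdim_subset_dim_le[OF fdim_UNIV, of K] by (auto simp: left_ideal_def)
  obtain K where K: "?P K" and max: "\<And>K'. ?P K' \<Longrightarrow> dim K' \<le> dim K"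
    using ex_has_greatest_nat[of ?P L dim "Suc (dim UNIV)"] bound L by auto
  have "K' = K \<or> K' = R" if K': "left_ideal R K'" "K \<subseteq> K'" for K'
  proof (rule ccontr)
    assume neg: "\<not> ?thesis"
    then have "K \<subset> K'" "?P K'" using K' K by auto
    moreover have "subspace K" "subspace K'" using K K' by (auto simp: left_ideal_def)
    ultimately show False using max[of K'] fdim_psubset_dim[of K' K] fdim_all by fastforce
  qed
  then have "maximal_left_ideal R K" using K unfolding maximal_left_ideal_def by blast
  then show ?thesis using K by blast
qed

text \<open>
  If the radical were not nil, it would contain an idempotent \<open>e \<noteq> 0\<close>. The left ideal \<open>{r - r e}\<close> does not
  contain \<open>e\<close>, and a maximal left ideal above it is modular, so it contains the radical and with \<open>e\<close> also
  every \<open>r = (r - r e) + r e\<close>.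
\<close>

lemma jacobson_radical_nil:
  assumes R: "subalgebra R" and x: "x \<in> jacobson_radical R"
  shows "nilp x"
proof (rule ccontr)
  let ?J = "jacobson_radical R"
  assume "\<not> nilp x"
  then obtain e where e: "e \<in> ?J" "e * e = e" "e \<noteq> 0"
    using idempotent_in_left_ideal[OF R left_ideal_jacobson_radical[OF R] x] by blast
  have eR: "e \<in> R" using e by (simp add: jacobson_radical_def)
  have sR: "subspace R" using R by (simp add: subalgebra_def)
  let ?L = "(\<lambda>r. r - r * e) ` R"
  have sL: "subspace ?L" by (intro subspace_image lin_minus lin_id lin_right_mult sR)
  have LR: "?L \<subseteq> R" using R eR subspace_diff[OF sR] by (auto simp: subalgebra_def)
  have "a * y \<in> ?L" if a: "a \<in> R" "y \<in> ?L" for a y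
  proof -
    obtain r where "r \<in> R" "y = r - r * e" using a by blast
    then have "a * y = a * r - (a * r) * e" "a * r \<in> R"
      using R a by (auto simp: right_diff_distrib mult.assoc subalgebra_def)
    then show ?thesis by blast
  qed
  then have L: "left_ideal R ?L" using sL LR by (auto simp: left_ideal_def)
  have "?L \<noteq> R"
  proof
    assume "?L = R"
    then obtain r where r: "e = r - r * e" using eR by blast
    then have "e * e = r * e - (r * e) * e" by (metis left_diff_distrib)
    then show False using e by (simp add: mult.assoc)
  qed
  then obtain K where K: "maximal_left_ideal R K" "?L \<subseteq> K"
    using maximal_left_ideal_exists[OF R L] by blast
  then have lK: "left_ideal R K" "K \<noteq> R" by (auto simp: maximal_left_ideal_def)
  have "modular_left_ideal R K" using lK K(2) eR by (auto simp: modular_left_ideal_def)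
  then have eK: "e \<in> K" using e(1) K(1) by (auto simp: jacobson_radical_def)
  have "r \<in> K" if r: "r \<in> R" for r
  proof -
    have "r - r * e \<in> K" "r * e \<in> K" using r eK K(2) lK by (auto simp: left_ideal_def)
    moreover have "subspace K" using lK(1) by (simp add: left_ideal_def)
    ultimately have "(r - r * e) + r * e \<in> K" using subspace_add by blast
    then show ?thesis by simp
  qed
  then show False using lK by (auto simp: left_ideal_def)
qed

text \<open>
  If a modular maximal left ideal \<open>L\<close> did not contain \<open>N\<close>, then \<open>N + L = R\<close>, and the right unit modulo \<open>L\<close>
  could be taken from \<open>N\<close>. A nilpotent right unit forces \<open>R = L\<close>.
\<close>

lemma nil_left_ideal_subset_radical:
  assumes R: "subalgebra R" and N: "left_ideal R N" "\<And>x. x \<in> N \<Longrightarrow> nilp x"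
  shows "N \<subseteq> jacobson_radical R"
proof
  fix x assume x: "x \<in> N"
  have sN: "subspace N" and NR: "N \<subseteq> R" and RN: "\<And>r y. r \<in> R \<Longrightarrow> y \<in> N \<Longrightarrow> r * y \<in> N"
    using N(1) by (auto simp: left_ideal_def)
  show "x \<in> jacobson_radical R"
  proof (rule subset_jacobson_radicalI)
    show "x \<in> R" using x NR by blast
    fix L assume max: "maximal_left_ideal R L" and mod: "modular_left_ideal R L"
    have sL: "subspace L" and LR: "L \<subseteq> R" "L \<noteq> R" and RL: "\<And>r y. r \<in> R \<Longrightarrow> y \<in> L \<Longrightarrow> r * y \<in> L"
      using max by (auto simp: maximal_left_ideal_def left_ideal_def)
    obtain e where e: "e \<in> R" "\<And>r. r \<in> R \<Longrightarrow> r - r * e \<in> L" using mod by (auto simp: modular_left_ideal_def)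
    show "x \<in> L"
    proof (rule ccontr)
      assume xL: "x \<notin> L"
      let ?S = "{y + z | y z. y \<in> N \<and> z \<in> L}"
      have sR: "subspace R" using R by (simp add: subalgebra_def)
      have "left_ideal R ?S"
        unfolding left_ideal_def
      proof (intro conjI ballI)
        show "subspace ?S" by (rule subspace_sums[OF sN sL])
        show "?S \<subseteq> R" using NR LR subspace_add[OF sR] by blast
        fix r w assume "r \<in> R" "w \<in> ?S"
        then show "r * w \<in> ?S" using RN RL by (auto simp: distrib_left) blast
      qed
      moreover have "L \<subseteq> ?S" using subspace_0[OF sN] by force
      moreover have "x \<in> ?S" using subspace_0[OF sL] x by force
      ultimately have "?S = R" using max xL unfolding maximal_left_ideal_def by blast
      then obtain n l where n: "e = n + l" "n \<in> N" "l \<in> L" using e(1) by blast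
      have step: "r - r * n \<in> L" if "r \<in> R" for r
      proof -
        have "r - r * n = (r - r * e) + r * l" using n(1) by (simp add: distrib_left)
        then show ?thesis using subspace_add[OF sL e(2)[OF that] RL[OF that n(3)]] by (simp only:)
      qed
      have nR: "n \<in> R" using n NR by blast
      have pow: "r - r * npow n k \<in> L" if "r \<in> R" for r k
        using that
      proof (induction k arbitrary: r)
        case 0 then show ?case using step by simp
      next
        case (Suc k)
        have rn: "r * n \<in> R" using Suc.prems nR R by (simp add: subalgebra_def)
        have "r - r * npow n (Suc k) = (r - r * n) + (r * n - r * n * npow n k)"
          by (simp add: mult.assoc npow_left)
        then show ?case using subspace_add[OF sL step[OF Suc.prems] Suc.IH[OF rn]] by (simp only:)
      qed
      obtain k where "npow n k = 0" using N(2)[OF n(2)] by (auto simp: nilp_def)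
      then have "R \<subseteq> L" using pow[of _ k] by auto
      then show False using LR by blast
    qed
  qed
qed

text \<open>
  The left ideal \<open>J a\<close> is nil because \<open>(y a)\<^bsup>k+1\<^esup> = y (a y)\<^sup>k a\<close>.
\<close>

lemma jacobson_radical_right:
  assumes R: "subalgebra R" and x: "x \<in> jacobson_radical R" and a: "a \<in> R"
  shows "x * a \<in> jacobson_radical R"
proof -
  let ?J = "jacobson_radical R"
  note lJ = left_ideal_jacobson_radical[OF R]
  let ?N = "(\<lambda>y. y * a) ` ?J"
  have "left_ideal R ?N"
    unfolding left_ideal_def
  proof (intro conjI ballI)
    show "subspace ?N" using lJ by (intro subspace_image lin_right_mult) (simp add: left_ideal_def)
    show "?N \<subseteq> R" using R a by (auto simp: jacobson_radical_def subalgebra_def)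
    fix r w assume r: "r \<in> R" and "w \<in> ?N"
    then obtain y where y: "y \<in> ?J" "w = y * a" by blast
    then have "r * w = (r * y) * a" "r * y \<in> ?J" using r lJ by (auto simp: left_ideal_def mult.assoc)
    then show "r * w \<in> ?N" by blast
  qed
  moreover have "nilp w" if w: "w \<in> ?N" for w
  proof -
    obtain y where y: "y \<in> ?J" "w = y * a" using w by blast
    then have "a * y \<in> ?J" using a lJ by (auto simp: left_ideal_def)
    then obtain n where "npow (a * y) n = 0" using jacobson_radical_nil[OF R] by (auto simp: nilp_def)
    then have "npow w (Suc n) = 0" unfolding y(2) npow_rotate by simp
    then show ?thesis by (auto simp: nilp_def simp del: npow.simps)
  qed
  ultimately have "?N \<subseteq> ?J" by (rule nil_left_ideal_subset_radical[OF R])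
  then show ?thesis using x by blast
qed

lemma subalgebra_UNIV: "subalgebra UNIV"
  by (simp add: subalgebra_def)

abbreviation J :: "'a set" where "J \<equiv> jacobson_radical UNIV"

lemma J_facts:
  shows subspace_J: "subspace J" and J_left: "x \<in> J \<Longrightarrow> a * x \<in> J" and J_right: "x \<in> J \<Longrightarrow> x * a \<in> J"
    and J_nil: "x \<in> J \<Longrightarrow> nilp x"
  using left_ideal_jacobson_radical[OF subalgebra_UNIV] jacobson_radical_right[OF subalgebra_UNIV]
    jacobson_radical_nil[OF subalgebra_UNIV] by (auto simp: left_ideal_def)

text \<open>
  An algebra acts by left multiplication on itself as a Lie algebra, which makes Engel's theorem
  available for nil subalgebras.
\<close>

lemma lie_rep_left_mult: "lie_rep scale (\<lambda>x y. x * y - y * x) scale UNIV (\<lambda>x y. x * y)"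
proof (intro lie_rep.intro fd_lie_algebra.intro lie_algebra.intro lie_algebra_axioms.intro
    fd_lie_algebra_axioms.intro lie_rep_axioms.intro vector_space_axioms lin_space_axioms fdim_UNIV
    lin_left_mult lin_minus lin_right_mult)
qed (simp_all add: algebra_simps scale_mult_left)

definition ideal_square :: "'a set \<Rightarrow> 'a set" where
  "ideal_square I = span {x * y | x y. x \<in> I \<and> y \<in> I}"

text \<open>
  By Engel's theorem the socle series of \<open>I\<close> acting on the algebra reaches the whole algebra. If
  \<open>I\<^sup>2 = I\<close>, then \<open>I\<close> would descend through this series to \<open>0\<close>.
\<close>

lemma nil_square_proper:
  assumes I: "subalgebra I" "\<And>x. x \<in> I \<Longrightarrow> nilp x" "I \<noteq> {0}"
  shows "ideal_square I \<subset> I"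
proof -
  interpret R: lie_rep scale "\<lambda>x y. x * y - y * x" scale UNIV "\<lambda>x y. x * y" by (rule lie_rep_left_mult)
  have sI: "subspace I" using I by (simp add: subalgebra_def)
  have "R.L.lie_subalgebra I" using I(1) subspace_diff[OF sI] by (auto simp: R.L.lie_subalgebra_def subalgebra_def)
  moreover have "locally_nilpotent_on UNIV (\<lambda>y. x * y)" if "x \<in> I" for x
    unfolding locally_nilpotent_on_def
  proof
    fix v
    obtain n where "npow x n = 0" using I(2) \<open>x \<in> I\<close> by (auto simp: nilp_def)
    then have "((\<lambda>y. x * y) ^^ Suc n) v = 0" unfolding left_mult_funpow by simp
    then show "\<exists>n. ((\<lambda>y. x * y) ^^ n) v = 0" by blast
  qed
  ultimately have "R.acts_unipotently I" by (rule R.engel)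
  then obtain n where n: "R.socle_series I n = UNIV" using R.socle_exhausts by blast
  have sub: "ideal_square I \<subseteq> I" unfolding ideal_square_def
    using I(1) by (intro span_minimal) (auto simp: subalgebra_def)
  have "ideal_square I \<noteq> I"
  proof
    assume eq: "ideal_square I = I"
    have "I \<subseteq> R.socle_series I i \<Longrightarrow> I = {0}" for i
    proof (induction i)
      case 0 then show ?case using subspace_0[OF sI] by auto
    next
      case (Suc i)
      have "ideal_square I \<subseteq> R.socle_series I i" unfolding ideal_square_def
        using Suc.prems R.subspace_socle by (intro span_minimal) auto
      then show ?case using Suc.IH eq by simp
    qed
    then show False using n I(3) by blast
  qed
  then show ?thesis using sub by blast
qed

end

section \<open>Trace forms, separability and lifting of sections\<close>

text \<open>
  A linear idempotent whose kernel is an ideal: its range is a model of the quotient algebra, with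
  product \<open>\<pi> (u * v)\<close>. Below it is applied with kernel \<open>0\<close> and with kernel the radical.
\<close>

locale algebra_projection = fd_algebra scale
  for scale :: "'k::field_char_0 \<Rightarrow> 'a::ring \<Rightarrow> 'a" (infixr \<open>*\<^sub>A\<close> 75) +
  fixes \<pi> :: "'a \<Rightarrow> 'a"
  assumes lin_pi: "lin \<pi>"
    and pi_idem: "\<pi> (\<pi> x) = \<pi> x"
    and pi_kernel: "\<pi> x = 0 \<Longrightarrow> \<pi> (x * y) = 0" "\<pi> x = 0 \<Longrightarrow> \<pi> (y * x) = 0"
begin

lemma pi_mult: "\<pi> (\<pi> x * y) = \<pi> (x * y)" "\<pi> (x * \<pi> y) = \<pi> (x * y)"
proof -
  have "\<pi> (z - \<pi> z) = 0" for z by (simp add: lin_diff[OF lin_pi] pi_idem)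
  then have "\<pi> ((x - \<pi> x) * y) = 0" "\<pi> (x * (y - \<pi> y)) = 0" using pi_kernel by blast+
  then show "\<pi> (\<pi> x * y) = \<pi> (x * y)" "\<pi> (x * \<pi> y) = \<pi> (x * y)"
    by (simp_all add: left_diff_distrib right_diff_distrib lin_diff[OF lin_pi])
qed

abbreviation V :: "'a set" where "V \<equiv> range \<pi>"

lemma fdim_V: "fdim V"
  by (intro fdim_all subspace_image lin_pi subspace_UNIV)

lemma pi_V: "v \<in> V \<Longrightarrow> \<pi> v = v"
  using pi_idem by blast

text \<open>
  The trace of left multiplication by \<open>x\<close> on the quotient algebra.
\<close>

definition mult_trace :: "'a \<Rightarrow> 'k" where
  "mult_trace x = trace_on V (\<lambda>v. \<pi> (x * v))"

lemma lin_pi_mult: "lin (\<lambda>v. \<pi> (x * v))"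
  by (rule lin_comp[OF lin_left_mult lin_pi])

lemma pi_image: "(\<lambda>v. \<pi> (T v)) ` V \<subseteq> V"
  by blast

lemma functional_mult_trace: "functional mult_trace"
proof (rule functionalI)
  fix x y c
  show "mult_trace (x + y) = mult_trace x + mult_trace y"
    unfolding mult_trace_def
    using trace_add[OF fdim_V lin_pi_mult pi_image lin_pi_mult pi_image, of x y]
    by (simp add: distrib_right lin_add[OF lin_pi])
  show "mult_trace (c *\<^sub>A x) = c * mult_trace x"
    unfolding mult_trace_def
    using trace_scale[OF fdim_V lin_id _ lin_pi_mult pi_image, of c x]
    by (simp add: scale_mult_left lin_scale[OF lin_pi])
qed

lemma mult_trace_pi: "mult_trace (\<pi> x) = mult_trace x"
  by (simp add: mult_trace_def pi_mult)

lemma mult_trace_commute: "mult_trace (x * y) = mult_trace (y * x)"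
proof -
  have *: "mult_trace (x * y) = trace_on V (\<lambda>v. \<pi> (x * \<pi> (y * v)))" for x y
    by (simp add: mult_trace_def pi_mult mult.assoc)
  show ?thesis unfolding * by (intro trace_commute fdim_V lin_pi_mult pi_image)
qed

lemma pi_mult_funpow: "((\<lambda>v. \<pi> (x * v)) ^^ Suc n) v = \<pi> (npow x n * v)"
proof (induction n)
  case (Suc n)
  have "((\<lambda>v. \<pi> (x * v)) ^^ Suc (Suc n)) v = \<pi> (x * \<pi> (npow x n * v))"
    unfolding Suc.IH[symmetric] by simp
  then show ?case by (simp add: pi_mult npow_left[symmetric] mult.assoc[symmetric])
qed simp

lemma mult_trace_nilp:
  assumes "nilp x" shows "mult_trace x = 0"
  unfolding mult_trace_def
proof (rule trace_nilpotent[OF fdim_V lin_pi_mult pi_image])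
  obtain n where "npow x n = 0" using assms by (auto simp: nilp_def)
  then have "((\<lambda>v. \<pi> (x * v)) ^^ Suc n) v = 0" for v
    unfolding pi_mult_funpow by (simp add: lin_zero[OF lin_pi])
  then show "locally_nilpotent_on V (\<lambda>v. \<pi> (x * v))" unfolding locally_nilpotent_on_def by blast
qed

text \<open>
  The trace of an idempotent operator is the dimension of its image, and characteristic \<open>0\<close> makes this
  dimension zero.
\<close>

lemma mult_trace_idempotent:
  assumes e: "e * e = e" "mult_trace e = 0" shows "\<pi> e = 0"
proof -
  let ?T = "\<lambda>v. \<pi> (e * v)"
  have "?T (?T v) = ?T v" for v by (simp add: pi_mult e mult.assoc[symmetric])
  then have "mult_trace e = of_nat (dim (?T ` V))"
    unfolding mult_trace_def by (intro trace_idempotent fdim_V lin_pi_mult pi_image)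
  then have "dim (?T ` V) = 0" using e by simp
  moreover have "subspace (?T ` V)" by (intro subspace_image lin_pi_mult fdim_subspace fdim_V)
  ultimately have "?T ` V = {0}" using fdim_dim_0 fdim_all by blast
  then have "?T (\<pi> e) = 0" by blast
  then show ?thesis by (simp add: pi_mult e)
qed

text \<open>
  Left multiplication by \<open>\<delta> x\<close> is the commutator of \<open>\<delta>\<close> with left multiplication by \<open>x\<close>.
\<close>

lemma mult_trace_derivation:
  assumes D: "derivation \<delta>" "\<And>v. \<pi> (\<delta> v) = \<delta> (\<pi> v)"
  shows "mult_trace (\<delta> x) = 0"
proof -
  have l: "lin \<delta>" and leib: "\<delta> (u * v) = \<delta> u * v + u * \<delta> v" for u v
    using D(1) by (auto simp: derivation_def)
  have dV: "\<delta> ` V \<subseteq> V"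
  proof (rule image_subsetI)
    fix v assume "v \<in> V"
    then have "\<pi> v = v" by (rule pi_V)
    then have "\<pi> (\<delta> v) = \<delta> v" using D(2)[of v] by simp
    then show "\<delta> v \<in> V" using rangeI[of \<pi> "\<delta> v"] by simp
  qed
  have "\<pi> (\<delta> x * v) = \<delta> (\<pi> (x * v)) - \<pi> (x * \<delta> v)" for v
    using leib[of x v] by (simp add: D(2)[symmetric] lin_add[OF lin_pi])
  then have "mult_trace (\<delta> x) = trace_on V (\<lambda>v. \<delta> (\<pi> (x * v)) - \<pi> (x * \<delta> v))"
    by (simp add: mult_trace_def)
  also have "\<dots> = trace_on V (\<lambda>v. \<delta> (\<pi> (x * v))) - trace_on V (\<lambda>v. \<pi> (x * \<delta> v))"
  proof (rule trace_diff[OF fdim_V])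
    show "lin (\<lambda>v. \<delta> (\<pi> (x * v)))" by (rule lin_comp[OF lin_pi_mult l])
    show "lin (\<lambda>v. \<pi> (x * \<delta> v))" by (rule lin_comp[OF l lin_pi_mult])
    show "(\<lambda>v. \<delta> (\<pi> (x * v))) ` V \<subseteq> V" using dV by blast
  qed blast
  also have "trace_on V (\<lambda>v. \<delta> (\<pi> (x * v))) = trace_on V (\<lambda>v. \<pi> (x * \<delta> v))"
    by (rule trace_commute[OF fdim_V l dV lin_pi_mult pi_image])
  finally show ?thesis by simp
qed

text \<open>
  The elements \<open>x\<close> of this kind form a left ideal. It is nil, since an idempotent \<open>e\<close> in it
  has \<open>mult_trace e = mult_trace (e * e) = 0\<close>.
\<close>

lemma trace_radical_subset_J:
  assumes nil: "\<And>x. \<pi> x = 0 \<Longrightarrow> nilp x" and x: "\<And>y. mult_trace (x * y) = 0"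
  shows "x \<in> J"
proof -
  note fu = functional_mult_trace
  let ?R = "{x. \<forall>y. mult_trace (x * y) = 0}"
  have R: "left_ideal UNIV ?R"
    unfolding left_ideal_def
  proof (intro conjI ballI)
    show "subspace ?R"
      by (intro subspaceI) (auto simp: lin_zero[OF fu] distrib_right lin_add[OF fu] scale_mult_left lin_scale[OF fu])
    fix r w assume w: "w \<in> ?R"
    have "mult_trace (r * w * y) = mult_trace (w * (y * r))" for y
      using mult_trace_commute[of r "w * y"] by (simp add: mult.assoc)
    then show "r * w \<in> ?R" using w by simp
  qed simp
  have "nilp w" if w: "w \<in> ?R" for w
  proof (rule ccontr)
    assume "\<not> nilp w"
    then obtain e where e: "e \<in> ?R" "e * e = e" "e \<noteq> 0"
      using idempotent_in_left_ideal[OF subalgebra_UNIV R w] by blast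
    have "mult_trace (e * e) = 0" using e(1) by blast
    then have "mult_trace e = 0" using e(2) by simp
    then have "nilp e" using mult_trace_idempotent[OF e(2)] nil by blast
    then show False using npow_idempotent[OF e(2)] e(3) by (simp add: nilp_def)
  qed
  then have "?R \<subseteq> J" by (rule nil_left_ideal_subset_radical[OF subalgebra_UNIV R])
  then show ?thesis using x by blast
qed

end

locale char0_fd_algebra = fd_algebra scale
  for scale :: "'k::field_char_0 \<Rightarrow> 'a::ring \<Rightarrow> 'a" (infixr \<open>*\<^sub>A\<close> 75)
begin

text \<open>
  The radical is exactly the kernel of the form \<open>tr L\<^sub>x\<^sub>y\<close>, which derivations leave invariant.
\<close>

theorem derivation_preserves_radical:
  assumes D: "derivation \<delta>" and x: "x \<in> J" shows "\<delta> x \<in> J"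
proof -
  interpret I: algebra_projection scale "\<lambda>v. v"
    by unfold_locales (simp_all add: lin_id)
  note fu = I.functional_mult_trace
  have l: "lin \<delta>" and leib: "\<And>u v. \<delta> (u * v) = \<delta> u * v + u * \<delta> v"
    using D by (auto simp: derivation_def)
  have zero: "I.mult_trace (x * y) = 0" for y using I.mult_trace_nilp J_nil J_right x by blast
  have "I.mult_trace (\<delta> x * y) = 0" for y
  proof -
    have "I.mult_trace (\<delta> (x * y)) = 0" by (rule I.mult_trace_derivation[OF D refl])
    then show ?thesis using zero[of "\<delta> y"] by (simp add: leib lin_add[OF fu])
  qed
  then show ?thesis by (intro I.trace_radical_subset_J) (auto simp: nilp_def intro: exI[of _ 0])
qed

end

text \<open>
  Equivariance is only used for one derivation at a time, so \<open>\<Delta>\<close> is a set without further structure;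
  for an action it is the image of the Lie algebra.
\<close>

locale equivariant_radical_projection = char0_fd_algebra scale
  for scale :: "'k::field_char_0 \<Rightarrow> 'a::ring \<Rightarrow> 'a" (infixr \<open>*\<^sub>A\<close> 75) +
  fixes \<pi> :: "'a \<Rightarrow> 'a" and \<Delta> :: "('a \<Rightarrow> 'a) set"
  assumes pi_lin: "lin \<pi>"
    and pi_J: "x \<in> J \<Longrightarrow> \<pi> x = 0"
    and diff_pi: "x - \<pi> x \<in> J"
    and derivations: "\<delta> \<in> \<Delta> \<Longrightarrow> derivation \<delta>"
    and pi_equivariant: "\<delta> \<in> \<Delta> \<Longrightarrow> \<pi> (\<delta> x) = \<delta> (\<pi> x)"
begin

lemma pi_zero_iff: "\<pi> x = 0 \<longleftrightarrow> x \<in> J"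
  using pi_J diff_pi[of x] by auto

sublocale algebra_projection scale \<pi>
proof (intro algebra_projection.intro algebra_projection_axioms.intro fd_algebra_axioms)
  show "\<pi> (\<pi> x) = \<pi> x" for x using pi_J[OF diff_pi, of x] by (simp add: lin_diff[OF pi_lin])
qed (auto simp: pi_lin pi_zero_iff J_left J_right)

abbreviation \<beta> :: "'a \<Rightarrow> 'a \<Rightarrow> 'k" where
  "\<beta> u v \<equiv> mult_trace (u * v)"

lemma beta_functional: "functional (\<beta> u)" "functional (\<lambda>u. \<beta> u v)"
  by (rule lin_comp[OF lin_left_mult functional_mult_trace] lin_comp[OF lin_right_mult functional_mult_trace])+

lemma beta_pi: "\<beta> (\<pi> u) v = \<beta> u v" "\<beta> u (\<pi> v) = \<beta> u v"
  by (metis mult_trace_pi pi_mult)+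

lemma beta_nondegenerate:
  assumes v: "v \<in> V" "\<And>u. u \<in> V \<Longrightarrow> \<beta> u v = 0"
  shows "v = 0"
proof -
  have "\<beta> v y = 0" for y
    using v(2)[of "\<pi> y"] by (simp add: mult_trace_commute[of v] beta_pi)
  then have "v \<in> J" by (intro trace_radical_subset_J) (auto simp: pi_zero_iff J_nil)
  then show ?thesis using pi_J pi_V[OF v(1)] by simp
qed

text \<open>
  A fixed choice of dual bases \<open>B\<close> and \<open>d\<close> for the nondegenerate form \<open>\<beta>\<close> on the complement \<open>V\<close>. The tensor
  \<open>\<Sum> b \<otimes> d b\<close> is the separability idempotent of the algebra modulo \<open>J\<close>.
\<close>

definition dual_pair :: "'a set \<times> ('a \<Rightarrow> 'a)" where
  "dual_pair = (SOME Bd. dual_bases V \<beta> (fst Bd) (snd Bd))"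

definition B :: "'a set" where "B = fst dual_pair"
definition d :: "'a \<Rightarrow> 'a" where "d = snd dual_pair"

lemma dual_B: "dual_bases V \<beta> B d"
proof -
  have "\<exists>B d. dual_bases V \<beta> B d"
    by (rule dual_bases_exist[OF fdim_V beta_functional beta_nondegenerate])
  then have "\<exists>Bd. dual_bases V \<beta> (fst Bd) (snd Bd)" by auto
  then show ?thesis unfolding B_def d_def dual_pair_def by (rule someI_ex)
qed

text \<open>
  The product of the two factors of the separability idempotent, a unit modulo \<open>J\<close>.
\<close>

definition z :: 'a where "z = (\<Sum>b\<in>B. b * d b)"

text \<open>
  In the frame of the dual bases the trace of left multiplication by \<open>y\<close> is \<open>\<Sum> \<beta>(y b, d b)\<close>.
\<close>

lemma mult_trace_z: "mult_trace (y * z) = mult_trace y"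
proof -
  note D = dual_basesD[OF dual_B]
  have "frame V B (\<lambda>b v. \<beta> v (d b))"
    unfolding frame_def using D(1,2,5) beta_functional(2) by auto
  then have "mult_trace y = (\<Sum>b\<in>B. \<beta> (\<pi> (y * b)) (d b))"
    unfolding mult_trace_def[of y] by (rule trace_frame[OF _ lin_pi_mult pi_image])
  also have "\<dots> = (\<Sum>b\<in>B. mult_trace (y * (b * d b)))" by (simp add: beta_pi mult.assoc)
  also have "\<dots> = mult_trace (y * z)"
    by (simp add: z_def sum_distrib_left lin_sum[OF functional_mult_trace])
  finally show ?thesis by simp
qed

lemma eq_by_beta:
  assumes "\<And>y. \<beta> y u = \<beta> y v" shows "\<pi> u = \<pi> v"
proof -
  have "\<beta> y (\<pi> u - \<pi> v) = 0" for y
    using assms by (simp add: lin_diff[OF beta_functional(1)] beta_pi)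
  moreover have "\<pi> u - \<pi> v \<in> V" by (metis lin_diff[OF pi_lin] rangeI)
  ultimately show ?thesis using beta_nondegenerate by (metis eq_iff_diff_eq_0)
qed

text \<open>
  By the previous lemma \<open>z\<close> cannot be distinguished from a unit by the form \<open>\<beta>\<close>.
\<close>

lemma z_unit: "\<pi> (z * w) = \<pi> w" "\<pi> (w * z) = \<pi> w"
proof -
  have "\<beta> y (z * w) = \<beta> y w" for y
  proof -
    have "\<beta> y (z * w) = mult_trace (w * (y * z))"
      using mult_trace_commute[of "y * z" w] by (simp add: mult.assoc)
    also have "\<dots> = mult_trace (w * y)" using mult_trace_z[of "w * y"] by (simp add: mult.assoc)
    finally show ?thesis by (simp add: mult_trace_commute)
  qed
  then show "\<pi> (z * w) = \<pi> w" by (rule eq_by_beta)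
  have "\<beta> y (w * z) = \<beta> y w" for y using mult_trace_z[of "y * w"] by (simp add: mult.assoc)
  then show "\<pi> (w * z) = \<pi> w" by (rule eq_by_beta)
qed

lemma derivationD:
  assumes "\<delta> \<in> \<Delta>"
  shows "lin \<delta>" "\<delta> (u * v) = \<delta> u * v + u * \<delta> v"
  using derivations[OF assms] by (auto simp: derivation_def)

text \<open>
  Modulo \<open>J\<close> a derivation kills every unit, since \<open>\<delta> z = \<delta> (z z) = 2 \<delta> z\<close>.
\<close>

lemma z_invariant: assumes \<delta>: "\<delta> \<in> \<Delta>" shows "\<pi> (\<delta> z) = 0"
proof -
  have "\<pi> (\<delta> z) = \<delta> (\<pi> (z * z))" using z_unit(1)[of z] pi_equivariant[OF \<delta>] by simp
  also have "\<dots> = \<pi> (\<delta> z * z) + \<pi> (z * \<delta> z)"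
    by (simp add: pi_equivariant[OF \<delta>, symmetric] derivationD[OF \<delta>] lin_add[OF pi_lin])
  also have "\<dots> = \<pi> (\<delta> z) + \<pi> (\<delta> z)" by (simp add: z_unit)
  finally show ?thesis by simp
qed

lemma beta_invariant:
  assumes \<delta>: "\<delta> \<in> \<Delta>" shows "\<beta> (\<delta> u) v = \<beta> u (- \<delta> v)"
  using mult_trace_derivation[OF derivations[OF \<delta>] pi_equivariant[OF \<delta>], of "u * v"]
  by (simp add: derivationD[OF \<delta>] lin_add[OF functional_mult_trace] lin_neg[OF functional_mult_trace]
      eq_neg_iff_add_eq_0)

definition two_sided_ideal :: "'a set \<Rightarrow> bool" where
  "two_sided_ideal I \<longleftrightarrow> subspace I \<and> (\<forall>x\<in>I. \<forall>a. a * x \<in> I \<and> x * a \<in> I)"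

definition defect :: "('a \<Rightarrow> 'a) \<Rightarrow> 'a \<Rightarrow> 'a \<Rightarrow> 'a" where
  "defect s u v = s u * s v - s (u * v)"

text \<open>
  An equivariant linear section of the quotient modulo \<open>J\<close>, written as a map on \<open>A\<close> that factors
  through \<open>\<pi>\<close>, which is multiplicative modulo the ideal \<open>I\<close>.
\<close>

definition lifting :: "('a \<Rightarrow> 'a) \<Rightarrow> 'a set \<Rightarrow> bool" where
  "lifting s I \<longleftrightarrow> lin s \<and> (\<forall>v. s (\<pi> v) = s v) \<and> (\<forall>v. \<pi> (s v) = \<pi> v) \<and>
     (\<forall>\<delta>\<in>\<Delta>. \<forall>v. s (\<delta> v) = \<delta> (s v)) \<and> two_sided_ideal I \<and> I \<subseteq> J \<and> (\<forall>u v. defect s u v \<in> I)"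

text \<open>
  Write \<open>f\<close> for the defect of \<open>s\<close>. It satisfies the Hochschild cocycle identity exactly, and \<open>s\<close> is
  multiplicative modulo \<open>I\<close>, so modulo \<open>I\<^sup>2\<close> the values of \<open>f\<close> may be multiplied by \<open>s(u) s(v)\<close> as if by
  \<open>s(u v)\<close>. Contraction with the separability idempotent, \<open>X u = \<Sum> s(b) f(d b, u)\<close>, has
  coboundary \<open>s(z) f\<close>. This differs from \<open>f\<close> because \<open>z\<close> need not act as a unit on the bimodule \<open>I\<close>; the
  missing part \<open>f - s(z) f\<close> is the coboundary of \<open>Y u = s(z) f(z, u) - f(z, u)\<close>, the contribution of the
  complementary idempotent \<open>1 - z\<close> after adjoining a unit. Hence \<open>s - (X + Y)\<close> has defect in \<open>I\<^sup>2\<close>. Both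
  \<open>X\<close> and \<open>Y\<close> are equivariant because derivations annihilate the separability idempotent and \<open>z\<close>.
\<close>

lemma lifting_step:
  assumes "lifting s I"
  shows "\<exists>s'. lifting s' (ideal_square I)"
proof -
  have ls: "lin s" and s_pi: "s (\<pi> v) = s v" and pi_s: "\<pi> (s v) = \<pi> v"
    and s_eq: "\<delta> \<in> \<Delta> \<Longrightarrow> s (\<delta> v) = \<delta> (s v)"
    and I: "subspace I" "x \<in> I \<Longrightarrow> a * x \<in> I" "x \<in> I \<Longrightarrow> x * a \<in> I" "I \<subseteq> J"
    and def: "defect s u v \<in> I" for u v \<delta> x a
    using assms by (auto simp: lifting_def two_sided_ideal_def)
  let ?f = "defect s" and ?I2 = "ideal_square I"
  note D = dual_basesD[OF dual_B]
  have I2: "x * y \<in> ?I2" if "x \<in> I" "y \<in> I" for x y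
    unfolding ideal_square_def using that by (intro span_base) blast
  have sI2: "subspace ?I2" by (simp add: ideal_square_def)
  have s_cong: "s u = s v" if "\<pi> u = \<pi> v" for u v using s_pi that by metis
  have s_pi_mult: "s (\<pi> u * v) = s (u * v)" "s (u * \<pi> v) = s (u * v)" for u v
    by (rule s_cong; simp add: pi_mult)+
  have f_pi: "?f (\<pi> u) v = ?f u v" "?f u (\<pi> v) = ?f u v" for u v
    by (simp_all add: defect_def s_pi s_pi_mult)
  have s_z: "s (z * u) = s u" "s (u * z) = s u" for u by (rule s_cong; simp add: z_unit)+
  have lf: "lin (?f u)" "lin (\<lambda>u. ?f u v)" for u v
    unfolding defect_def
    by (intro lin_minus lin_comp[OF lin_left_mult ls] lin_comp[OF lin_right_mult ls]
      lin_comp[OF ls lin_left_mult] lin_comp[OF ls lin_right_mult])+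
  have cocyc: "s u * ?f v w + ?f u (v * w) = ?f u v * s w + ?f (u * v) w" for u v w
    by (simp add: defect_def algebra_simps)
  have ss: "s u * s v = s (u * v) + ?f u v" for u v by (simp add: defect_def)
  define X where "X u = (\<Sum>b\<in>B. s b * ?f (d b) u)" for u
  define Y where "Y u = s z * ?f z u - ?f z u" for u
  define s' where "s' u = s u - (X u + Y u)" for u
  define F where "F = (\<Sum>b\<in>B. ?f b (d b))"
  have XI: "X u \<in> I" and YI: "Y u \<in> I" and FI: "F \<in> I" for u
    unfolding X_def Y_def F_def using I def by (auto intro!: subspace_sum subspace_diff)
  have lX: "lin X" unfolding X_def by (intro lin_sums lin_comp[OF lf(1) lin_left_mult])
  have lY: "lin Y" unfolding Y_def by (intro lin_minus lf lin_comp[OF lf(1) lin_left_mult])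
  have ls': "lin s'" unfolding s'_def by (intro lin_minus lin_plus ls lX lY)
  \<comment> \<open>The coboundaries of \<open>X\<close> and \<open>Y\<close>, as exact identities with explicit terms in \<open>I\<^sup>2\<close>.\<close>
  have mod1: "s u * X v + X u * s v - X (u * v) =
      (\<Sum>b\<in>B. ?f u b * ?f (d b) v) + F * ?f u v + s z * ?f u v" for u v
  proof -
    have "s u * X v = (\<Sum>b\<in>B. s (u * b) * ?f (d b) v) + (\<Sum>b\<in>B. ?f u b * ?f (d b) v)"
      unfolding X_def sum_distrib_left sum.distrib[symmetric]
      by (intro sum.cong refl) (simp add: mult.assoc[symmetric] ss distrib_right)
    also have "(\<Sum>b\<in>B. s (u * b) * ?f (d b) v) = (\<Sum>b\<in>B. s b * ?f (d b * u) v)"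
    proof -
      have "(\<Sum>b\<in>B. s (\<pi> (u * b)) * ?f (d b) v) = (\<Sum>b\<in>B. s b * ?f (\<pi> (d b * u)) v)"
      proof (rule dual_bases_adjoint[OF dual_B, of "\<lambda>w. \<pi> (u * w)" "\<lambda>w. \<pi> (w * u)" scale "\<lambda>p q. s p * ?f q v"])
        show "\<beta> (\<pi> (u * p)) q = \<beta> p (\<pi> (q * u))" for p q
          using mult_trace_commute[of u "p * q"] by (simp add: beta_pi mult.assoc)
        show "lin (\<lambda>q. s p * ?f q v)" for p by (rule lin_comp[OF lf(2) lin_left_mult])
        show "lin (\<lambda>p. s p * ?f q v)" for q by (rule lin_comp[OF ls lin_right_mult])
      qed auto
      then show ?thesis by (simp add: s_pi f_pi)
    qed
    finally have 1: "s u * X v = (\<Sum>b\<in>B. s b * ?f (d b * u) v) + (\<Sum>b\<in>B. ?f u b * ?f (d b) v)" .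
    have "X u * s v = (\<Sum>b\<in>B. s b * (?f (d b) u * s v))"
      by (simp add: X_def sum_distrib_right mult.assoc)
    also have "\<dots> = (\<Sum>b\<in>B. s b * s (d b) * ?f u v + s b * ?f (d b) (u * v) - s b * ?f (d b * u) v)"
    proof (intro sum.cong refl)
      fix b
      have e: "?f (d b) u * s v = s (d b) * ?f u v + ?f (d b) (u * v) - ?f (d b * u) v"
        using cocyc[of "d b" u v] by (simp add: algebra_simps)
      then show "s b * (?f (d b) u * s v) = s b * s (d b) * ?f u v + s b * ?f (d b) (u * v) - s b * ?f (d b * u) v"
        unfolding e by (simp add: distrib_left right_diff_distrib mult.assoc)
    qed
    also have "\<dots> = (\<Sum>b\<in>B. s b * s (d b)) * ?f u v + X (u * v) - (\<Sum>b\<in>B. s b * ?f (d b * u) v)"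
      by (simp add: X_def sum_subtractf sum.distrib sum_distrib_right)
    also have "(\<Sum>b\<in>B. s b * s (d b)) = s z + F"
      by (simp add: ss F_def z_def sum.distrib lin_sum[OF ls])
    finally show ?thesis using 1 by (simp add: algebra_simps)
  qed
  have mod2: "s u * Y v + Y u * s v - Y (u * v) =
      ?f u z * ?f z v + ?f z z * ?f u v - s z * ?f u v + ?f u v" for u v
  proof -
    have "?f (z * u) v = ?f u v" using f_pi(1)[of "z * u" v] f_pi(1)[of u v] z_unit(1)[of u] by simp
    then have G: "?f z u * s v - ?f z (u * v) = s z * ?f u v - ?f u v"
      using cocyc[of z u v] by (simp add: algebra_simps)
    have "s u * Y v = (s u * s z) * ?f z v - s u * ?f z v" by (simp add: Y_def algebra_simps)
    also have "\<dots> = ?f u z * ?f z v" by (simp add: ss s_z algebra_simps)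
    finally have 1: "s u * Y v = ?f u z * ?f z v" .
    have "Y u * s v - Y (u * v) = s z * (?f z u * s v - ?f z (u * v)) - (?f z u * s v - ?f z (u * v))"
      by (simp add: Y_def algebra_simps)
    also have "\<dots> = (s z * s z) * ?f u v - s z * ?f u v - (s z * ?f u v - ?f u v)"
      unfolding G by (simp add: algebra_simps)
    also have "\<dots> = ?f z z * ?f u v - s z * ?f u v + ?f u v" by (simp add: ss s_z algebra_simps)
    finally show ?thesis using 1 by (simp add: algebra_simps)
  qed
  have "defect s' u v \<in> ?I2" for u v
  proof -
    have "defect s' u v = ?f u v - (s u * X v + X u * s v - X (u * v))
        - (s u * Y v + Y u * s v - Y (u * v)) + (X u + Y u) * (X v + Y v)"
      by (simp add: defect_def s'_def lin_sum algebra_simps)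
    also have "\<dots> = (X u + Y u) * (X v + Y v)
        - ((\<Sum>b\<in>B. ?f u b * ?f (d b) v) + F * ?f u v + ?f u z * ?f z v + ?f z z * ?f u v)"
      unfolding mod1 mod2 by (simp add: algebra_simps)
    also have "\<dots> \<in> ?I2"
      by (intro subspace_diff[OF sI2] subspace_add[OF sI2] subspace_sum[OF sI2] I2 subspace_add[OF I(1)] XI YI FI def)
    finally show ?thesis .
  qed
  moreover have "s' (\<pi> v) = s' v" for v by (simp add: s'_def X_def Y_def s_pi f_pi)
  moreover have "\<pi> (s' v) = \<pi> v" for v
  proof -
    have "X v + Y v \<in> J" using XI YI I(4) subspace_add[OF I(1)] by blast
    then show ?thesis using pi_J by (simp add: s'_def lin_diff[OF pi_lin] pi_s)
  qed
  moreover have "s' (\<delta> v) = \<delta> (s' v)" if \<delta>: "\<delta> \<in> \<Delta>" for \<delta> v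
  proof -
    note d' = derivationD[OF \<delta>] and sd = s_eq[OF \<delta>]
    have df: "\<delta> (?f u v) = ?f (\<delta> u) v + ?f u (\<delta> v)" for u v
      by (simp add: defect_def lin_diff[OF d'(1)] d'(2) sd[symmetric] lin_add[OF ls] algebra_simps)
    have fz: "?f (\<delta> z) v = 0" for v
      using f_pi(1)[of "\<delta> z" v] z_invariant[OF \<delta>] lin_zero[OF lf(2)] by simp
    have sz: "s (\<delta> z) = 0" using s_pi[of "\<delta> z"] z_invariant[OF \<delta>] lin_zero[OF ls] by simp
    have "\<delta> (Y v) = Y (\<delta> v)"
      by (simp add: Y_def lin_diff[OF d'(1)] d'(2) df fz sd[symmetric] sz)
    moreover have "\<delta> (X v) = X (\<delta> v)"
    proof -
      have dV: "\<delta> u \<in> V" "- \<delta> u \<in> V" if "u \<in> V" for u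
        using that pi_equivariant[OF \<delta>] lin_neg[OF pi_lin] by (metis pi_V rangeI)+
      have "(\<Sum>b\<in>B. s (\<delta> b) * ?f (d b) v) = (\<Sum>b\<in>B. s b * ?f (- \<delta> (d b)) v)"
      proof (rule dual_bases_adjoint[OF dual_B, of \<delta> "\<lambda>u. - \<delta> u" scale "\<lambda>p q. s p * ?f q v"])
        show "lin (\<lambda>q. s p * ?f q v)" for p by (rule lin_comp[OF lf(2) lin_left_mult])
        show "lin (\<lambda>p. s p * ?f q v)" for q by (rule lin_comp[OF ls lin_right_mult])
      qed (use dV beta_invariant[OF \<delta>] in auto)
      also have "\<dots> = - (\<Sum>b\<in>B. s b * ?f (\<delta> (d b)) v)"
        by (simp add: lin_neg[OF lf(2)] sum_negf)
      finally have "(\<Sum>b\<in>B. s (\<delta> b) * ?f (d b) v) + (\<Sum>b\<in>B. s b * ?f (\<delta> (d b)) v) = 0" by simp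
      then show ?thesis
        by (simp add: X_def lin_sum[OF d'(1)] d'(2) df sd[symmetric] distrib_left sum.distrib add.assoc[symmetric])
    qed
    ultimately show ?thesis by (simp add: s'_def lin_diff[OF d'(1)] lin_add[OF d'(1)] sd)
  qed
  moreover have "two_sided_ideal ?I2"
    unfolding two_sided_ideal_def
  proof (intro conjI ballI allI sI2)
    fix x a assume "x \<in> ?I2"
    then show "a * x \<in> ?I2" "x * a \<in> ?I2"
      unfolding ideal_square_def
    proof (induction rule: span_induct_alt)
      case base
      { case 1 then show ?case by (simp add: span_zero) }
      { case 2 then show ?case by (simp add: span_zero) }
    next
      case (step c x y)
      then obtain p q where pq: "x = p * q" "p \<in> I" "q \<in> I" by blast
      have "a * x = (a * p) * q" "x * a = p * (q * a)" by (simp_all add: pq mult.assoc)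
      moreover have "a * p \<in> I" "q * a \<in> I" using I(2,3) pq by blast+
      ultimately have m: "a * x \<in> span {x * y |x y. x \<in> I \<and> y \<in> I}" "x * a \<in> span {x * y |x y. x \<in> I \<and> y \<in> I}"
        using pq(2,3) by (metis (mono_tags, lifting) mem_Collect_eq span_base)+
      { case 1 then show ?case using m step by (simp add: distrib_left scale_mult_right span_add span_scale) }
      { case 2 then show ?case using m step by (simp add: distrib_right scale_mult_left span_add span_scale) }
    qed
  qed
  moreover have "?I2 \<subseteq> J"
    unfolding ideal_square_def using I by (intro span_minimal subspace_J) auto
  ultimately show ?thesis using ls' unfolding lifting_def by blast
qed

text \<open>
  Start with \<open>s = \<pi>\<close>, \<open>I = J\<close> and choose a lifting whose ideal has least dimension. As \<open>I\<close> is nil,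
  \<open>I\<^sup>2\<close> would be smaller unless \<open>I = 0\<close>.
\<close>

lemma lifting_hom_exists: "\<exists>s. lifting s {0}"
proof -
  have "lifting \<pi> J"
    unfolding lifting_def two_sided_ideal_def defect_def
    using pi_lin pi_idem pi_equivariant subspace_J J_left J_right
    by (auto simp: pi_zero_iff[symmetric] lin_diff[OF pi_lin] pi_mult)
  then have "\<exists>I s. lifting s I" by blast
  then obtain I where I: "\<exists>s. lifting s I" and min: "\<And>I'. (\<exists>s. lifting s I') \<Longrightarrow> dim I \<le> dim I'"
    using ex_has_least_nat[of "\<lambda>I. \<exists>s. lifting s I" _ dim] by blast
  then obtain s where s: "lifting s I" by blast
  have "I = {0}"
  proof (rule ccontr)
    assume I0: "I \<noteq> {0}"
    have "subalgebra I" "\<And>x. x \<in> I \<Longrightarrow> nilp x" "subspace I"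
      using s J_nil by (auto simp: lifting_def two_sided_ideal_def subalgebra_def)
    then have "dim (ideal_square I) < dim I"
      using nil_square_proper[OF _ _ I0] fdim_psubset_dim[OF fdim_all, of I "ideal_square I"]
      by (simp add: ideal_square_def)
    moreover have "dim I \<le> dim (ideal_square I)" using lifting_step[OF s] by (rule min)
    ultimately show False by linarith
  qed
  then show ?thesis using s by blast
qed

lemma npow_mod_J: "x - y \<in> J \<Longrightarrow> npow x n - npow y n \<in> J"
proof (induction n)
  case (Suc n)
  have "npow x (Suc n) - npow y (Suc n) = (npow x n - npow y n) * x + npow y n * (x - y)"
    by (simp add: algebra_simps)
  then show ?case using Suc J_left J_right subspace_add[OF subspace_J] by simp
qed simp

text \<open>
  The image \<open>S\<close> of a multiplicative equivariant section. The sum of \<open>J\<close> and the radical of \<open>S\<close> is a nil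
  left ideal, hence contained in \<open>J\<close>, so the radical of \<open>S\<close> lies in \<open>S \<inter> J = 0\<close>. If a semisimple \<open>C\<close> contains
  \<open>S\<close>, then \<open>C \<inter> J\<close> is a nil left ideal of \<open>C\<close>, so it is zero and \<open>C = S\<close>.
\<close>

theorem invariant_wedderburn_complement:
  "\<exists>S. maximal_semisimple_subalgebra S \<and> (\<forall>\<delta>\<in>\<Delta>. \<delta> ` S \<subseteq> S) \<and> S \<inter> J = {0} \<and>
     {v + w | v w. v \<in> S \<and> w \<in> J} = UNIV"
proof -
  obtain s where "lifting s {0}" using lifting_hom_exists by blast
  then have ls: "lin s" and pi_s: "\<pi> (s v) = \<pi> v" and s_pi: "s (\<pi> v) = s v"
    and s_eq: "\<delta> \<in> \<Delta> \<Longrightarrow> s (\<delta> v) = \<delta> (s v)" and hom: "s u * s v = s (u * v)" for u v \<delta>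
    by (auto simp: lifting_def defect_def)
  let ?S = "range s"
  have sS: "subspace ?S" by (intro subspace_image ls subspace_UNIV)
  have S: "subalgebra ?S" unfolding subalgebra_def using sS hom by auto
  have ss: "s (s v) = s v" for v using s_pi[of "s v"] s_pi[of v] pi_s by simp
  have diff: "v - s v \<in> J" for v by (simp add: pi_zero_iff[symmetric] lin_diff[OF pi_lin] pi_s)
  have sJ: "s v = 0" if "v \<in> J" for v using s_pi[of v] pi_J[OF that] lin_zero[OF ls] by simp
  have int: "?S \<inter> J = {0}"
  proof -
    have "x = 0" if "x \<in> ?S" "x \<in> J" for x using that ss sJ by (metis rangeE)
    then show ?thesis using subspace_0[OF sS] subspace_0[OF subspace_J] by blast
  qed
  have "jacobson_radical ?S = {0}"
  proof -
    let ?K = "jacobson_radical ?S"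
    have K: "subspace ?K" "?K \<subseteq> ?S" "\<And>r x. r \<in> ?S \<Longrightarrow> x \<in> ?K \<Longrightarrow> r * x \<in> ?K"
      using left_ideal_jacobson_radical[OF S] by (auto simp: left_ideal_def)
    let ?N = "{x + y | x y. x \<in> ?K \<and> y \<in> J}"
    have "left_ideal UNIV ?N"
      unfolding left_ideal_def
    proof (intro conjI ballI)
      show "subspace ?N" by (rule subspace_sums[OF K(1) subspace_J])
      fix a w assume "w \<in> ?N"
      then obtain x y where w: "w = x + y" "x \<in> ?K" "y \<in> J" by blast
      have "a * w = s a * x + ((a - s a) * x + a * y)" by (simp add: w algebra_simps)
      moreover have "(a - s a) * x + a * y \<in> J" using J_left J_right diff w subspace_add[OF subspace_J] by blast
      moreover have "s a * x \<in> ?K" using K(3) w by blast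
      ultimately show "a * w \<in> ?N" by blast
    qed simp
    moreover have "nilp w" if w: "w \<in> ?N" for w
    proof -
      obtain x y where xy: "w = x + y" "x \<in> ?K" "y \<in> J" using w by blast
      obtain n where "npow x n = 0" using jacobson_radical_nil[OF S xy(2)] by (auto simp: nilp_def)
      then have "npow w n \<in> J" using npow_mod_J[of w x n] xy by simp
      then show ?thesis using J_nil nilp_npow by blast
    qed
    ultimately have "?N \<subseteq> J" by (rule nil_left_ideal_subset_radical[OF subalgebra_UNIV])
    moreover have "?K \<subseteq> ?N" using subspace_0[OF subspace_J] by force
    ultimately have "?K \<subseteq> {0}" using K(2) int by blast
    then show ?thesis using subspace_0[OF K(1)] by blast
  qed
  then have ssS: "semisimple_subalgebra ?S" using S by (simp add: semisimple_subalgebra_def)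
  have "C = ?S" if C: "semisimple_subalgebra C" "?S \<subseteq> C" for C
  proof -
    have C': "subalgebra C" "jacobson_radical C = {0}" using C by (auto simp: semisimple_subalgebra_def)
    have sC: "subspace C" using C' by (simp add: subalgebra_def)
    have "left_ideal C (C \<inter> J)"
      using C' J_left subspace_inter[OF sC subspace_J] by (auto simp: left_ideal_def subalgebra_def)
    then have CJ: "C \<inter> J \<subseteq> {0}"
      using nil_left_ideal_subset_radical[OF C'(1), of "C \<inter> J"] J_nil C'(2) by auto
    have "c \<in> ?S" if c: "c \<in> C" for c
    proof -
      have "c - s c \<in> C \<inter> J" using c C(2) diff subspace_diff[OF sC] by blast
      then have "c = s c" using CJ by auto
      then show ?thesis by (metis rangeI)
    qed
    then show ?thesis using C(2) by blast
  qed
  then have "maximal_semisimple_subalgebra ?S" using ssS by (simp add: maximal_semisimple_subalgebra_def)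
  moreover have "\<delta> ` ?S \<subseteq> ?S" if \<delta>: "\<delta> \<in> \<Delta>" for \<delta>
  proof -
    have "\<delta> (s v) \<in> ?S" for v using rangeI[of s "\<delta> v"] by (simp add: s_eq[OF \<delta>])
    then show ?thesis by blast
  qed
  moreover have "{v + w | v w. v \<in> ?S \<and> w \<in> J} = UNIV"
  proof -
    have "v = s v + (v - s v)" for v by simp
    then show ?thesis using diff by blast
  qed
  ultimately show ?thesis using int by blast
qed

end

text \<open>
  The Lie algebra enters only through an equivariant projection along the radical; the complement is
  then found for the set of all derivations \<open>act x\<close>.
\<close>

theorem theorem4:
  fixes scaleA :: "'k::{alg_closed_field, field_char_0} \<Rightarrow> 'a::ring \<Rightarrow> 'a"
    and basisA :: "'a set"
    and scaleL :: "'k \<Rightarrow> 'l::ab_group_add \<Rightarrow> 'l"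
    and basisL :: "'l set"
    and bracket :: "'l \<Rightarrow> 'l \<Rightarrow> 'l"
    and act :: "'l \<Rightarrow> 'a \<Rightarrow> 'a"
  assumes "associative_algebra scaleA"
    and "finite_dimensional_vector_space scaleA basisA"
    and "lie_algebra scaleL bracket"
    and "finite_dimensional_vector_space scaleL basisL"
    and "lie_algebra.semisimple scaleL bracket"
    and "action_by_derivations scaleA scaleL bracket act"
  shows "\<exists>B. associative_algebra.maximal_semisimple_subalgebra scaleA B \<and>
    action_by_derivations.direct_sum_of_submodules scaleA act B
      (associative_algebra.jacobson_radical scaleA UNIV)"
proof -
  interpret act: action_by_derivations scaleA scaleL bracket act by fact
  interpret FA: finite_dimensional_vector_space scaleA basisA by fact
  interpret FL: finite_dimensional_vector_space scaleL basisL by fact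
  interpret A: char0_fd_algebra scaleA
  proof
    show "act.A.fdim UNIV" unfolding act.A.fdim_def using FA.finite_Basis FA.span_Basis by auto
  qed
  interpret L: semisimple_lie_algebra scaleL bracket
  proof
    show "act.L.fdim UNIV" unfolding act.L.fdim_def using FL.finite_Basis FL.span_Basis by auto
    show "act.L.semisimple" by fact
  qed
  have der: "act.A.derivation (act x)" for x by (rule act.act_derivation)
  have rep: "lie_rep scaleL bracket scaleA UNIV act"
    using der A.fdim_UNIV
    by (intro lie_rep.intro lie_rep_axioms.intro L.fd_lie_algebra_axioms act.A.lin_space_axioms)
      (auto simp: act.A.derivation_def act.act_add act.act_scale act.act_bracket)
  have J_act: "act x v \<in> A.J" if "v \<in> A.J" for x v
    by (rule A.derivation_preserves_radical[OF der that])
  obtain \<pi> where \<pi>: "act.A.lin \<pi>" "\<forall>v. v - \<pi> v \<in> A.J" "\<forall>v \<in> A.J. \<pi> v = 0"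
    "\<forall>x v. \<pi> (act x v) = act x (\<pi> v)"
    using L.equivariant_projection_exists[OF rep A.subspace_J J_act] by blast
  interpret E: equivariant_radical_projection scaleA \<pi> "range act"
  proof (intro equivariant_radical_projection.intro equivariant_radical_projection_axioms.intro
      A.char0_fd_algebra_axioms \<pi>(1))
    fix x \<delta>
    show "x - \<pi> x \<in> A.J" using \<pi>(2) by blast
    show "\<pi> x = 0" if "x \<in> A.J" using \<pi>(3) that by blast
    assume "\<delta> \<in> range act"
    then obtain y where y: "\<delta> = act y" by blast
    show "act.A.derivation \<delta>" unfolding y by (rule der)
    show "\<pi> (\<delta> x) = \<delta> (\<pi> x)" unfolding y using \<pi>(4) by blast
  qed
  obtain S where S: "act.A.maximal_semisimple_subalgebra S" "\<forall>\<delta>\<in>range act. \<delta> ` S \<subseteq> S"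
    "S \<inter> A.J = {0}" "{v + w | v w. v \<in> S \<and> w \<in> A.J} = UNIV"
  proof -
    have "\<exists>S. act.A.maximal_semisimple_subalgebra S \<and> (\<forall>\<delta>\<in>range act. \<delta> ` S \<subseteq> S) \<and> S \<inter> A.J = {0} \<and>
        {v + w | v w. v \<in> S \<and> w \<in> A.J} = UNIV"
      by (rule E.invariant_wedderburn_complement)
    then show ?thesis using that by blast
  qed
  have "act.A.subspace S"
    using S(1) by (simp add: act.A.maximal_semisimple_subalgebra_def act.A.semisimple_subalgebra_def act.A.subalgebra_def)
  moreover have "act x v \<in> S" if "v \<in> S" for x v using S(2) that by blast
  ultimately have "act.submodule S" by (simp add: act.submodule_def)
  moreover have "act.submodule A.J" using J_act A.subspace_J by (simp add: act.submodule_def)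
  ultimately have "act.direct_sum_of_submodules S A.J"
    using S(3,4) by (simp add: act.direct_sum_of_submodules_def)
  then show ?thesis using S(1) by blast
qed

end
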